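(* Let $W_1,\dots,W_k$ be subgroups of $S_d$ and let $\chi_m\colon W_m\to K$ be a one-dimensional character of $W_m$, $m=1,\dots,k$. Let $I_m$ be a left transversal of $W_m$ in $S_d$, let $I=I_1\times\cdots\times I_k$ with the $S_d$-action $s$ described in the context, and let $T(W_1,\dots,W_k)\subseteq I$ be a system of distinct representatives of the $S_d$-orbits in $I$. Then there is an isomorphism of $K$-linear representations of $S_d$ $$ \mathrm{ind}_{W_1}^{S_d}(\chi_1)\otimes_K \mathrm{ind}_{W_2}^{S_d}(\chi_2)\otimes_K\cdots\otimes_K \mathrm{ind}_{W_k}^{S_d}(\chi_k)\;\simeq\;\bigoplus_{(\omega_1,\dots,\omega_k)\in T(W_1,\dots,W_k)}\mathrm{ind}_{\omega_1W_1\omega_1^{-1}\cap\cdots\cap\omega_kW_k\omega_k^{-1}}^{S_d}\bigl(\psi_{(\omega_1,\dots,\omega_k)}\bigr), $$ where $\psi_{(\omega_1,\dots,\omega_k)}$ is the one-dimensional character of the group $\omega_1W_1\omega_1^{-1}\cap\cdots\cap\omega_kW_k\omega_k^{-1}$ which is the restriction to this group of the function $$ \beta_\omega(\zeta)=\chi_1\bigl((s_1(\zeta)(\omega_1))^{-1}\zeta\omega_1\bigr)\cdots\chi_k\bigl((s_k(\zeta)(\omega_k))^{-1}\zeta\omega_k\bigr),\qquad \zeta\in S_d . $$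
   Context: $K$ is an algebraically closed field of characteristic zero; $d,k\ge 1$; $S_d$ is the symmetric group. A one-dimensional character of a group $W$ is a homomorphism $\chi\colon W\to K^*$, and $K_\chi$ is $K$ with $W$ acting by $\sigma c=\chi(\sigma)c$. For $W\le S_d$, $\mathrm{ind}_W^{S_d}(\chi)=KS_d\otimes_{KW}K_\chi$. The tensor product over $K$ carries the diagonal $S_d$-action. For each $m$, $s_m\colon S_d\to S(I_m)$ (the symmetric group on the set $I_m$) is the homomorphism determined by: $s_m(\zeta)(i)$ is the unique $j\in I_m$ with $j^{-1}\zeta i\in W_m$. The action $s\colon S_d\to S(I)$ on $I=I_1\times\cdots\times I_k$ is $s(\zeta)(i_1,\dots,i_k)=(s_1(\zeta)(i_1),\dots,s_k(\zeta)(i_k))$. The stabilizer of $(\omega_1,\dots,\omega_k)\in I$ in $S_d$ is $\omega_1W_1\omega_1^{-1}\cap\cdots\cap\omega_kW_k\omega_k^{-1}$, and on this stabilizer $\psi_{(\omega_1,\dots,\omega_k)}(\zeta)=\prod_m\chi_m(\omega_m^{-1}\zeta\omega_m)$. *)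

theory Defs
  imports "HOL-Algebra.Algebra"
begin

section \<open>Linear representations\<close>

text \<open>The fields mult and one that a module record inherits from rings are not used in a
  representation and are left undefined below.\<close>

record ('a, 'v, 'g) rep = "('a, 'v) module" +
  act :: "'g \<Rightarrow> 'v \<Rightarrow> 'v"

locale linear_representation = G?: group G + K?: field K + V?: module K V
  for G :: "('g, 'm) monoid_scheme" and K :: "('a, 'n) ring_scheme"
    and V :: "('a, 'v, 'g, 'p) rep_scheme" +
  assumes act_closed:
      "\<lbrakk>g \<in> carrier G; v \<in> carrier V\<rbrakk> \<Longrightarrow> act V g v \<in> carrier V"
    and act_add:
      "\<lbrakk>g \<in> carrier G; v \<in> carrier V; w \<in> carrier V\<rbrakk>
        \<Longrightarrow> act V g (v \<oplus>\<^bsub>V\<^esub> w) = act V g v \<oplus>\<^bsub>V\<^esub> act V g w"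
    and act_smult:
      "\<lbrakk>g \<in> carrier G; c \<in> carrier K; v \<in> carrier V\<rbrakk>
        \<Longrightarrow> act V g (c \<odot>\<^bsub>V\<^esub> v) = c \<odot>\<^bsub>V\<^esub> act V g v"
    and act_one:
      "v \<in> carrier V \<Longrightarrow> act V \<one>\<^bsub>G\<^esub> v = v"
    and act_mult:
      "\<lbrakk>g \<in> carrier G; h \<in> carrier G; v \<in> carrier V\<rbrakk>
        \<Longrightarrow> act V (g \<otimes>\<^bsub>G\<^esub> h) v = act V g (act V h v)"

definition rep_isomorphic ::
  "('g, 'm) monoid_scheme \<Rightarrow> ('a, 'n) ring_scheme \<Rightarrow> ('a, 'v, 'g) rep \<Rightarrow> ('a, 'w, 'g) rep \<Rightarrow> bool"
  where "rep_isomorphic G K V V' \<longleftrightarrow>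
    linear_representation G K V \<and> linear_representation G K V' \<and>
    (\<exists>f \<in> iso (add_monoid V) (add_monoid V').
      (\<forall>c \<in> carrier K. \<forall>v \<in> carrier V. f (c \<odot>\<^bsub>V\<^esub> v) = c \<odot>\<^bsub>V'\<^esub> f v) \<and>
      (\<forall>g \<in> carrier G. \<forall>v \<in> carrier V. f (act V g v) = act V' g (f v)))"

definition direct_sum_rep :: "'i set \<Rightarrow> ('i \<Rightarrow> ('a, 'v, 'g) rep) \<Rightarrow> ('a, 'i \<Rightarrow> 'v, 'g) rep"
  where "direct_sum_rep J V =
    \<lparr>carrier = {f \<in> \<Pi>\<^sub>E i\<in>J. carrier (V i). finite {i \<in> J. f i \<noteq> \<zero>\<^bsub>V i\<^esub>}},
     monoid.mult = undefined, one = undefined,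
     ring.zero = (\<lambda>i\<in>J. \<zero>\<^bsub>V i\<^esub>),
     add = (\<lambda>f f'. \<lambda>i\<in>J. f i \<oplus>\<^bsub>V i\<^esub> f' i),
     smult = (\<lambda>c f. \<lambda>i\<in>J. c \<odot>\<^bsub>V i\<^esub> f i),
     act = (\<lambda>g f. \<lambda>i\<in>J. act (V i) g (f i))\<rparr>"

section \<open>Free modules and quotients\<close>

text \<open>Elements of the free module on B are finitely supported functions that vanish outside B.\<close>

definition free_module :: "('a, 'n) ring_scheme \<Rightarrow> 'x set \<Rightarrow> ('a, 'x \<Rightarrow> 'a) module"
  where "free_module K B =
    \<lparr>carrier = {u. (\<forall>x. u x \<in> carrier K) \<and> finite {x. u x \<noteq> \<zero>\<^bsub>K\<^esub>} \<and>
       {x. u x \<noteq> \<zero>\<^bsub>K\<^esub>} \<subseteq> B},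
     monoid.mult = undefined, one = undefined,
     ring.zero = (\<lambda>_. \<zero>\<^bsub>K\<^esub>),
     add = (\<lambda>u v x. u x \<oplus>\<^bsub>K\<^esub> v x),
     smult = (\<lambda>c u x. c \<otimes>\<^bsub>K\<^esub> u x)\<rparr>"

definition basis_elt :: "('a, 'n) ring_scheme \<Rightarrow> 'x \<Rightarrow> 'x \<Rightarrow> 'a"
  where "basis_elt K x = (\<lambda>y. if y = x then \<one>\<^bsub>K\<^esub> else \<zero>\<^bsub>K\<^esub>)"

definition free_rep ::
  "('a, 'n) ring_scheme \<Rightarrow> 'x set \<Rightarrow> ('g \<Rightarrow> 'x \<Rightarrow> 'x) \<Rightarrow> ('a, 'x \<Rightarrow> 'a, 'g) rep"
  where "free_rep K B \<phi> = module.extend (free_module K B)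
    (rep.fields (\<lambda>g u y. finsum K u {x. u x \<noteq> \<zero>\<^bsub>K\<^esub> \<and> \<phi> g x = y}))"

definition submodule_span ::
  "('a, 'n) ring_scheme \<Rightarrow> ('a, 'v, 'p) module_scheme \<Rightarrow> 'v set \<Rightarrow> 'v set"
  where "submodule_span K M S = (\<lambda>N. submodule N K M) hull S"

definition quot_module :: "('a, 'v, 'p) module_scheme \<Rightarrow> 'v set \<Rightarrow> ('a, 'v set) module"
  where "quot_module M N =
    \<lparr>carrier = a_rcosets\<^bsub>M\<^esub> N,
     monoid.mult = undefined, one = undefined,
     ring.zero = N,
     add = set_add M,
     smult = (\<lambda>c C. \<Union>u\<in>C. N +>\<^bsub>M\<^esub> (c \<odot>\<^bsub>M\<^esub> u))\<rparr>"

definition quot_rep :: "('a, 'v, 'g) rep \<Rightarrow> 'v set \<Rightarrow> ('a, 'v set, 'g) rep"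
  where "quot_rep V N = module.extend (quot_module V N)
    (rep.fields (\<lambda>g C. \<Union>u\<in>C. N +>\<^bsub>V\<^esub> act V g u))"

section \<open>Tensor products\<close>

text \<open>The tensor product over K of a finite family is the free module on the product of the
  carriers modulo the relations of multilinearity.\<close>

definition multilinear_relations ::
  "('a, 'n) ring_scheme \<Rightarrow> 'i set \<Rightarrow> ('i \<Rightarrow> ('a, 'v, 'p) module_scheme) \<Rightarrow> (('i \<Rightarrow> 'v) \<Rightarrow> 'a) set"
  where "multilinear_relations K J V =
    (let B = (\<Pi>\<^sub>E j\<in>J. carrier (V j)); F = free_module K B; e = basis_elt K in
      {e (f(j := x \<oplus>\<^bsub>V j\<^esub> y)) \<ominus>\<^bsub>F\<^esub> (e (f(j := x)) \<oplus>\<^bsub>F\<^esub> e (f(j := y))) | f j x y.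
        f \<in> B \<and> j \<in> J \<and> x \<in> carrier (V j) \<and> y \<in> carrier (V j)} \<union>
      {e (f(j := c \<odot>\<^bsub>V j\<^esub> x)) \<ominus>\<^bsub>F\<^esub> c \<odot>\<^bsub>F\<^esub> e (f(j := x)) | f j c x.
        f \<in> B \<and> j \<in> J \<and> c \<in> carrier K \<and> x \<in> carrier (V j)})"

definition tensor_rep ::
  "('a, 'n) ring_scheme \<Rightarrow> 'i set \<Rightarrow> ('i \<Rightarrow> ('a, 'v, 'g) rep) \<Rightarrow> ('a, (('i \<Rightarrow> 'v) \<Rightarrow> 'a) set, 'g) rep"
  where "tensor_rep K J V =
    (let F = free_rep K (\<Pi>\<^sub>E j\<in>J. carrier (V j)) (\<lambda>g f. \<lambda>j\<in>J. act (V j) g (f j))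
     in quot_rep F (submodule_span K F (multilinear_relations K J V)))"

text \<open>For a set A of scalars acting on M from the right (by r) and on N from the left (by l),
  both actions being compatible with K, these relations cut out the tensor product of M and N
  over A as a quotient of the free K-module on pairs.\<close>

definition balanced_relations ::
  "('a, 'n) ring_scheme \<Rightarrow> 's set \<Rightarrow> ('a, 'v, 'p) module_scheme \<Rightarrow> ('v \<Rightarrow> 's \<Rightarrow> 'v)
    \<Rightarrow> ('a, 'w, 'q) module_scheme \<Rightarrow> ('s \<Rightarrow> 'w \<Rightarrow> 'w) \<Rightarrow> ('v \<times> 'w \<Rightarrow> 'a) set"
  where "balanced_relations K A M r N l =
    (let F = free_module K (carrier M \<times> carrier N); e = basis_elt K in
      {e (x \<oplus>\<^bsub>M\<^esub> x', y) \<ominus>\<^bsub>F\<^esub> (e (x, y) \<oplus>\<^bsub>F\<^esub> e (x', y)) | x x' y.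
        x \<in> carrier M \<and> x' \<in> carrier M \<and> y \<in> carrier N} \<union>
      {e (x, y \<oplus>\<^bsub>N\<^esub> y') \<ominus>\<^bsub>F\<^esub> (e (x, y) \<oplus>\<^bsub>F\<^esub> e (x, y')) | x y y'.
        x \<in> carrier M \<and> y \<in> carrier N \<and> y' \<in> carrier N} \<union>
      {e (c \<odot>\<^bsub>M\<^esub> x, y) \<ominus>\<^bsub>F\<^esub> c \<odot>\<^bsub>F\<^esub> e (x, y) | c x y.
        c \<in> carrier K \<and> x \<in> carrier M \<and> y \<in> carrier N} \<union>
      {e (x, c \<odot>\<^bsub>N\<^esub> y) \<ominus>\<^bsub>F\<^esub> c \<odot>\<^bsub>F\<^esub> e (x, y) | c x y.
        c \<in> carrier K \<and> x \<in> carrier M \<and> y \<in> carrier N} \<union>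
      {e (r x a, y) \<ominus>\<^bsub>F\<^esub> e (x, l a y) | x a y.
        x \<in> carrier M \<and> a \<in> A \<and> y \<in> carrier N})"

section \<open>Induced representations of one-dimensional characters\<close>

definition group_algebra ::
  "('a, 'n) ring_scheme \<Rightarrow> ('g, 'm) monoid_scheme \<Rightarrow> ('a, 'g \<Rightarrow> 'a) module"
  where "group_algebra K G = (free_module K (carrier G))
    \<lparr>monoid.mult := (\<lambda>a b x. if x \<in> carrier G
        then \<Oplus>\<^bsub>K\<^esub>y\<in>{y. a y \<noteq> \<zero>\<^bsub>K\<^esub>}. a y \<otimes>\<^bsub>K\<^esub> b (inv\<^bsub>G\<^esub> y \<otimes>\<^bsub>G\<^esub> x) else \<zero>\<^bsub>K\<^esub>),
     one := basis_elt K \<one>\<^bsub>G\<^esub>\<rparr>"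

definition self_module :: "('a, 'n) ring_scheme \<Rightarrow> ('a, 'a) module"
  where "self_module K =
    \<lparr>carrier = carrier K, monoid.mult = monoid.mult K, one = \<one>\<^bsub>K\<^esub>, ring.zero = \<zero>\<^bsub>K\<^esub>, add = add K, smult = monoid.mult K\<rparr>"

text \<open>The action of the group algebra on K through the linear extension of a character.\<close>

definition char_act :: "('a, 'n) ring_scheme \<Rightarrow> ('g \<Rightarrow> 'a) \<Rightarrow> ('g \<Rightarrow> 'a) \<Rightarrow> 'a \<Rightarrow> 'a"
  where "char_act K \<chi> a c =
    (\<Oplus>\<^bsub>K\<^esub>w\<in>{w. a w \<noteq> \<zero>\<^bsub>K\<^esub>}. a w \<otimes>\<^bsub>K\<^esub> (\<chi> w \<otimes>\<^bsub>K\<^esub> c))"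

text \<open>The group algebra of W consists of the elements of the group algebra of G supported in W,
  so it acts on the latter by right multiplication. The group G acts by left multiplication on
  the left tensor factor.\<close>

definition ind_rep ::
  "('g, 'm) monoid_scheme \<Rightarrow> ('a, 'n) ring_scheme \<Rightarrow> 'g set \<Rightarrow> ('g \<Rightarrow> 'a)
    \<Rightarrow> ('a, (('g \<Rightarrow> 'a) \<times> 'a \<Rightarrow> 'a) set, 'g) rep"
  where "ind_rep G K W \<chi> =
    (let KG = group_algebra K G; KW = group_algebra K (G\<lparr>carrier := W\<rparr>);
         F = free_rep K (carrier KG \<times> carrier (self_module K))
               (\<lambda>g (x, c). (basis_elt K g \<otimes>\<^bsub>KG\<^esub> x, c))
     in quot_rep F (submodule_span K F
          (balanced_relations K (carrier KW) KG (monoid.mult KG) (self_module K) (char_act K \<chi>))))"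

section \<open>Transversals and orbits\<close>

definition left_transversal :: "('g, 'm) monoid_scheme \<Rightarrow> 'g set \<Rightarrow> 'g set \<Rightarrow> bool"
  where "left_transversal G W I \<longleftrightarrow>
    I \<subseteq> carrier G \<and> (\<forall>C \<in> lcosets\<^bsub>G\<^esub> W. \<exists>!i. i \<in> I \<and> i \<in> C)"

definition transversal_action ::
  "('g, 'm) monoid_scheme \<Rightarrow> 'g set \<Rightarrow> 'g set \<Rightarrow> 'g \<Rightarrow> 'g \<Rightarrow> 'g"
  where "transversal_action G W I \<zeta> =
    (\<lambda>i\<in>I. THE j. j \<in> I \<and> inv\<^bsub>G\<^esub> j \<otimes>\<^bsub>G\<^esub> \<zeta> \<otimes>\<^bsub>G\<^esub> i \<in> W)"

definition product_action ::
  "('g, 'm) monoid_scheme \<Rightarrow> 'i set \<Rightarrow> ('i \<Rightarrow> 'g set) \<Rightarrow> ('i \<Rightarrow> 'g set) \<Rightarrow> 'g \<Rightarrow> ('i \<Rightarrow> 'g) \<Rightarrow> ('i \<Rightarrow> 'g)"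
  where "product_action G J W I \<zeta> =
    (\<lambda>\<omega> \<in> (\<Pi>\<^sub>E m\<in>J. I m). \<lambda>m\<in>J. transversal_action G (W m) (I m) \<zeta> (\<omega> m))"

definition orbit_representatives ::
  "('g, 'm) monoid_scheme \<Rightarrow> 'x set \<Rightarrow> ('g \<Rightarrow> 'x \<Rightarrow> 'x) \<Rightarrow> 'x set \<Rightarrow> bool"
  where "orbit_representatives G E \<phi> T \<longleftrightarrow>
    T \<subseteq> E \<and> (\<forall>B \<in> orbits G E \<phi>. \<exists>!t. t \<in> T \<and> t \<in> B)"

definition conj_intersection ::
  "('g, 'm) monoid_scheme \<Rightarrow> 'i set \<Rightarrow> ('i \<Rightarrow> 'g set) \<Rightarrow> ('i \<Rightarrow> 'g) \<Rightarrow> 'g set"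
  where "conj_intersection G J W \<omega> = (\<Inter>m\<in>J. \<omega> m <#\<^bsub>G\<^esub> W m #>\<^bsub>G\<^esub> inv\<^bsub>G\<^esub> (\<omega> m))"

text \<open>Only the values of beta on the stabilizer of the tuple are those of a character; elsewhere it
  is just a function on G.\<close>

definition beta ::
  "('g, 'm) monoid_scheme \<Rightarrow> ('a, 'n) ring_scheme \<Rightarrow> 'i set \<Rightarrow> ('i \<Rightarrow> 'g set) \<Rightarrow> ('i \<Rightarrow> 'g set)
    \<Rightarrow> ('i \<Rightarrow> 'g \<Rightarrow> 'a) \<Rightarrow> ('i \<Rightarrow> 'g) \<Rightarrow> 'g \<Rightarrow> 'a"
  where "beta G K J W I \<chi> \<omega> \<zeta> =
    (\<Otimes>\<^bsub>K\<^esub>m\<in>J. \<chi> m (inv\<^bsub>G\<^esub> (transversal_action G (W m) (I m) \<zeta> (\<omega> m)) \<otimes>\<^bsub>G\<^esub> \<zeta> \<otimes>\<^bsub>G\<^esub> \<omega> m))"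

definition psi ::
  "('g, 'm) monoid_scheme \<Rightarrow> ('a, 'n) ring_scheme \<Rightarrow> 'i set \<Rightarrow> ('i \<Rightarrow> 'g set) \<Rightarrow> ('i \<Rightarrow> 'g set)
    \<Rightarrow> ('i \<Rightarrow> 'g \<Rightarrow> 'a) \<Rightarrow> ('i \<Rightarrow> 'g) \<Rightarrow> 'g \<Rightarrow> 'a"
  where "psi G K J W I \<chi> \<omega> = restrict (beta G K J W I \<chi> \<omega>) (conj_intersection G J W \<omega>)"

end

theory Submission
  imports Defs
begin

text \<open>Every representation in sight is monomial: it has a basis which the group permutes up to
  scalars. The representation induced from a character \<open>\<chi>\<close> of W has as basis a transversal I,
  where g sends the basis vector of i to \<open>\<chi> ((s g i)\<^sup>-\<^sup>1 g i)\<close> times that of \<open>s g i\<close>. A tensor product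
  of monomial representations is monomial on the product of the bases, with the product scalars
  \<open>\<beta>\<close>. A monomial representation is the direct sum of its restrictions to the orbits of the basis,
  and a transitive one is induced from the character through which the stabilizer of a basis point
  acts on the line of that point.\<close>

section \<open>Linear maps and free modules\<close>

text \<open>The obstacle is that neither side comes with a basis: induced representations and tensor
  products are quotients of free modules on all pairs, or all tuples, of vectors by the span of the
  defining relations. It has to be shown that these relations suffice, that is, that their span is
  the whole kernel of the evident map to the free module on the expected basis. One criterion,
  \<open>quot_free_rep_isomorphic\<close>, settles this for both constructions. It asks for values
  on the generators that respect the relations, for a chosen generator over each basis point, and
  for a reduction of all generators to the chosen ones.

  The scalars of a monomial representation obey the cocycle identity
  \<open>c (g h) x = c g (h x) c h x\<close>. At a fixed point it becomes multiplicativity, which is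
  why \<beta> gives a character of the stabilizer. The lemma \<open>ind_rep_isomorphic\<close> on
  transitive monomial actions is used twice: on each transversal, to make the factors monomial, and
  on each orbit, to recognize the pieces as induced representations.\<close>

definition linear_on ::
  "('a, 'n) ring_scheme \<Rightarrow> ('a, 'v, 'p) module_scheme \<Rightarrow> ('a, 'w, 'q) module_scheme \<Rightarrow> ('v \<Rightarrow> 'w) \<Rightarrow> bool"
  where "linear_on K M N f \<longleftrightarrow> f \<in> carrier M \<rightarrow> carrier N \<and>
    (\<forall>u\<in>carrier M. \<forall>v\<in>carrier M. f (u \<oplus>\<^bsub>M\<^esub> v) = f u \<oplus>\<^bsub>N\<^esub> f v) \<and>
    (\<forall>c\<in>carrier K. \<forall>u\<in>carrier M. f (c \<odot>\<^bsub>M\<^esub> u) = c \<odot>\<^bsub>N\<^esub> f u)"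

lemma linear_onI:
  assumes "\<And>u. u \<in> carrier M \<Longrightarrow> f u \<in> carrier N"
    and "\<And>u v. \<lbrakk>u \<in> carrier M; v \<in> carrier M\<rbrakk> \<Longrightarrow> f (u \<oplus>\<^bsub>M\<^esub> v) = f u \<oplus>\<^bsub>N\<^esub> f v"
    and "\<And>c u. \<lbrakk>c \<in> carrier K; u \<in> carrier M\<rbrakk> \<Longrightarrow> f (c \<odot>\<^bsub>M\<^esub> u) = c \<odot>\<^bsub>N\<^esub> f u"
  shows "linear_on K M N f"
  using assms unfolding linear_on_def by blast

lemma linear_onD:
  assumes "linear_on K M N f"
  shows "u \<in> carrier M \<Longrightarrow> f u \<in> carrier N"
    and "\<lbrakk>u \<in> carrier M; v \<in> carrier M\<rbrakk> \<Longrightarrow> f (u \<oplus>\<^bsub>M\<^esub> v) = f u \<oplus>\<^bsub>N\<^esub> f v"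
    and "\<lbrakk>c \<in> carrier K; u \<in> carrier M\<rbrakk> \<Longrightarrow> f (c \<odot>\<^bsub>M\<^esub> u) = c \<odot>\<^bsub>N\<^esub> f u"
  using assms unfolding linear_on_def by blast+

lemma linear_on_comp:
  "\<lbrakk>linear_on K M N f; linear_on K N P g\<rbrakk> \<Longrightarrow> linear_on K M P (g \<circ> f)"
  unfolding linear_on_def by (auto simp: Pi_iff)

text \<open>Homogeneity for the scalar zero is enough.\<close>

lemma linear_on_zero:
  assumes "module K M" "module K N" "linear_on K M N f"
  shows "f \<zero>\<^bsub>M\<^esub> = \<zero>\<^bsub>N\<^esub>"
proof -
  interpret M: module K M by fact
  interpret N: module K N by fact
  have "f (\<zero>\<^bsub>K\<^esub> \<odot>\<^bsub>M\<^esub> \<zero>\<^bsub>M\<^esub>) = \<zero>\<^bsub>K\<^esub> \<odot>\<^bsub>N\<^esub> f \<zero>\<^bsub>M\<^esub>"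
    using linear_onD(3)[OF assms(3), of "\<zero>\<^bsub>K\<^esub>" "\<zero>\<^bsub>M\<^esub>"] by (simp del: M.smult_r_null)
  then show ?thesis using linear_onD(1)[OF assms(3)] by simp
qed

text \<open>Rewrites subtraction through the two operations that a linear map preserves by
  definition.\<close>

lemma (in module) minus_eq_smult:
  "\<lbrakk>x \<in> carrier M; y \<in> carrier M\<rbrakk> \<Longrightarrow> x \<ominus>\<^bsub>M\<^esub> y = x \<oplus>\<^bsub>M\<^esub> (\<ominus> \<one>) \<odot>\<^bsub>M\<^esub> y"
  by (simp add: a_minus_def smult_l_minus)

lemma linear_on_minus:
  assumes "module K M" "module K N" "linear_on K M N f" "u \<in> carrier M" "v \<in> carrier M"
  shows "f (u \<ominus>\<^bsub>M\<^esub> v) = f u \<ominus>\<^bsub>N\<^esub> f v"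
proof -
  interpret M: module K M by fact
  interpret N: module K N by fact
  show ?thesis
    using linear_onD[OF assms(3)] assms(4,5) by (simp add: M.minus_eq_smult N.minus_eq_smult)
qed

text \<open>Closure under negatives is the case of the scalar -1.\<close>

lemma (in module) submoduleI':
  assumes "H \<subseteq> carrier M" "\<zero>\<^bsub>M\<^esub> \<in> H"
    and "\<And>a b. \<lbrakk>a \<in> H; b \<in> H\<rbrakk> \<Longrightarrow> a \<oplus>\<^bsub>M\<^esub> b \<in> H"
    and "\<And>a x. \<lbrakk>a \<in> carrier R; x \<in> H\<rbrakk> \<Longrightarrow> a \<odot>\<^bsub>M\<^esub> x \<in> H"
  shows "submodule H R M"
proof (rule submoduleI)
  fix x assume "x \<in> H"
  then have "(\<ominus> \<one>) \<odot>\<^bsub>M\<^esub> x = \<ominus>\<^bsub>M\<^esub> x" "(\<ominus> \<one>) \<odot>\<^bsub>M\<^esub> x \<in> H"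
    using assms by (auto simp: smult_l_minus)
  then show "\<ominus>\<^bsub>M\<^esub> x \<in> H" by simp
qed (use assms in auto)

text \<open>The form in which relations are used: each of them is a difference x - y, and once it
  lies in a submodule, membership passes from y to x.\<close>

lemma (in module) submodule_minusD:
  assumes "submodule H R M" "x \<ominus>\<^bsub>M\<^esub> y \<in> H" "x \<in> carrier M" "y \<in> carrier M" "y \<in> H"
  shows "x \<in> H"
proof -
  have "x = (x \<ominus>\<^bsub>M\<^esub> y) \<oplus>\<^bsub>M\<^esub> y"
    using assms(3,4) by (simp add: a_minus_def M.a_assoc M.l_neg)
  then show ?thesis
    using submoduleE(5)[OF assms(1,2,5)] by simp
qed

section \<open>Free modules and linear extension from the basis\<close>

lemma free_module_simps [simp]:
  "u \<in> carrier (free_module K B) \<longleftrightarrow> (\<forall>x. u x \<in> carrier K) \<and> finite {x. u x \<noteq> \<zero>\<^bsub>K\<^esub>} \<and>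
     {x. u x \<noteq> \<zero>\<^bsub>K\<^esub>} \<subseteq> B"
  "\<zero>\<^bsub>free_module K B\<^esub> = (\<lambda>_. \<zero>\<^bsub>K\<^esub>)"
  "u \<oplus>\<^bsub>free_module K B\<^esub> v = (\<lambda>x. u x \<oplus>\<^bsub>K\<^esub> v x)"
  "c \<odot>\<^bsub>free_module K B\<^esub> u = (\<lambda>x. c \<otimes>\<^bsub>K\<^esub> u x)"
  by (auto simp: free_module_def)

lemma (in cring) free_module_add_closed:
  assumes "u \<in> carrier (free_module R B)" "v \<in> carrier (free_module R B)"
  shows "u \<oplus>\<^bsub>free_module R B\<^esub> v \<in> carrier (free_module R B)"
proof -
  have *: "{x. u x \<oplus> v x \<noteq> \<zero>} \<subseteq> {x. u x \<noteq> \<zero>} \<union> {x. v x \<noteq> \<zero>}" by auto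
  show ?thesis
    using assms finite_subset[OF *] subset_trans[OF *, of B] by auto
qed

lemma (in cring) free_module_smult_closed:
  assumes "c \<in> carrier R" "u \<in> carrier (free_module R B)"
  shows "c \<odot>\<^bsub>free_module R B\<^esub> u \<in> carrier (free_module R B)"
proof -
  have *: "{x. c \<otimes> u x \<noteq> \<zero>} \<subseteq> {x. u x \<noteq> \<zero>}" using assms(1) by auto
  show ?thesis
    using assms finite_subset[OF *] subset_trans[OF *, of B] by auto
qed

lemma (in cring) module_free_module: "module R (free_module R B)"
proof (rule moduleI)
  show "cring R" by (rule is_cring)
  show "abelian_group (free_module R B)"
  proof (rule abelian_groupI)
    fix u assume u: "u \<in> carrier (free_module R B)"
    then have "\<exists>v\<in>carrier (free_module R B). v \<oplus>\<^bsub>free_module R B\<^esub> u = \<zero>\<^bsub>free_module R B\<^esub>"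
      using free_module_smult_closed[of "\<ominus> \<one>" u B]
      by (intro bexI[of _ "(\<ominus> \<one>) \<odot>\<^bsub>free_module R B\<^esub> u"]) (auto simp: l_minus l_neg)
    then show "\<exists>v\<in>carrier (free_module R B). v \<oplus>\<^bsub>free_module R B\<^esub> u = \<zero>\<^bsub>free_module R B\<^esub>" .
  next
    fix u v assume "u \<in> carrier (free_module R B)" "v \<in> carrier (free_module R B)"
    then show "u \<oplus>\<^bsub>free_module R B\<^esub> v \<in> carrier (free_module R B)"
      by (rule free_module_add_closed)
  qed (auto simp: a_ac)
  fix c u assume "c \<in> carrier R" "u \<in> carrier (free_module R B)"
  then show "c \<odot>\<^bsub>free_module R B\<^esub> u \<in> carrier (free_module R B)"
    by (rule free_module_smult_closed)
qed (auto simp: l_distr r_distr m_assoc)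

lemma (in cring) basis_elt_closed: "x \<in> B \<Longrightarrow> basis_elt R x \<in> carrier (free_module R B)"
  by (auto simp: basis_elt_def intro: finite_subset[of _ "{x}"])

text \<open>The cases are the closure properties of a submodule together with the basis vectors. The
  rule therefore shows that a submodule is everything and that linear maps agreeing on the basis are
  equal.\<close>

lemma (in cring) free_module_induct [consumes 1, case_names zero basis smult add]:
  assumes "u \<in> carrier (free_module R B)"
    and zero: "P \<zero>\<^bsub>free_module R B\<^esub>"
    and basis: "\<And>x. x \<in> B \<Longrightarrow> P (basis_elt R x)"
    and smult: "\<And>c u. \<lbrakk>c \<in> carrier R; u \<in> carrier (free_module R B); P u\<rbrakk>
        \<Longrightarrow> P (c \<odot>\<^bsub>free_module R B\<^esub> u)"
    and add: "\<And>u v. \<lbrakk>u \<in> carrier (free_module R B); v \<in> carrier (free_module R B); P u; P v\<rbrakk>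
        \<Longrightarrow> P (u \<oplus>\<^bsub>free_module R B\<^esub> v)"
  shows "P u"
proof -
  have "P u" if "finite A" "u \<in> carrier (free_module R B)" "{x. u x \<noteq> \<zero>} \<subseteq> A" for A u
    using that
  proof (induction A arbitrary: u rule: finite_induct)
    case empty
    then have "u = \<zero>\<^bsub>free_module R B\<^esub>" by auto
    then show ?case using zero by simp
  next
    case (insert a A)
    show ?case
    proof (cases "u a = \<zero>")
      case True
      then show ?thesis using insert.prems insert.hyps by (intro insert.IH) auto
    next
      case False
      then have a: "a \<in> B" using insert.prems by auto
      \<comment> \<open>Deleting \<open>a\<close> from the support splits off the multiple
        \<open>u a\<close> of the basis vector of \<open>a\<close>.\<close>
      define v where "v = u(a := \<zero>)"
      have *: "{x. v x \<noteq> \<zero>} \<subseteq> {x. u x \<noteq> \<zero>}" by (auto simp: v_def)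
      have v: "v \<in> carrier (free_module R B)"
        using insert.prems(1) finite_subset[OF *] subset_trans[OF *, of B] by (auto simp: v_def)
      have uac: "u a \<in> carrier R" using insert.prems by auto
      have "P v" using insert.prems(2) v by (intro insert.IH) (auto simp: v_def split: if_splits)
      moreover have "u = (u a \<odot>\<^bsub>free_module R B\<^esub> basis_elt R a) \<oplus>\<^bsub>free_module R B\<^esub> v"
        using insert.prems(1) by (auto simp: v_def basis_elt_def)
      ultimately show ?thesis
        using add[OF free_module_smult_closed[OF uac basis_elt_closed[OF a]] v
            smult[OF uac basis_elt_closed[OF a] basis[OF a]]] by simp
    qed
  qed
  then show ?thesis using assms(1) by auto
qed

text \<open>The linear map with prescribed values \<open>b\<close> on the basis. Only the support is
  summed over, because the bases of the presentations below can be infinite.\<close>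

definition lin_ext ::
  "('a, 'n) ring_scheme \<Rightarrow> ('a, 'v, 'p) module_scheme \<Rightarrow> ('x \<Rightarrow> 'v) \<Rightarrow> ('x \<Rightarrow> 'a) \<Rightarrow> 'v"
  where "lin_ext K M b u = (\<Oplus>\<^bsub>M\<^esub>y\<in>{y. u y \<noteq> \<zero>\<^bsub>K\<^esub>}. u y \<odot>\<^bsub>M\<^esub> b y)"

text \<open>Different elements have different supports; to compare their images, the sums are taken
  over a common finite set, where the extra terms vanish.\<close>

lemma (in module) lin_ext_eq_finsum:
  assumes "u \<in> carrier (free_module R B)" "b \<in> B \<rightarrow> carrier M"
    and "finite A" "{y. u y \<noteq> \<zero>} \<subseteq> A" "A \<subseteq> B"
  shows "lin_ext R M b u = (\<Oplus>\<^bsub>M\<^esub>y\<in>A. u y \<odot>\<^bsub>M\<^esub> b y)"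
  unfolding lin_ext_def
  using assms by (intro M.add.finprod_mono_neutral_cong_left) (auto simp: Pi_iff subset_iff)

lemma (in module) lin_ext_linear:
  assumes b: "b \<in> B \<rightarrow> carrier M"
  shows "linear_on R (free_module R B) M (lin_ext R M b)"
proof (rule linear_onI)
  fix u assume u: "u \<in> carrier (free_module R B)"
  then show "lin_ext R M b u \<in> carrier M"
    unfolding lin_ext_def using b by (intro M.finsum_closed) (auto simp: Pi_iff subset_iff)
  fix v assume v: "v \<in> carrier (free_module R B)"
  define A where "A = {x. u x \<noteq> \<zero>} \<union> {x. v x \<noteq> \<zero>}"
  have A: "finite A" "A \<subseteq> B" using u v by (auto simp: A_def)
  have uv: "u \<oplus>\<^bsub>free_module R B\<^esub> v \<in> carrier (free_module R B)"
    using u v by (rule free_module_add_closed)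
  have "lin_ext R M b (u \<oplus>\<^bsub>free_module R B\<^esub> v) = (\<Oplus>\<^bsub>M\<^esub>y\<in>A. (u y \<oplus> v y) \<odot>\<^bsub>M\<^esub> b y)"
    by (subst lin_ext_eq_finsum[OF uv b A(1) _ A(2)]) (use u v in \<open>auto simp: A_def\<close>)
  also have "\<dots> = (\<Oplus>\<^bsub>M\<^esub>y\<in>A. u y \<odot>\<^bsub>M\<^esub> b y \<oplus>\<^bsub>M\<^esub> v y \<odot>\<^bsub>M\<^esub> b y)"
    using u v b A by (intro M.finsum_cong') (auto simp: smult_l_distr Pi_iff subset_iff)
  also have "\<dots> = (\<Oplus>\<^bsub>M\<^esub>y\<in>A. u y \<odot>\<^bsub>M\<^esub> b y) \<oplus>\<^bsub>M\<^esub> (\<Oplus>\<^bsub>M\<^esub>y\<in>A. v y \<odot>\<^bsub>M\<^esub> b y)"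
    using u v b A by (intro M.finsum_addf) (auto simp: Pi_iff subset_iff)
  also have "\<dots> = lin_ext R M b u \<oplus>\<^bsub>M\<^esub> lin_ext R M b v"
    using lin_ext_eq_finsum[OF u b A(1) _ A(2)] lin_ext_eq_finsum[OF v b A(1) _ A(2)]
    by (simp add: A_def)
  finally show "lin_ext R M b (u \<oplus>\<^bsub>free_module R B\<^esub> v) = lin_ext R M b u \<oplus>\<^bsub>M\<^esub> lin_ext R M b v" .
next
  fix c u assume c: "c \<in> carrier R" and u: "u \<in> carrier (free_module R B)"
  define A where "A = {x. u x \<noteq> \<zero>}"
  have A: "finite A" "A \<subseteq> B" using u by (auto simp: A_def)
  have cu: "c \<odot>\<^bsub>free_module R B\<^esub> u \<in> carrier (free_module R B)"
    using c u by (rule free_module_smult_closed)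
  have "lin_ext R M b (c \<odot>\<^bsub>free_module R B\<^esub> u) = (\<Oplus>\<^bsub>M\<^esub>y\<in>A. (c \<otimes> u y) \<odot>\<^bsub>M\<^esub> b y)"
    by (subst lin_ext_eq_finsum[OF cu b A(1) _ A(2)]) (use c in \<open>auto simp: A_def\<close>)
  also have "\<dots> = (\<Oplus>\<^bsub>M\<^esub>y\<in>A. c \<odot>\<^bsub>M\<^esub> (u y \<odot>\<^bsub>M\<^esub> b y))"
    using c u b A by (intro M.finsum_cong') (auto simp: smult_assoc1 Pi_iff subset_iff)
  also have "\<dots> = c \<odot>\<^bsub>M\<^esub> (\<Oplus>\<^bsub>M\<^esub>y\<in>A. u y \<odot>\<^bsub>M\<^esub> b y)"
    using c u b A by (intro finsum_smult_ldistr[symmetric]) (auto simp: Pi_iff subset_iff)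
  finally show "lin_ext R M b (c \<odot>\<^bsub>free_module R B\<^esub> u) = c \<odot>\<^bsub>M\<^esub> lin_ext R M b u"
    by (simp add: lin_ext_def A_def)
qed

lemma (in module) lin_ext_basis_elt:
  assumes "x \<in> B" "b \<in> B \<rightarrow> carrier M"
  shows "lin_ext R M b (basis_elt R x) = b x"
proof -
  have "lin_ext R M b (basis_elt R x) = (\<Oplus>\<^bsub>M\<^esub>y\<in>{x}. basis_elt R x y \<odot>\<^bsub>M\<^esub> b y)"
    using assms by (intro lin_ext_eq_finsum[OF basis_elt_closed[OF assms(1)]])
      (auto simp: basis_elt_def)
  also have "\<dots> = b x" using assms by (auto simp: basis_elt_def Pi_iff)
  finally show ?thesis .
qed

text \<open>The uniqueness half of the universal property. Identities that are linear in an element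
  of a free module are reduced to basis vectors by it, in particular all identities in the group
  algebra below.\<close>

lemma (in module) linear_on_free_module_eqI:
  assumes u: "u \<in> carrier (free_module R B)"
    and f: "linear_on R (free_module R B) M f" and g: "linear_on R (free_module R B) M g"
    and eq: "\<And>x. x \<in> B \<Longrightarrow> f (basis_elt R x) = g (basis_elt R x)"
  shows "f u = g u"
  using u
proof (induction rule: free_module_induct)
  case zero
  then show ?case
    using linear_on_zero[OF module_free_module module_axioms] f g by metis
qed (use eq linear_onD[OF f] linear_onD[OF g] in \<open>auto simp del: free_module_simps\<close>)

declare free_module_simps [simp del]

section \<open>Isomorphisms of representations\<close>

text \<open>No axiom is assumed for \<open>V'\<close>. Every element of it is some f x, so each
  axiom is the image under f of the same axiom in \<open>V\<close>. This spares a direct check of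
  the axioms for quotients and direct sums.\<close>

lemma rep_isomorphic_transport:
  assumes V: "linear_representation G K V"
    and bij: "bij_betw f (carrier V) (carrier V')"
    and zero: "f \<zero>\<^bsub>V\<^esub> = \<zero>\<^bsub>V'\<^esub>"
    and add: "\<And>u v. \<lbrakk>u \<in> carrier V; v \<in> carrier V\<rbrakk> \<Longrightarrow> f (u \<oplus>\<^bsub>V\<^esub> v) = f u \<oplus>\<^bsub>V'\<^esub> f v"
    and smult: "\<And>c u. \<lbrakk>c \<in> carrier K; u \<in> carrier V\<rbrakk> \<Longrightarrow> f (c \<odot>\<^bsub>V\<^esub> u) = c \<odot>\<^bsub>V'\<^esub> f u"
    and act: "\<And>g u. \<lbrakk>g \<in> carrier G; u \<in> carrier V\<rbrakk> \<Longrightarrow> f (act V g u) = act V' g (f u)"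
  shows "rep_isomorphic G K V V'"
proof -
  interpret V: linear_representation G K V by fact
  have im: "\<exists>u\<in>carrier V. v = f u" if "v \<in> carrier V'" for v
    using that bij by (auto simp: bij_betw_def)
  have cl: "f u \<in> carrier V'" if "u \<in> carrier V" for u
    using that bij by (auto simp: bij_betw_def)
  have "linear_representation G K V'"
  proof (intro linear_representation.intro linear_representation_axioms.intro moduleI abelian_groupI)
    fix u v assume "u \<in> carrier V'" "v \<in> carrier V'"
    then obtain x y where [simp]: "x \<in> carrier V" "y \<in> carrier V" "u = f x" "v = f y"
      using im by metis
    show "u \<oplus>\<^bsub>V'\<^esub> v \<in> carrier V'" by (simp add: add[symmetric] cl)
    show "u \<oplus>\<^bsub>V'\<^esub> v = v \<oplus>\<^bsub>V'\<^esub> u" by (simp add: add[symmetric] V.M.a_comm)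
    show "c \<odot>\<^bsub>V'\<^esub> (u \<oplus>\<^bsub>V'\<^esub> v) = c \<odot>\<^bsub>V'\<^esub> u \<oplus>\<^bsub>V'\<^esub> c \<odot>\<^bsub>V'\<^esub> v" if "c \<in> carrier K" for c
      using that by (simp add: add[symmetric] smult[symmetric] V.smult_r_distr)
    show "act V' g (u \<oplus>\<^bsub>V'\<^esub> v) = act V' g u \<oplus>\<^bsub>V'\<^esub> act V' g v" if "g \<in> carrier G" for g
      using that by (simp add: add[symmetric] act[symmetric] V.act_add V.act_closed)
    fix w assume "w \<in> carrier V'"
    then obtain z where [simp]: "z \<in> carrier V" "w = f z" using im by metis
    show "u \<oplus>\<^bsub>V'\<^esub> v \<oplus>\<^bsub>V'\<^esub> w = u \<oplus>\<^bsub>V'\<^esub> (v \<oplus>\<^bsub>V'\<^esub> w)"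
      by (simp add: add[symmetric] V.M.a_assoc)
  next
    fix u assume "u \<in> carrier V'"
    then obtain x where [simp]: "x \<in> carrier V" "u = f x" using im by metis
    show "\<zero>\<^bsub>V'\<^esub> \<oplus>\<^bsub>V'\<^esub> u = u" by (simp add: add[symmetric] zero[symmetric])
    show "\<exists>v\<in>carrier V'. v \<oplus>\<^bsub>V'\<^esub> u = \<zero>\<^bsub>V'\<^esub>"
      by (intro bexI[of _ "f (\<ominus>\<^bsub>V\<^esub> x)"])
        (simp_all add: add[symmetric] zero[symmetric] cl V.M.l_neg)
    show "\<one>\<^bsub>K\<^esub> \<odot>\<^bsub>V'\<^esub> u = u" by (simp add: smult[symmetric])
    show "act V' \<one>\<^bsub>G\<^esub> u = u" by (simp add: act[symmetric] V.act_one)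
    show "act V' g u \<in> carrier V'" if "g \<in> carrier G" for g
      using that by (simp add: act[symmetric] cl V.act_closed)
    show "act V' (g \<otimes>\<^bsub>G\<^esub> h) u = act V' g (act V' h u)" if "g \<in> carrier G" "h \<in> carrier G" for g h
      using that by (simp add: act[symmetric] V.act_closed V.act_mult)
    show "c \<odot>\<^bsub>V'\<^esub> u \<in> carrier V'" if "c \<in> carrier K" for c
      using that by (simp add: smult[symmetric] cl)
    show "act V' g (c \<odot>\<^bsub>V'\<^esub> u) = c \<odot>\<^bsub>V'\<^esub> act V' g u" if "g \<in> carrier G" "c \<in> carrier K" for g c
      using that by (simp add: smult[symmetric] act[symmetric] V.act_closed V.act_smult)
    fix a b assume [simp]: "a \<in> carrier K" "b \<in> carrier K"
    show "(a \<oplus>\<^bsub>K\<^esub> b) \<odot>\<^bsub>V'\<^esub> u = a \<odot>\<^bsub>V'\<^esub> u \<oplus>\<^bsub>V'\<^esub> b \<odot>\<^bsub>V'\<^esub> u"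
      by (simp add: smult[symmetric] add[symmetric] V.smult_l_distr)
    show "(a \<otimes>\<^bsub>K\<^esub> b) \<odot>\<^bsub>V'\<^esub> u = a \<odot>\<^bsub>V'\<^esub> (b \<odot>\<^bsub>V'\<^esub> u)"
      by (simp add: smult[symmetric] V.smult_assoc1)
  next
    show "\<zero>\<^bsub>V'\<^esub> \<in> carrier V'" by (simp add: zero[symmetric] cl)
  qed (fact V.G.is_group V.K.field_axioms V.K.is_cring)+
  moreover have "f \<in> iso (add_monoid V) (add_monoid V')"
    using bij add cl by (auto simp: iso_def hom_def)
  ultimately show ?thesis
    using V smult act unfolding rep_isomorphic_def by blast
qed

lemma rep_isomorphicE:
  assumes "rep_isomorphic G K V V'"
  obtains f where "linear_representation G K V" "linear_representation G K V'"
    "bij_betw f (carrier V) (carrier V')" "linear_on K V V' f"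
    "\<And>g u. \<lbrakk>g \<in> carrier G; u \<in> carrier V\<rbrakk> \<Longrightarrow> f (act V g u) = act V' g (f u)"
  using assms unfolding rep_isomorphic_def linear_on_def by (auto simp: iso_def hom_def)

lemma rep_isomorphicI:
  assumes "linear_representation G K V" "linear_representation G K V'"
    "bij_betw f (carrier V) (carrier V')" "linear_on K V V' f"
    "\<And>g u. \<lbrakk>g \<in> carrier G; u \<in> carrier V\<rbrakk> \<Longrightarrow> f (act V g u) = act V' g (f u)"
  shows "rep_isomorphic G K V V'"
proof -
  have "f \<in> iso (add_monoid V) (add_monoid V')"
    using assms(3,4) by (auto simp: iso_def hom_def linear_on_def)
  then show ?thesis
    using assms unfolding rep_isomorphic_def linear_on_def by blast
qed

lemma linear_on_inv_into:
  assumes V: "module K V" and bij: "bij_betw f (carrier V) (carrier V')" and f: "linear_on K V V' f"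
  shows "linear_on K V' V (inv_into (carrier V) f)"
proof -
  interpret V: module K V by fact
  let ?h = "inv_into (carrier V) f"
  have cl: "?h u \<in> carrier V" and fh: "f (?h u) = u" if "u \<in> carrier V'" for u
    using bij that by (auto simp: bij_betw_def inv_into_into f_inv_into_f)
  have hf: "?h (f u) = u" if "u \<in> carrier V" for u
    using bij that by (auto simp: bij_betw_def)
  show ?thesis
  proof (rule linear_onI)
    fix u assume u: "u \<in> carrier V'"
    show "?h u \<in> carrier V" using u by (rule cl)
    show "?h (u \<oplus>\<^bsub>V'\<^esub> v) = ?h u \<oplus>\<^bsub>V\<^esub> ?h v" if v: "v \<in> carrier V'" for v
      using linear_onD(2)[OF f cl[OF u] cl[OF v]] hf[OF V.M.a_closed[OF cl[OF u] cl[OF v]]]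
      by (simp add: fh u v)
    show "?h (c \<odot>\<^bsub>V'\<^esub> u) = c \<odot>\<^bsub>V\<^esub> ?h u" if c: "c \<in> carrier K" for c
      using linear_onD(3)[OF f c cl[OF u]] hf[OF V.smult_closed[OF c cl[OF u]]]
      by (simp add: fh u)
  qed
qed

lemma rep_isomorphic_sym:
  assumes "rep_isomorphic G K V V'"
  shows "rep_isomorphic G K V' V"
proof -
  from assms obtain f where V: "linear_representation G K V" and V': "linear_representation G K V'"
    and bij: "bij_betw f (carrier V) (carrier V')" and lin: "linear_on K V V' f"
    and act: "\<And>g u. \<lbrakk>g \<in> carrier G; u \<in> carrier V\<rbrakk> \<Longrightarrow> f (act V g u) = act V' g (f u)"
    by (rule rep_isomorphicE) blast
  interpret V: linear_representation G K V by fact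
  let ?h = "inv_into (carrier V) f"
  have "?h (act V' g u) = act V g (?h u)" if g: "g \<in> carrier G" and u: "u \<in> carrier V'" for g u
  proof -
    have hu: "?h u \<in> carrier V" and fhu: "f (?h u) = u"
      using bij u by (auto simp: bij_betw_def inv_into_into f_inv_into_f)
    have "?h (f (act V g (?h u))) = act V g (?h u)"
      using bij V.act_closed[OF g hu] by (auto simp: bij_betw_def)
    then show ?thesis by (simp add: act[OF g hu] fhu)
  qed
  then show ?thesis
    using rep_isomorphicI[OF V' V bij_betw_inv_into[OF bij] linear_on_inv_into[OF V.module_axioms bij lin]]
    by blast
qed

lemma rep_isomorphic_trans:
  assumes "rep_isomorphic G K U V" "rep_isomorphic G K V W"
  shows "rep_isomorphic G K U W"
proof -
  from assms(1) obtain f where f: "linear_representation G K U"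
      "bij_betw f (carrier U) (carrier V)" "linear_on K U V f"
      "\<And>g u. \<lbrakk>g \<in> carrier G; u \<in> carrier U\<rbrakk> \<Longrightarrow> f (act U g u) = act V g (f u)"
    by (rule rep_isomorphicE) blast
  from assms(2) obtain h where h: "linear_representation G K W"
      "bij_betw h (carrier V) (carrier W)" "linear_on K V W h"
      "\<And>g u. \<lbrakk>g \<in> carrier G; u \<in> carrier V\<rbrakk> \<Longrightarrow> h (act V g u) = act W g (h u)"
    by (rule rep_isomorphicE) blast
  show ?thesis
    using f(4) h(4) linear_onD(1)[OF f(3)]
    by (intro rep_isomorphicI[OF f(1) h(1) bij_betw_trans[OF f(2) h(2)] linear_on_comp[OF f(3) h(3)]]) auto
qed

section \<open>Quotients of free modules\<close>

lemma submodule_zero_closed: "submodule N K M \<Longrightarrow> \<zero>\<^bsub>M\<^esub> \<in> N"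
  using subgroup.one_closed[OF submodule.axioms(1)] by fastforce

lemma (in module) submodule_Int:
  assumes "submodule H R M" "submodule H' R M"
  shows "submodule (H \<inter> H') R M"
proof (rule submoduleI')
  show "H \<inter> H' \<subseteq> carrier M" using submoduleE(1)[OF assms(1)] by blast
  show "\<zero>\<^bsub>M\<^esub> \<in> H \<inter> H'" using assms by (simp add: submodule_zero_closed)
  show "a \<oplus>\<^bsub>M\<^esub> b \<in> H \<inter> H'" if "a \<in> H \<inter> H'" "b \<in> H \<inter> H'" for a b
    using that submoduleE(5)[OF assms(1)] submoduleE(5)[OF assms(2)] by simp
  show "a \<odot>\<^bsub>M\<^esub> x \<in> H \<inter> H'" if "a \<in> carrier R" "x \<in> H \<inter> H'" for a x
    using that submoduleE(4)[OF assms(1)] submoduleE(4)[OF assms(2)] by simp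
qed

lemma module_extend_simps [simp]:
  fixes M :: "('a, 'v) module" and a :: "'g \<Rightarrow> 'v \<Rightarrow> 'v"
  shows "carrier (module.extend M (rep.fields a)) = carrier M"
    and "\<zero>\<^bsub>module.extend M (rep.fields a)\<^esub> = \<zero>\<^bsub>M\<^esub>"
    and "add (module.extend M (rep.fields a)) = add M"
    and "smult (module.extend M (rep.fields a)) = smult M"
    and "act (module.extend M (rep.fields a)) = a"
  by (simp_all add: module.extend_def rep.fields_def)

text \<open>These constants depend on the module fields alone, so adding an action does not change
  them. Since the two record types differ, each constant has to be unfolded down to the
  fields.\<close>

lemma module_extend_simps' [simp]:
  fixes M :: "('a, 'v) module" and a :: "'g \<Rightarrow> 'v \<Rightarrow> 'v"
  shows "a_minus (module.extend M (rep.fields a)) = a_minus M"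
    and "finsum (module.extend M (rep.fields a)) = finsum M"
    and "submodule H K (module.extend M (rep.fields a)) = submodule H K M"
    and "module K (module.extend M (rep.fields a)) = module K M"
    and "linear_on K (module.extend M (rep.fields a)) N f = linear_on K M N f"
    and "linear_on K N' (module.extend M (rep.fields a)) f' = linear_on K N' M f'"
    and "lin_ext K (module.extend M (rep.fields a)) b = lin_ext K M b"
    and "submodule_span K (module.extend M (rep.fields a)) S = submodule_span K M S"
  by (simp_all add: fun_eq_iff a_minus_def a_inv_def finsum_def submodule_def submodule_axioms_def
      finprod_def m_inv_def subgroup_def comm_group_def comm_monoid_def group_def monoid_def
      comm_monoid_axioms_def group_axioms_def Units_def
      module_def module_axioms_def abelian_group_def abelian_monoid_def abelian_group_axioms_def
      linear_on_def lin_ext_def submodule_span_def)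

text \<open>The first isomorphism theorem. The map goes from \<open>V\<close> to the quotient and
  sends v to its fibre under \<open>\<Phi>\<close>, which is a coset of the kernel. In this
  direction the structure of \<open>V\<close> can be transported to the quotient.\<close>

lemma quot_rep_kernel_isomorphic:
  fixes F :: "('a, 'u, 'g) rep" and V :: "('a, 'v, 'g) rep"
  assumes V: "linear_representation G K V" and F: "module K F"
    and lin: "linear_on K F V \<Phi>" and surj: "\<Phi> ` carrier F = carrier V"
    and act_closed: "\<And>g u. \<lbrakk>g \<in> carrier G; u \<in> carrier F\<rbrakk> \<Longrightarrow> act F g u \<in> carrier F"
    and act: "\<And>g u. \<lbrakk>g \<in> carrier G; u \<in> carrier F\<rbrakk> \<Longrightarrow> \<Phi> (act F g u) = act V g (\<Phi> u)"
  shows "rep_isomorphic G K V (quot_rep F {u \<in> carrier F. \<Phi> u = \<zero>\<^bsub>V\<^esub>})"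
proof -
  interpret V: linear_representation G K V by fact
  interpret F: module K F by fact
  define N where "N = {u \<in> carrier F. \<Phi> u = \<zero>\<^bsub>V\<^esub>}"
  define fib where "fib v = {u \<in> carrier F. \<Phi> u = v}" for v
  note \<Phi> = linear_onD[OF lin]
  have ne: "\<exists>u. u \<in> fib v" if "v \<in> carrier V" for v
    using that surj[symmetric] by (auto simp: fib_def)
  have coset: "N +>\<^bsub>F\<^esub> u = fib (\<Phi> u)" if u: "u \<in> carrier F" for u
  proof
    show "N +>\<^bsub>F\<^esub> u \<subseteq> fib (\<Phi> u)"
      using u \<Phi> by (auto simp: a_r_coset_def' N_def fib_def)
    show "fib (\<Phi> u) \<subseteq> N +>\<^bsub>F\<^esub> u"
    proof
      fix w assume "w \<in> fib (\<Phi> u)"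
      then have w: "w \<in> carrier F" "\<Phi> w = \<Phi> u" by (auto simp: fib_def)
      then have "w \<ominus>\<^bsub>F\<^esub> u \<in> N"
        using u linear_on_minus[OF F V.module_axioms lin, of w u] \<Phi>(1)
        by (auto simp: N_def V.M.r_neg a_minus_def)
      moreover have "w = (w \<ominus>\<^bsub>F\<^esub> u) \<oplus>\<^bsub>F\<^esub> u"
        using w u by (simp add: a_minus_def F.M.a_assoc F.M.l_neg)
      ultimately show "w \<in> N +>\<^bsub>F\<^esub> u" by (auto simp: a_r_coset_def')
    qed
  qed
  have "bij_betw fib (carrier V) (carrier (quot_rep F N))"
  proof (rule bij_betw_imageI)
    show "inj_on fib (carrier V)"
    proof (rule inj_onI)
      fix v w assume "v \<in> carrier V" and eq: "fib v = fib w"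
      then obtain u where u: "u \<in> fib v" using ne by blast
      moreover have "u \<in> fib w" using u eq by simp
      ultimately show "v = w" by (auto simp: fib_def)
    qed
    have "carrier (quot_rep F N) = (\<lambda>u. N +>\<^bsub>F\<^esub> u) ` carrier F"
      by (auto simp: quot_rep_def quot_module_def A_RCOSETS_def')
    also have "\<dots> = fib ` carrier V"
      by (simp add: coset surj[symmetric] image_image)
    finally show "fib ` carrier V = carrier (quot_rep F N)" by simp
  qed
  moreover have "fib \<zero>\<^bsub>V\<^esub> = \<zero>\<^bsub>quot_rep F N\<^esub>"
    by (simp add: quot_rep_def quot_module_def fib_def N_def)
  moreover have "fib (v \<oplus>\<^bsub>V\<^esub> w) = fib v \<oplus>\<^bsub>quot_rep F N\<^esub> fib w"
    if v: "v \<in> carrier V" and w: "w \<in> carrier V" for v w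
  proof -
    have "fib v <+>\<^bsub>F\<^esub> fib w = fib (v \<oplus>\<^bsub>V\<^esub> w)"
    proof
      show "fib v <+>\<^bsub>F\<^esub> fib w \<subseteq> fib (v \<oplus>\<^bsub>V\<^esub> w)"
        using \<Phi> by (auto simp: set_add_def' fib_def)
      show "fib (v \<oplus>\<^bsub>V\<^esub> w) \<subseteq> fib v <+>\<^bsub>F\<^esub> fib w"
      proof
        fix u assume u: "u \<in> fib (v \<oplus>\<^bsub>V\<^esub> w)"
        obtain x where x: "x \<in> fib v" using ne v by blast
        have "\<Phi> (u \<ominus>\<^bsub>F\<^esub> x) = w"
          using u x v w linear_on_minus[OF F V.module_axioms lin, of u x]
          by (auto simp: fib_def a_minus_def V.M.a_ac V.M.r_neg V.M.r_neg1 V.M.r_neg2)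
        then have "u \<ominus>\<^bsub>F\<^esub> x \<in> fib w" using u x by (auto simp: fib_def)
        moreover have "u = x \<oplus>\<^bsub>F\<^esub> (u \<ominus>\<^bsub>F\<^esub> x)"
          using u x by (auto simp: fib_def a_minus_def F.M.a_ac F.M.r_neg F.M.r_neg1 F.M.r_neg2)
        ultimately show "u \<in> fib v <+>\<^bsub>F\<^esub> fib w" using x by (auto simp: set_add_def')
      qed
    qed
    then show ?thesis by (simp add: quot_rep_def quot_module_def)
  qed
  moreover have "fib (c \<odot>\<^bsub>V\<^esub> v) = c \<odot>\<^bsub>quot_rep F N\<^esub> fib v"
    if c: "c \<in> carrier K" and v: "v \<in> carrier V" for c v
  proof -
    \<comment> \<open>The product in the quotient is a union of cosets over all u in the fibre.
      These cosets coincide and the fibre is non-empty, so the union is that single coset. The group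
      action below is treated in the same way.\<close>
    have "N +>\<^bsub>F\<^esub> (c \<odot>\<^bsub>F\<^esub> u) = fib (c \<odot>\<^bsub>V\<^esub> v)" if "u \<in> fib v" for u
      using that c by (simp add: fib_def coset \<Phi>)
    then show ?thesis using ne[OF v] by (auto simp: quot_rep_def quot_module_def)
  qed
  moreover have "fib (act V g v) = act (quot_rep F N) g (fib v)"
    if g: "g \<in> carrier G" and v: "v \<in> carrier V" for g v
  proof -
    have "N +>\<^bsub>F\<^esub> (act F g u) = fib (act V g v)" if "u \<in> fib v" for u
      using that g by (simp add: fib_def coset act act_closed)
    then show ?thesis using ne[OF v] by (auto simp: quot_rep_def)
  qed
  ultimately have "rep_isomorphic G K V (quot_rep F N)"
    by (intro rep_isomorphic_transport[OF V])
  then show ?thesis unfolding N_def .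
qed

text \<open>The reason: modulo S every element of the free module is a combination of the generators
  e x, and the linear extension of b is injective on these combinations.\<close>

lemma kernel_eq_submodule_span:
  assumes K: "cring K" and b: "b \<in> B \<rightarrow> carrier (free_module K E)"
    and S: "S \<subseteq> carrier (free_module K B)"
    and kill: "\<And>r. r \<in> S \<Longrightarrow> lin_ext K (free_module K E) b r = \<zero>\<^bsub>free_module K E\<^esub>"
    and e: "\<And>x. x \<in> E \<Longrightarrow> e x \<in> B" "\<And>x. x \<in> E \<Longrightarrow> b (e x) = basis_elt K x"
    and gen: "\<And>N y. submodule N K (free_module K B) \<Longrightarrow> S \<subseteq> N \<Longrightarrow>
        (\<And>x. x \<in> E \<Longrightarrow> basis_elt K (e x) \<in> N) \<Longrightarrow> y \<in> B \<Longrightarrow> basis_elt K y \<in> N"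
  shows "submodule_span K (free_module K B) S =
      {u \<in> carrier (free_module K B). lin_ext K (free_module K E) b u = \<zero>\<^bsub>free_module K E\<^esub>}" (is "_ = ?ker")
    and "lin_ext K (free_module K E) b ` carrier (free_module K B) = carrier (free_module K E)"
proof -
  interpret K: cring K by (rule K)
  let ?F = "free_module K B" and ?V = "free_module K E"
  interpret F: module K ?F by (rule K.module_free_module)
  interpret V: module K ?V by (rule K.module_free_module)
  define \<Phi> where "\<Phi> = lin_ext K ?V b"
  \<comment> \<open>A linear right inverse of \<open>\<Phi>\<close>, given by the chosen generators
    \<open>e x\<close>.\<close>
  define \<sigma> where "\<sigma> = lin_ext K ?F (\<lambda>x. basis_elt K (e x))"
  have b\<sigma>: "(\<lambda>x. basis_elt K (e x)) \<in> E \<rightarrow> carrier ?F"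
    by (intro Pi_I K.basis_elt_closed e(1))
  have \<Phi>: "linear_on K ?F ?V \<Phi>" unfolding \<Phi>_def using b by (rule V.lin_ext_linear)
  have \<sigma>: "linear_on K ?V ?F \<sigma>" unfolding \<sigma>_def using b\<sigma> by (rule F.lin_ext_linear)
  have \<sigma>_basis: "\<sigma> (basis_elt K x) = basis_elt K (e x)" if "x \<in> E" for x
    unfolding \<sigma>_def using that b\<sigma> by (rule F.lin_ext_basis_elt)
  have \<Phi>_basis: "\<Phi> (basis_elt K y) = b y" if "y \<in> B" for y
    unfolding \<Phi>_def using that b by (rule V.lin_ext_basis_elt)
  have id: "linear_on K ?V ?V (\<lambda>u. u)" by (auto simp: linear_on_def)
  have \<Phi>\<sigma>: "\<Phi> (\<sigma> v) = v" if "v \<in> carrier ?V" for v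
    using V.linear_on_free_module_eqI[OF that linear_on_comp[OF \<sigma> \<Phi>] id]
    by (simp add: \<sigma>_basis \<Phi>_basis e)
  show "\<Phi> ` carrier ?F = carrier ?V"
  proof
    show "carrier ?V \<subseteq> \<Phi> ` carrier ?F"
    proof
      fix v assume v: "v \<in> carrier ?V"
      show "v \<in> \<Phi> ` carrier ?F"
        using imageI[OF linear_onD(1)[OF \<sigma> v], of \<Phi>] by (simp only: \<Phi>\<sigma>[OF v])
    qed
  qed (use linear_onD(1)[OF \<Phi>] in blast)
  have aux: "?ker \<subseteq> N" if N: "submodule N K ?F" and "S \<subseteq> N" and "N \<subseteq> ?ker" for N
  proof
    \<comment> \<open>The sum of \<open>N\<close> and the image of \<open>\<sigma>\<close> contains
      the relations and the chosen generators, hence everything by \<open>gen\<close>. So a kernel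
      element is n + \<sigma> v. Applying \<open>\<Phi>\<close>, which kills n because
      \<open>N\<close> lies in the kernel, gives v = 0.\<close>
    define N' where "N' = {n \<oplus>\<^bsub>?F\<^esub> \<sigma> v | n v. n \<in> N \<and> v \<in> carrier ?V}"
    note NE = F.submoduleE[OF N]
    have n0: "\<zero>\<^bsub>?F\<^esub> \<in> N" by (rule submodule_zero_closed[OF N])
    have \<sigma>0: "\<sigma> \<zero>\<^bsub>?V\<^esub> = \<zero>\<^bsub>?F\<^esub>"
      by (rule linear_on_zero[OF V.module_axioms F.module_axioms \<sigma>])
    have N'I: "n \<oplus>\<^bsub>?F\<^esub> \<sigma> v \<in> N'" if "n \<in> N" "v \<in> carrier ?V" for n v
      using that unfolding N'_def by blast
    have "submodule N' K ?F"
    proof (rule F.submoduleI')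
      show "N' \<subseteq> carrier ?F"
        unfolding N'_def using NE(1) linear_onD(1)[OF \<sigma>] F.M.a_closed by blast
      show "\<zero>\<^bsub>?F\<^esub> \<in> N'"
        using N'I[OF n0 V.M.zero_closed] by (simp only: \<sigma>0 F.M.r_zero[OF F.M.zero_closed])
    next
      fix a a' assume "a \<in> N'" "a' \<in> N'"
      then obtain n v n' v' where *: "a = n \<oplus>\<^bsub>?F\<^esub> \<sigma> v" "n \<in> N" "v \<in> carrier ?V"
          "a' = n' \<oplus>\<^bsub>?F\<^esub> \<sigma> v'" "n' \<in> N" "v' \<in> carrier ?V"
        unfolding N'_def by blast
      have "a \<oplus>\<^bsub>?F\<^esub> a' = (n \<oplus>\<^bsub>?F\<^esub> n') \<oplus>\<^bsub>?F\<^esub> \<sigma> (v \<oplus>\<^bsub>?V\<^esub> v')"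
        using * linear_onD[OF \<sigma>] NE(1) by (simp add: subset_iff F.M.a_ac)
      then show "a \<oplus>\<^bsub>?F\<^esub> a' \<in> N'"
        using N'I[OF NE(5)[OF *(2,5)] V.M.a_closed[OF *(3,6)]] by (simp only:)
    next
      fix c a assume c: "c \<in> carrier K" and "a \<in> N'"
      then obtain n v where *: "a = n \<oplus>\<^bsub>?F\<^esub> \<sigma> v" "n \<in> N" "v \<in> carrier ?V"
        unfolding N'_def by blast
      have "c \<odot>\<^bsub>?F\<^esub> a = (c \<odot>\<^bsub>?F\<^esub> n) \<oplus>\<^bsub>?F\<^esub> \<sigma> (c \<odot>\<^bsub>?V\<^esub> v)"
        using * c linear_onD[OF \<sigma>] NE(1)
        by (simp add: subset_iff F.smult_r_distr)
      then show "c \<odot>\<^bsub>?F\<^esub> a \<in> N'"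
        using N'I[OF NE(4)[OF c *(2)] V.smult_closed[OF c *(3)]] by (simp only:)
    qed
    moreover have "S \<subseteq> N'"
    proof
      fix r assume "r \<in> S"
      then have r: "r \<in> N" "r \<in> carrier ?F" using \<open>S \<subseteq> N\<close> S by auto
      show "r \<in> N'"
        using N'I[OF r(1) V.M.zero_closed] by (simp only: \<sigma>0 F.M.r_zero[OF r(2)])
    qed
    moreover have "basis_elt K (e x) \<in> N'" if x: "x \<in> E" for x
      using N'I[OF n0 K.basis_elt_closed[OF x]]
      by (simp only: \<sigma>_basis[OF x] F.M.l_zero[OF K.basis_elt_closed[OF e(1)[OF x]]])
    ultimately have N'_basis: "basis_elt K y \<in> N'" if "y \<in> B" for y
      using gen that by blast
    note N'E = F.submoduleE[OF \<open>submodule N' K ?F\<close>]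
    fix u assume u: "u \<in> ?ker"
    then have uF: "u \<in> carrier ?F" and u0: "\<Phi> u = \<zero>\<^bsub>?V\<^esub>" by (simp_all add: \<Phi>_def)
    have "u \<in> N'"
      using uF
    proof (induction rule: K.free_module_induct)
      case zero
      show ?case using N'I[OF n0 V.M.zero_closed] by (simp only: \<sigma>0 F.M.r_zero[OF F.M.zero_closed])
    next
      case (basis x)
      then show ?case by (rule N'_basis)
    next
      case (smult c u)
      then show ?case by (intro N'E(4))
    next
      case (add u v)
      then show ?case by (intro N'E(5))
    qed
    then obtain n v where nv: "u = n \<oplus>\<^bsub>?F\<^esub> \<sigma> v" "n \<in> N" "v \<in> carrier ?V"
      unfolding N'_def by blast
    have n: "n \<in> carrier ?F" "\<Phi> n = \<zero>\<^bsub>?V\<^esub>"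
      using nv(2) \<open>N \<subseteq> ?ker\<close> by (auto simp: \<Phi>_def)
    have "\<Phi> u = v"
      using nv(1,3) n linear_onD[OF \<Phi>] linear_onD(1)[OF \<sigma>]
      by (simp add: \<Phi>\<sigma>)
    then have "u = n" using nv(1) u0 \<sigma>0 n(1) by simp
    then show "u \<in> N" using nv(2) by simp
  qed
  have ker: "submodule ?ker K ?F"
  proof (rule F.submoduleI')
  qed (use linear_onD[OF \<Phi>] linear_on_zero[OF F.module_axioms V.module_axioms \<Phi>]
     in \<open>auto simp: \<Phi>_def[symmetric]\<close>)
  have S_ker: "S \<subseteq> ?ker" using S kill by auto
  have "?ker \<subseteq> N" if N: "submodule N K ?F" and "S \<subseteq> N" for N
  proof -
    \<comment> \<open>Cutting \<open>N\<close> down to the kernel restores the assumption of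
      \<open>aux\<close>; the relations stay inside since they are killed.\<close>
    have "submodule (N \<inter> ?ker) K ?F"
      by (rule F.submodule_Int[OF N ker])
    then show ?thesis using aux[of "N \<inter> ?ker"] \<open>S \<subseteq> N\<close> S_ker by blast
  qed
  then show "submodule_span K ?F S = ?ker"
    unfolding submodule_span_def by (intro hull_unique S_ker ker)
qed

section \<open>Actions on a free module induced from its basis, and the comparison criterion for
  presented representations\<close>

lemma (in cring) free_rep_act_eq:
  assumes u: "u \<in> carrier (free_module R B)" and A: "finite A" "{x. u x \<noteq> \<zero>} \<subseteq> A"
  shows "act (free_rep R B \<phi>) g u y = finsum R u {x \<in> A. \<phi> g x = y}"
proof -
  have "finsum R u {x. u x \<noteq> \<zero> \<and> \<phi> g x = y} = finsum R u {x \<in> A. \<phi> g x = y}"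
    using u A by (intro add.finprod_mono_neutral_cong_left) (auto simp: free_module_simps)
  then show ?thesis by (simp add: free_rep_def)
qed

text \<open>The map \<open>\<phi> g\<close> may identify points of \<open>B\<close>; their
  coefficients are then added. The new support lies in the image of the old one and so remains
  finite.\<close>

lemma (in cring) free_rep_act_linear:
  assumes \<phi>: "\<And>y. y \<in> B \<Longrightarrow> \<phi> g y \<in> B"
  shows "linear_on R (free_module R B) (free_module R B) (act (free_rep R B \<phi>) g)"
proof (rule linear_onI)
  fix u assume u: "u \<in> carrier (free_module R B)"
  define A where "A = {x. u x \<noteq> \<zero>}"
  have A: "finite A" "A \<subseteq> B" and cl: "\<And>x. u x \<in> carrier R"
    using u by (auto simp: A_def free_module_simps)
  have act_u: "act (free_rep R B \<phi>) g u y = finsum R u {x \<in> A. \<phi> g x = y}" for y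
    using free_rep_act_eq[OF u A(1)] by (auto simp: A_def)
  have "{y. act (free_rep R B \<phi>) g u y \<noteq> \<zero>} \<subseteq> \<phi> g ` A"
  proof
    fix y assume y: "y \<in> {y. act (free_rep R B \<phi>) g u y \<noteq> \<zero>}"
    have "{x \<in> A. \<phi> g x = y} \<noteq> {}"
    proof
      assume "{x \<in> A. \<phi> g x = y} = {}"
      then show False using y by (simp only: act_u mem_Collect_eq finsum_empty simp_thms)
    qed
    then show "y \<in> \<phi> g ` A" by auto
  qed
  then have "finite {y. act (free_rep R B \<phi>) g u y \<noteq> \<zero>}"
      "{y. act (free_rep R B \<phi>) g u y \<noteq> \<zero>} \<subseteq> B"
    using A \<phi> by (auto intro: finite_subset[of _ "\<phi> g ` A"])
  moreover have "act (free_rep R B \<phi>) g u y \<in> carrier R" for y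
    unfolding act_u using cl by (intro finsum_closed) auto
  ultimately show "act (free_rep R B \<phi>) g u \<in> carrier (free_module R B)"
    by (simp add: free_module_simps)
next
  fix u v assume u: "u \<in> carrier (free_module R B)" and v: "v \<in> carrier (free_module R B)"
  define A where "A = {x. u x \<noteq> \<zero>} \<union> {x. v x \<noteq> \<zero>}"
  have A: "finite A" "{x. u x \<noteq> \<zero>} \<subseteq> A" "{x. v x \<noteq> \<zero>} \<subseteq> A" "{x. u x \<oplus> v x \<noteq> \<zero>} \<subseteq> A"
    and cl: "\<And>x. u x \<in> carrier R" "\<And>x. v x \<in> carrier R"
    using u v by (auto simp: A_def free_module_simps)
  have uv: "(\<lambda>x. u x \<oplus> v x) \<in> carrier (free_module R B)"
    using free_module_add_closed[OF u v] by (simp add: free_module_simps(3))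
  show "act (free_rep R B \<phi>) g (u \<oplus>\<^bsub>free_module R B\<^esub> v) =
      act (free_rep R B \<phi>) g u \<oplus>\<^bsub>free_module R B\<^esub> act (free_rep R B \<phi>) g v"
    using cl by (auto simp: fun_eq_iff free_module_simps(3) free_rep_act_eq[OF u A(1,2)]
        free_rep_act_eq[OF v A(1,3)] free_rep_act_eq[OF uv A(1,4)] intro!: finsum_addf)
next
  fix c u assume c: "c \<in> carrier R" and u: "u \<in> carrier (free_module R B)"
  define A where "A = {x. u x \<noteq> \<zero>}"
  have A: "finite A" "{x. u x \<noteq> \<zero>} \<subseteq> A" "{x. c \<otimes> u x \<noteq> \<zero>} \<subseteq> A"
    and cl: "\<And>x. u x \<in> carrier R"
    using u c by (auto simp: A_def free_module_simps)
  have cu: "(\<lambda>x. c \<otimes> u x) \<in> carrier (free_module R B)"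
    using free_module_smult_closed[OF c u] by (simp add: free_module_simps(4))
  show "act (free_rep R B \<phi>) g (c \<odot>\<^bsub>free_module R B\<^esub> u) =
      c \<odot>\<^bsub>free_module R B\<^esub> act (free_rep R B \<phi>) g u"
    using cl c A(1) by (auto simp: fun_eq_iff free_module_simps(4) free_rep_act_eq[OF u A(1,2)]
        free_rep_act_eq[OF cu A(1,3)] intro!: finsum_rdistr[symmetric])
qed

lemma (in cring) free_rep_act_basis_elt:
  assumes "y \<in> B"
  shows "act (free_rep R B \<phi>) g (basis_elt R y) = basis_elt R (\<phi> g y)"
proof
  fix z
  have "act (free_rep R B \<phi>) g (basis_elt R y) z = finsum R (basis_elt R y) {x \<in> {y}. \<phi> g x = z}"
    by (intro free_rep_act_eq[OF basis_elt_closed[OF assms]]) (auto simp: basis_elt_def)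
  also have "{x \<in> {y}. \<phi> g x = z} = (if z = \<phi> g y then {y} else {})" by auto
  finally show "act (free_rep R B \<phi>) g (basis_elt R y) z = basis_elt R (\<phi> g y) z"
    by (simp add: basis_elt_def)
qed

text \<open>Joins the description of the span as a kernel to the first isomorphism theorem.
  Equivariance is needed only on generators, because both composites are linear on the free
  module.\<close>

lemma quot_free_rep_isomorphic:
  assumes V: "linear_representation G K (module.extend (free_module K E) (rep.fields a))"
    and b: "b \<in> B \<rightarrow> carrier (free_module K E)"
    and S: "S \<subseteq> carrier (free_module K B)"
    and kill: "\<And>r. r \<in> S \<Longrightarrow> lin_ext K (free_module K E) b r = \<zero>\<^bsub>free_module K E\<^esub>"
    and e: "\<And>x. x \<in> E \<Longrightarrow> e x \<in> B" "\<And>x. x \<in> E \<Longrightarrow> b (e x) = basis_elt K x"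
    and gen: "\<And>N y. submodule N K (free_module K B) \<Longrightarrow> S \<subseteq> N \<Longrightarrow>
        (\<And>x. x \<in> E \<Longrightarrow> basis_elt K (e x) \<in> N) \<Longrightarrow> y \<in> B \<Longrightarrow> basis_elt K y \<in> N"
    and \<phi>: "\<And>g y. \<lbrakk>g \<in> carrier G; y \<in> B\<rbrakk> \<Longrightarrow> \<phi> g y \<in> B"
    and equiv: "\<And>g y. \<lbrakk>g \<in> carrier G; y \<in> B\<rbrakk> \<Longrightarrow> b (\<phi> g y) = a g (b y)"
  shows "rep_isomorphic G K (module.extend (free_module K E) (rep.fields a))
    (quot_rep (free_rep K B \<phi>) (submodule_span K (free_rep K B \<phi>) S))"
proof -
  interpret V: linear_representation G K "module.extend (free_module K E) (rep.fields a)" by (rule V)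
  have K: "cring K" by (rule V.K.is_cring)
  interpret E: module K "free_module K E" by (rule cring.module_free_module[OF K])
  note ext = E.lin_ext_linear[OF b]
  have F: "carrier (free_rep K B \<phi>) = carrier (free_module K B)"
    by (simp add: free_rep_def)
  have "rep_isomorphic G K (module.extend (free_module K E) (rep.fields a))
    (quot_rep (free_rep K B \<phi>) {u \<in> carrier (free_rep K B \<phi>).
      lin_ext K (free_module K E) b u = \<zero>\<^bsub>module.extend (free_module K E) (rep.fields a)\<^esub>})"
  proof (rule quot_rep_kernel_isomorphic[OF V])
    show "Module.module K (free_rep K B \<phi>)"
      by (simp add: free_rep_def cring.module_free_module[OF K])
    show "linear_on K (free_rep K B \<phi>) (module.extend (free_module K E) (rep.fields a))
        (lin_ext K (free_module K E) b)"
      using ext by (simp add: free_rep_def)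
    show "lin_ext K (free_module K E) b ` carrier (free_rep K B \<phi>) =
        carrier (module.extend (free_module K E) (rep.fields a))"
      unfolding F module_extend_simps
      by (rule kernel_eq_submodule_span(2)[OF K b S kill e gen])
  next
    fix g u assume g: "g \<in> carrier G" and "u \<in> carrier (free_rep K B \<phi>)"
    then have u: "u \<in> carrier (free_module K B)" by (simp add: F)
    have lin: "linear_on K (free_module K B) (free_module K B) (act (free_rep K B \<phi>) g)"
      by (rule cring.free_rep_act_linear[OF K]) (rule \<phi>[OF g])
    show "act (free_rep K B \<phi>) g u \<in> carrier (free_rep K B \<phi>)"
      unfolding F by (rule linear_onD(1)[OF lin u])
    have a: "linear_on K (free_module K E) (free_module K E) (a g)"
      using V.act_closed[OF g] V.act_add[OF g] V.act_smult[OF g] by (intro linear_onI) simp_all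
    have "(lin_ext K (free_module K E) b \<circ> act (free_rep K B \<phi>) g) u =
        (a g \<circ> lin_ext K (free_module K E) b) u"
    proof (rule E.linear_on_free_module_eqI[OF u linear_on_comp[OF lin ext] linear_on_comp[OF ext a]])
      fix y assume y: "y \<in> B"
      show "(lin_ext K (free_module K E) b \<circ> act (free_rep K B \<phi>) g) (basis_elt K y) =
          (a g \<circ> lin_ext K (free_module K E) b) (basis_elt K y)"
        using E.lin_ext_basis_elt[OF y b] E.lin_ext_basis_elt[OF \<phi>[OF g y] b]
        by (simp add: cring.free_rep_act_basis_elt[OF K y] equiv[OF g y])
    qed
    then show "lin_ext K (free_module K E) b (act (free_rep K B \<phi>) g u) =
        act (module.extend (free_module K E) (rep.fields a)) g (lin_ext K (free_module K E) b u)"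
      by simp
  qed
  moreover have "submodule_span K (free_module K B) S =
      {u \<in> carrier (free_module K B). lin_ext K (free_module K E) b u = \<zero>\<^bsub>free_module K E\<^esub>}"
    by (rule kernel_eq_submodule_span(1)[OF K b S kill e gen])
  then have "submodule_span K (free_rep K B \<phi>) S = {u \<in> carrier (free_rep K B \<phi>).
      lin_ext K (free_module K E) b u = \<zero>\<^bsub>module.extend (free_module K E) (rep.fields a)\<^esub>}"
    by (simp add: free_rep_def)
  ultimately show ?thesis by simp
qed

section \<open>Monomial representations\<close>

text \<open>The action sends the basis vector of x to c g x times the basis vector of \<open>\<phi> g x\<close>.\<close>

definition mono_rep ::
  "('g, 'm) monoid_scheme \<Rightarrow> ('a, 'n) ring_scheme \<Rightarrow> 'x set \<Rightarrow> ('g \<Rightarrow> 'x \<Rightarrow> 'x)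
    \<Rightarrow> ('g \<Rightarrow> 'x \<Rightarrow> 'a) \<Rightarrow> ('a, 'x \<Rightarrow> 'a, 'g) rep"
  where "mono_rep G K E \<phi> c = module.extend (free_module K E)
    (rep.fields (\<lambda>g u y. if y \<in> E
      then c g (\<phi> (inv\<^bsub>G\<^esub> g) y) \<otimes>\<^bsub>K\<^esub> u (\<phi> (inv\<^bsub>G\<^esub> g) y) else \<zero>\<^bsub>K\<^esub>))"

lemma mono_rep_simps [simp]:
  "carrier (mono_rep G K E \<phi> c) = carrier (free_module K E)"
  "\<zero>\<^bsub>mono_rep G K E \<phi> c\<^esub> = \<zero>\<^bsub>free_module K E\<^esub>"
  "add (mono_rep G K E \<phi> c) = add (free_module K E)"
  "smult (mono_rep G K E \<phi> c) = smult (free_module K E)"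
  "linear_on K (mono_rep G K E \<phi> c) N f = linear_on K (free_module K E) N f"
  "linear_on K N' (mono_rep G K E \<phi> c) f' = linear_on K N' (free_module K E) f'"
  by (simp_all add: mono_rep_def)

lemma act_mono_rep:
  "act (mono_rep G K E \<phi> c) g u = (\<lambda>y. if y \<in> E
    then c g (\<phi> (inv\<^bsub>G\<^esub> g) y) \<otimes>\<^bsub>K\<^esub> u (\<phi> (inv\<^bsub>G\<^esub> g) y) else \<zero>\<^bsub>K\<^esub>)"
  by (simp add: mono_rep_def)

text \<open>The law \<open>c_mult\<close> is the cocycle identity, which makes the formula of
  \<open>mono_rep\<close> multiplicative in the group element. Finiteness of \<open>E\<close> makes
  the free module consist of all functions that vanish off \<open>E\<close>.\<close>

locale monomial_action = G?: group G + K?: field K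
  for G :: "('g, 'm) monoid_scheme" and K :: "('a, 'n) ring_scheme" +
  fixes E :: "'x set" and \<phi> :: "'g \<Rightarrow> 'x \<Rightarrow> 'x" and c :: "'g \<Rightarrow> 'x \<Rightarrow> 'a"
  assumes finite_E: "finite E"
    and \<phi>_closed: "\<lbrakk>g \<in> carrier G; x \<in> E\<rbrakk> \<Longrightarrow> \<phi> g x \<in> E"
    and \<phi>_one: "x \<in> E \<Longrightarrow> \<phi> \<one>\<^bsub>G\<^esub> x = x"
    and \<phi>_mult: "\<lbrakk>g \<in> carrier G; h \<in> carrier G; x \<in> E\<rbrakk> \<Longrightarrow> \<phi> (g \<otimes>\<^bsub>G\<^esub> h) x = \<phi> g (\<phi> h x)"
    and c_closed: "\<lbrakk>g \<in> carrier G; x \<in> E\<rbrakk> \<Longrightarrow> c g x \<in> carrier K"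
    and c_nonzero: "\<lbrakk>g \<in> carrier G; x \<in> E\<rbrakk> \<Longrightarrow> c g x \<noteq> \<zero>\<^bsub>K\<^esub>"
    and c_mult: "\<lbrakk>g \<in> carrier G; h \<in> carrier G; x \<in> E\<rbrakk>
        \<Longrightarrow> c (g \<otimes>\<^bsub>G\<^esub> h) x = c g (\<phi> h x) \<otimes>\<^bsub>K\<^esub> c h x"
begin

lemma \<phi>_inv [simp]:
  assumes "g \<in> carrier G" "x \<in> E"
  shows "\<phi> (inv\<^bsub>G\<^esub> g) (\<phi> g x) = x" "\<phi> g (\<phi> (inv\<^bsub>G\<^esub> g) x) = x"
  using \<phi>_mult[of "inv\<^bsub>G\<^esub> g" g x] \<phi>_mult[of g "inv\<^bsub>G\<^esub> g" x] \<phi>_one assms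
  by (simp_all add: G.l_inv G.r_inv)

text \<open>At g = h = 1 the cocycle identity says that the scalar is idempotent, and a non-zero
  scalar can be cancelled.\<close>

lemma c_one:
  assumes x: "x \<in> E"
  shows "c \<one>\<^bsub>G\<^esub> x = \<one>\<^bsub>K\<^esub>"
proof -
  have cx: "c \<one>\<^bsub>G\<^esub> x \<in> carrier K" "c \<one>\<^bsub>G\<^esub> x \<noteq> \<zero>\<^bsub>K\<^esub>"
    using x c_closed c_nonzero by auto
  have "c \<one>\<^bsub>G\<^esub> x \<otimes>\<^bsub>K\<^esub> c \<one>\<^bsub>G\<^esub> x = c \<one>\<^bsub>G\<^esub> x \<otimes>\<^bsub>K\<^esub> \<one>\<^bsub>K\<^esub>"
    using c_mult[of "\<one>\<^bsub>G\<^esub>" "\<one>\<^bsub>G\<^esub>" x] x cx by (simp add: \<phi>_one)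
  then show ?thesis
    using K.m_lcancel[OF cx(2,1) cx(1) K.one_closed] by blast
qed

lemma carrier_free_module_iff:
  "u \<in> carrier (free_module K E) \<longleftrightarrow> (\<forall>x. u x \<in> carrier K) \<and> (\<forall>x. x \<notin> E \<longrightarrow> u x = \<zero>\<^bsub>K\<^esub>)"
proof -
  have "finite {x. u x \<noteq> \<zero>\<^bsub>K\<^esub>}" if "{x. u x \<noteq> \<zero>\<^bsub>K\<^esub>} \<subseteq> E"
    using finite_subset[OF that finite_E] .
  then show ?thesis by (auto simp: free_module_simps)
qed

lemma linear_representation_mono_rep: "linear_representation G K (mono_rep G K E \<phi> c)"
proof (intro linear_representation.intro linear_representation_axioms.intro)
  show "Module.module K (mono_rep G K E \<phi> c)"
    by (simp add: mono_rep_def K.module_free_module)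
  fix u assume "u \<in> carrier (mono_rep G K E \<phi> c)"
  then have u: "\<And>x. u x \<in> carrier K" "\<And>x. x \<notin> E \<Longrightarrow> u x = \<zero>\<^bsub>K\<^esub>"
    by (auto simp: carrier_free_module_iff)
  show "act (mono_rep G K E \<phi> c) g u \<in> carrier (mono_rep G K E \<phi> c)" if "g \<in> carrier G" for g
    using that by (simp add: carrier_free_module_iff act_mono_rep u c_closed \<phi>_closed)
  show "act (mono_rep G K E \<phi> c) \<one>\<^bsub>G\<^esub> u = u"
    by (auto simp: act_mono_rep \<phi>_one c_one u fun_eq_iff)
  show "act (mono_rep G K E \<phi> c) (g \<otimes>\<^bsub>G\<^esub> h) u = act (mono_rep G K E \<phi> c) g (act (mono_rep G K E \<phi> c) h u)"
    if g: "g \<in> carrier G" and h: "h \<in> carrier G" for g h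
  proof
    fix y
    \<comment> \<open>The cocycle identity at the point (gh)^-1 y, which h sends to g^-1 y.\<close>
    have "c (g \<otimes>\<^bsub>G\<^esub> h) (\<phi> (inv\<^bsub>G\<^esub> (g \<otimes>\<^bsub>G\<^esub> h)) y) =
        c g (\<phi> (inv\<^bsub>G\<^esub> g) y) \<otimes>\<^bsub>K\<^esub> c h (\<phi> (inv\<^bsub>G\<^esub> h) (\<phi> (inv\<^bsub>G\<^esub> g) y))" if "y \<in> E"
      using that g h by (simp add: G.inv_mult_group \<phi>_mult \<phi>_closed c_mult)
    then show "act (mono_rep G K E \<phi> c) (g \<otimes>\<^bsub>G\<^esub> h) u y =
        act (mono_rep G K E \<phi> c) g (act (mono_rep G K E \<phi> c) h u) y"
      using g h by (simp add: act_mono_rep \<phi>_closed c_closed u K.m_assoc G.inv_mult_group \<phi>_mult)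
  qed
  show "act (mono_rep G K E \<phi> c) g (k \<odot>\<^bsub>mono_rep G K E \<phi> c\<^esub> u) =
      k \<odot>\<^bsub>mono_rep G K E \<phi> c\<^esub> act (mono_rep G K E \<phi> c) g u"
    if "g \<in> carrier G" "k \<in> carrier K" for g k
    using that u by (auto simp: act_mono_rep free_module_simps fun_eq_iff c_closed \<phi>_closed K.m_lcomm)
  fix v assume "v \<in> carrier (mono_rep G K E \<phi> c)"
  then have v: "\<And>x. v x \<in> carrier K" by (auto simp: carrier_free_module_iff)
  show "act (mono_rep G K E \<phi> c) g (u \<oplus>\<^bsub>mono_rep G K E \<phi> c\<^esub> v) =
      act (mono_rep G K E \<phi> c) g u \<oplus>\<^bsub>mono_rep G K E \<phi> c\<^esub> act (mono_rep G K E \<phi> c) g v"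
    if "g \<in> carrier G" for g
    using that u v by (auto simp: act_mono_rep free_module_simps fun_eq_iff c_closed \<phi>_closed K.r_distr)
qed (fact G.is_group K.field_axioms)+

lemma act_mono_rep_basis_elt:
  assumes "g \<in> carrier G" "x \<in> E"
  shows "act (mono_rep G K E \<phi> c) g (basis_elt K x) = c g x \<odot>\<^bsub>free_module K E\<^esub> basis_elt K (\<phi> g x)"
  using assms
  by (auto simp: act_mono_rep basis_elt_def free_module_simps fun_eq_iff c_closed \<phi>_closed)

end

text \<open>Reduces each relation to one equation of values: the difference of a generator y and a
  combination u is killed as soon as u is mapped to \<open>b y\<close>.\<close>

lemma (in module) lin_ext_relation:
  assumes b: "b \<in> B \<rightarrow> carrier M" and y: "y \<in> B"
    and u: "u \<in> carrier (free_module R B)" "lin_ext R M b u = b y"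
  shows "basis_elt R y \<ominus>\<^bsub>free_module R B\<^esub> u \<in> carrier (free_module R B)"
    and "lin_ext R M b (basis_elt R y \<ominus>\<^bsub>free_module R B\<^esub> u) = \<zero>\<^bsub>M\<^esub>"
proof -
  interpret F: module R "free_module R B" by (rule module_free_module)
  show "basis_elt R y \<ominus>\<^bsub>free_module R B\<^esub> u \<in> carrier (free_module R B)"
    using basis_elt_closed[OF y] u(1) by (rule F.M.minus_closed)
  have "b y \<in> carrier M" using b y by auto
  then show "lin_ext R M b (basis_elt R y \<ominus>\<^bsub>free_module R B\<^esub> u) = \<zero>\<^bsub>M\<^esub>"
    using linear_on_minus[OF F.module_axioms module_axioms lin_ext_linear[OF b] basis_elt_closed[OF y] u(1)]
    by (simp add: u(2) lin_ext_basis_elt[OF y b] a_minus_def M.r_neg)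
qed

section \<open>Induced representations as monomial representations\<close>

lemma free_module_mono:
  assumes "B \<subseteq> B'"
  shows "carrier (free_module K B) \<subseteq> carrier (free_module K B')"
  using subset_trans[OF _ assms] by (simp add: subset_iff[of "carrier _"] free_module_simps(1))

lemma (in cring) finsum_free_module:
  assumes "finite A" "\<And>i. i \<in> A \<Longrightarrow> f i \<in> carrier (free_module R B)"
  shows "finsum (free_module R B) f A x = (\<Oplus>i\<in>A. f i x)"
proof -
  interpret F: module R "free_module R B" by (rule module_free_module)
  show ?thesis
    using assms
  proof (induction rule: finite_induct)
    case empty
    then show ?case by (simp add: free_module_simps)
  next
    case (insert i A)
    then have "f j x \<in> carrier R" if "j \<in> insert i A" for j
      using that by (auto simp: free_module_simps)
    with insert show ?case
      by (simp add: free_module_simps(3) Pi_iff)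
  qed
qed

section \<open>The group algebra, its multiplication and its action through a character\<close>

lemma group_algebra_simps [simp]:
  "carrier (group_algebra K G) = carrier (free_module K (carrier G))"
  "add (group_algebra K G) = add (free_module K (carrier G))"
  "smult (group_algebra K G) = smult (free_module K (carrier G))"
  by (simp_all add: group_algebra_def)

lemma self_module_simps [simp]:
  "carrier (self_module K) = carrier K"
  "add (self_module K) = add K"
  "smult (self_module K) = monoid.mult K"
  "\<zero>\<^bsub>self_module K\<^esub> = \<zero>\<^bsub>K\<^esub>"
  by (simp_all add: self_module_def)

lemma (in cring) module_self_module: "module R (self_module R)"
  by (rule moduleI[OF is_cring abelian_groupI])
    (auto simp: a_ac l_distr r_distr m_assoc intro: bexI[of _ "\<ominus> _"] l_neg)

text \<open>Makes linearity in the group algebra element available from the general facts on linear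
  extension.\<close>

lemma char_act_eq_lin_ext: "char_act K \<psi> h k = lin_ext K (self_module K) (\<lambda>w. \<psi> w \<otimes>\<^bsub>K\<^esub> k) h"
  by (simp add: char_act_def lin_ext_def finsum_def finprod_def)

text \<open>Left multiplication by a group element, seen as a permutation of the basis of the group
  algebra, so that the facts about \<open>free_rep\<close> apply.\<close>

abbreviation translate ::
  "('g, 'm) monoid_scheme \<Rightarrow> ('a, 'n) ring_scheme \<Rightarrow> 'g \<Rightarrow> ('g \<Rightarrow> 'a) \<Rightarrow> 'g \<Rightarrow> 'a"
  where "translate G K \<equiv> act (free_rep K (carrier G) (monoid.mult G))"

lemma translate_linear:
  assumes "group G" "cring K" "g \<in> carrier G"
  shows "linear_on K (free_module K (carrier G)) (free_module K (carrier G)) (translate G K g)"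
proof -
  interpret G: group G by fact
  show ?thesis
    using cring.free_rep_act_linear[OF assms(2), of "carrier G" "monoid.mult G" g] assms(3) by simp
qed

text \<open>The convolution a b is the sum of the left translates of b by y, weighted with
  \<open>a y\<close>.\<close>

lemma group_algebra_mult_eq_lin_ext:
  assumes G: "group G" and K: "cring K"
    and a: "a \<in> carrier (free_module K (carrier G))" and b: "b \<in> carrier (free_module K (carrier G))"
  shows "a \<otimes>\<^bsub>group_algebra K G\<^esub> b =
    lin_ext K (free_module K (carrier G)) (\<lambda>y. translate G K y b) a"
proof
  interpret G: group G by fact
  interpret K: cring K by fact
  interpret F: module K "free_module K (carrier G)" by (rule K.module_free_module)
  fix x
  have ac: "\<And>y. a y \<in> carrier K" "finite {y. a y \<noteq> \<zero>\<^bsub>K\<^esub>}" "\<And>y. a y \<noteq> \<zero>\<^bsub>K\<^esub> \<Longrightarrow> y \<in> carrier G"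
    and bc: "\<And>y. b y \<in> carrier K" "finite {y. b y \<noteq> \<zero>\<^bsub>K\<^esub>}" "\<And>y. b y \<noteq> \<zero>\<^bsub>K\<^esub> \<Longrightarrow> y \<in> carrier G"
    using a b by (auto simp: free_module_simps)
  \<comment> \<open>The translate is a sum over preimages of x, of which there is at most one,
    namely y^-1 x. Points x outside the group are separated off because nothing is known about y^-1
    x for them.\<close>
  have tr: "translate G K y b x = (if x \<in> carrier G then b (inv\<^bsub>G\<^esub> y \<otimes>\<^bsub>G\<^esub> x) else \<zero>\<^bsub>K\<^esub>)"
    if y: "y \<in> carrier G" for y
  proof -
    define A where "A = {z. b z \<noteq> \<zero>\<^bsub>K\<^esub>}"
    have eq: "translate G K y b x = finsum K b {z \<in> A. y \<otimes>\<^bsub>G\<^esub> z = x}"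
      by (rule K.free_rep_act_eq[OF b]) (use bc in \<open>auto simp: A_def\<close>)
    consider (1) "x \<in> carrier G" "b (inv\<^bsub>G\<^esub> y \<otimes>\<^bsub>G\<^esub> x) \<noteq> \<zero>\<^bsub>K\<^esub>"
      | (2) "x \<in> carrier G" "b (inv\<^bsub>G\<^esub> y \<otimes>\<^bsub>G\<^esub> x) = \<zero>\<^bsub>K\<^esub>" | (3) "x \<notin> carrier G" by blast
    then show ?thesis
    proof cases
      case 1
      then have "{z \<in> A. y \<otimes>\<^bsub>G\<^esub> z = x} = {inv\<^bsub>G\<^esub> y \<otimes>\<^bsub>G\<^esub> x}"
        using y bc(3) by (auto simp: A_def G.inv_solve_left G.m_assoc[symmetric])
      then show ?thesis using 1 bc(1) by (simp add: eq)
    next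
      case 2
      then have *: "{z \<in> A. y \<otimes>\<^bsub>G\<^esub> z = x} = {}"
        using y bc(3) by (auto simp: A_def G.m_assoc[symmetric])
      show ?thesis using 2 unfolding eq * by simp
    next
      case 3
      then have *: "{z \<in> A. y \<otimes>\<^bsub>G\<^esub> z = x} = {}"
        using y bc(3) by (auto simp: A_def)
      show ?thesis using 3 unfolding eq * by simp
    qed
  qed
  have "lin_ext K (free_module K (carrier G)) (\<lambda>y. translate G K y b) a x =
      (\<Oplus>\<^bsub>K\<^esub>y\<in>{y. a y \<noteq> \<zero>\<^bsub>K\<^esub>}. (a y \<odot>\<^bsub>free_module K (carrier G)\<^esub> translate G K y b) x)"
    unfolding lin_ext_def
    using ac linear_onD(1)[OF translate_linear[OF G K] b]
    by (intro K.finsum_free_module F.smult_closed) auto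
  also have "\<dots> = (\<Oplus>\<^bsub>K\<^esub>y\<in>{y. a y \<noteq> \<zero>\<^bsub>K\<^esub>}.
      if x \<in> carrier G then a y \<otimes>\<^bsub>K\<^esub> b (inv\<^bsub>G\<^esub> y \<otimes>\<^bsub>G\<^esub> x) else \<zero>\<^bsub>K\<^esub>)"
    using ac bc by (intro K.finsum_cong') (auto simp: free_module_simps(4) tr)
  finally show "(a \<otimes>\<^bsub>group_algebra K G\<^esub> b) x =
      lin_ext K (free_module K (carrier G)) (\<lambda>y. translate G K y b) a x"
    by (simp add: group_algebra_def)
qed

lemma group_algebra_mult_basis_elt:
  assumes G: "group G" and K: "cring K"
    and g: "g \<in> carrier G" and b: "b \<in> carrier (free_module K (carrier G))"
  shows "basis_elt K g \<otimes>\<^bsub>group_algebra K G\<^esub> b = translate G K g b"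
proof -
  interpret F: module K "free_module K (carrier G)" by (rule cring.module_free_module[OF K])
  show ?thesis
    using group_algebra_mult_eq_lin_ext[OF G K F.basis_elt_closed[OF g] b]
      linear_onD(1)[OF translate_linear[OF G K] b]
    by (simp add: F.lin_ext_basis_elt[OF g] Pi_iff)
qed

text \<open>Linearity in the left factor is what the balancing relations call for: the subgroup acts
  on the right, and identities are tested with a group element on the left.\<close>

lemma group_algebra_mult_linear:
  assumes G: "group G" and K: "cring K" and b: "b \<in> carrier (free_module K (carrier G))"
  shows "linear_on K (free_module K (carrier G)) (free_module K (carrier G))
    (\<lambda>a. a \<otimes>\<^bsub>group_algebra K G\<^esub> b)"
proof -
  interpret F: module K "free_module K (carrier G)" by (rule cring.module_free_module[OF K])
  have "linear_on K (free_module K (carrier G)) (free_module K (carrier G))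
      (lin_ext K (free_module K (carrier G)) (\<lambda>y. translate G K y b))"
    using linear_onD(1)[OF translate_linear[OF G K] b] by (intro F.lin_ext_linear) blast
  then show ?thesis
    using group_algebra_mult_eq_lin_ext[OF G K _ b]
    by (auto simp: linear_on_def Pi_iff F.smult_closed)
qed

context monomial_action
begin

text \<open>The map sends g tensor k to k times g applied to the basis vector of \<open>x0\<close>.
  It respects the tensor product over the group algebra of \<open>H\<close> because \<open>H\<close>
  acts on the line of that vector through \<psi>. It hits every basis line because the action is
  transitive.\<close>

lemma ind_rep_isomorphic:
  assumes x0: "x0 \<in> E" and trans: "\<And>x. x \<in> E \<Longrightarrow> \<exists>g\<in>carrier G. \<phi> g x0 = x"
    and H: "H = {g \<in> carrier G. \<phi> g x0 = x0}" and \<psi>: "\<And>h. h \<in> H \<Longrightarrow> \<psi> h = c h x0"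
  shows "rep_isomorphic G K (mono_rep G K E \<phi> c) (ind_rep G K H \<psi>)"
proof -
  define M where "M = free_module K (carrier G)"
  define V where "V = free_module K E"
  define B where "B = carrier M \<times> carrier K"
  define F where "F = free_module K B"
  define KH where "KH = free_module K H"
  define mul where "mul = monoid.mult (group_algebra K G)"
  define a where "a = act (mono_rep G K E \<phi> c)"
  interpret M: module K M unfolding M_def by (rule K.module_free_module)
  interpret V: module K V unfolding V_def by (rule K.module_free_module)
  interpret F: module K F unfolding F_def by (rule K.module_free_module)
  interpret S: module K "self_module K" by (rule K.module_self_module)
  note MV = linear_representation_mono_rep
  have V_mono: "mono_rep G K E \<phi> c = module.extend V (rep.fields a)"
    by (simp add: a_def V_def act_mono_rep mono_rep_def)
  have a_lin: "linear_on K V V (a g)" if "g \<in> carrier G" for g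
    using linear_representation.act_closed[OF MV that] linear_representation.act_add[OF MV that]
      linear_representation.act_smult[OF MV that]
    by (intro linear_onI) (simp_all add: a_def V_def)
  have HG: "H \<subseteq> carrier G" using H by blast
  have KHM: "carrier KH \<subseteq> carrier M" unfolding KH_def M_def by (rule free_module_mono[OF HG])
  have KH_ops: "u \<oplus>\<^bsub>KH\<^esub> v = u \<oplus>\<^bsub>M\<^esub> v" "k \<odot>\<^bsub>KH\<^esub> u = k \<odot>\<^bsub>M\<^esub> u" for u v k
    by (simp_all add: KH_def M_def free_module_simps(3,4))
  have basis_M: "basis_elt K g \<in> carrier M" if "g \<in> carrier G" for g
    using K.basis_elt_closed[OF that] by (simp add: M_def)
  have basis_F: "basis_elt K y \<in> carrier F" if "y \<in> B" for y
    using K.basis_elt_closed[OF that] by (simp add: F_def)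
  define v0 where "v0 = basis_elt K x0"
  have v0: "v0 \<in> carrier V" using K.basis_elt_closed[OF x0] by (simp add: v0_def V_def)
  \<comment> \<open>The orbit map g to g \<open>v0\<close>, extended linearly to the group
    algebra.\<close>
  define t where "t = lin_ext K V (\<lambda>g. a g v0)"
  have av0: "(\<lambda>g. a g v0) \<in> carrier G \<rightarrow> carrier V" using linear_onD(1)[OF a_lin v0] by blast
  have t_lin: "linear_on K M V t" unfolding t_def M_def by (rule V.lin_ext_linear[OF av0])
  note t = linear_onD[OF t_lin]
  have t_basis: "t (basis_elt K g) = a g v0" if "g \<in> carrier G" for g
    unfolding t_def by (rule V.lin_ext_basis_elt[OF that av0])
  have tr_lin: "linear_on K M M (translate G K g)" if "g \<in> carrier G" for g
    unfolding M_def by (rule translate_linear[OF G.is_group K.is_cring that])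
  have mul_lin: "linear_on K M M (\<lambda>x. mul x y)" if "y \<in> carrier M" for y
    using group_algebra_mult_linear[OF G.is_group K.is_cring] that by (simp add: M_def mul_def)
  have mul_basis: "mul (basis_elt K g) x = translate G K g x" if "g \<in> carrier G" "x \<in> carrier M" for g x
    using group_algebra_mult_basis_elt[OF G.is_group K.is_cring that(1)] that(2) by (simp add: M_def mul_def)
  have t_tr: "t (translate G K g x) = a g (t x)" if g: "g \<in> carrier G" and x: "x \<in> carrier M" for g x
  proof -
    have "(t \<circ> translate G K g) x = (a g \<circ> t) x"
    proof (rule V.linear_on_free_module_eqI[OF x[unfolded M_def]])
      show "linear_on K (free_module K (carrier G)) V (t \<circ> translate G K g)"
        using linear_on_comp[OF tr_lin[OF g] t_lin] by (simp add: M_def)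
      show "linear_on K (free_module K (carrier G)) V (a g \<circ> t)"
        using linear_on_comp[OF t_lin a_lin[OF g]] by (simp add: M_def)
      fix w assume w: "w \<in> carrier G"
      have "a (g \<otimes>\<^bsub>G\<^esub> w) v0 = a g (a w v0)"
        using linear_representation.act_mult[OF MV g w] v0 by (simp add: a_def V_def)
      then show "(t \<circ> translate G K g) (basis_elt K w) = (a g \<circ> t) (basis_elt K w)"
        using g w by (simp add: K.free_rep_act_basis_elt t_basis)
    qed
    then show ?thesis by simp
  qed
  have smult_t_lin: "linear_on K N V (\<lambda>x. k \<odot>\<^bsub>V\<^esub> f x)"
    if k: "k \<in> carrier K" and f: "linear_on K N V f" for N :: "('a, 'z, 'y) module_scheme" and k f
    using linear_onD[OF f] k
    by (intro linear_onI)
      (simp_all add: V.smult_r_distr V.smult_assoc1[symmetric] K.m_comm)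
  \<comment> \<open>For w in \<open>H\<close> the point \<open>x0\<close> is fixed, so w multiplies
    \<open>v0\<close> by \<open>c w x0\<close>, which is \<open>\<psi> w\<close>. Both sides are
    linear in h, so these elements suffice.\<close>
  have t_KH: "k \<odot>\<^bsub>V\<^esub> t h = char_act K \<psi> h k \<odot>\<^bsub>V\<^esub> v0"
    and char_closed: "char_act K \<psi> h k \<in> carrier K"
    if h: "h \<in> carrier KH" and k: "k \<in> carrier K" for h k
  proof -
    have \<psi>k: "(\<lambda>w. \<psi> w \<otimes>\<^bsub>K\<^esub> k) \<in> H \<rightarrow> carrier (self_module K)"
      using k \<psi> c_closed x0 HG by auto
    have lin: "linear_on K KH (self_module K) (\<lambda>h. char_act K \<psi> h k)"
      unfolding char_act_eq_lin_ext KH_def by (rule S.lin_ext_linear[OF \<psi>k])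
    show "char_act K \<psi> h k \<in> carrier K" using linear_onD(1)[OF lin h] by simp
    show "k \<odot>\<^bsub>V\<^esub> t h = char_act K \<psi> h k \<odot>\<^bsub>V\<^esub> v0"
    proof (rule V.linear_on_free_module_eqI[OF h[unfolded KH_def], folded KH_def])
      have "linear_on K KH V t"
        by (intro linear_onI) (simp_all add: KH_ops t subsetD[OF KHM])
      then show "linear_on K KH V (\<lambda>h. k \<odot>\<^bsub>V\<^esub> t h)" by (rule smult_t_lin[OF k])
      show "linear_on K KH V (\<lambda>h. char_act K \<psi> h k \<odot>\<^bsub>V\<^esub> v0)"
        using linear_onD[OF lin] v0 by (intro linear_onI) (simp_all add: V.smult_l_distr V.smult_assoc1)
      fix w assume w: "w \<in> H"
      then have wG: "w \<in> carrier G" and wx: "\<phi> w x0 = x0" using H by auto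
      have "char_act K \<psi> (basis_elt K w) k = \<psi> w \<otimes>\<^bsub>K\<^esub> k"
        unfolding char_act_eq_lin_ext by (rule S.lin_ext_basis_elt[OF w \<psi>k])
      moreover have "a w v0 = c w x0 \<odot>\<^bsub>V\<^esub> v0"
        using act_mono_rep_basis_elt[OF wG x0] by (simp add: a_def v0_def V_def wx)
      ultimately show "k \<odot>\<^bsub>V\<^esub> t (basis_elt K w) = char_act K \<psi> (basis_elt K w) k \<odot>\<^bsub>V\<^esub> v0"
        using k c_closed[OF wG x0] v0
        by (simp add: t_basis wG \<psi>[OF w] V.smult_assoc1[symmetric] K.m_comm)
    qed
  qed
  \<comment> \<open>By linearity in x it suffices to take a group element g, and then the claim is
    \<open>t_KH\<close> with \<open>a g\<close> applied to both sides.\<close>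
  have t_mul: "k \<odot>\<^bsub>V\<^esub> t (mul x h) = char_act K \<psi> h k \<odot>\<^bsub>V\<^esub> t x"
    if x: "x \<in> carrier M" and h: "h \<in> carrier KH" and k: "k \<in> carrier K" for x h k
  proof (rule V.linear_on_free_module_eqI[OF x[unfolded M_def], folded M_def])
    have hM: "h \<in> carrier M" using h KHM by blast
    show "linear_on K M V (\<lambda>x. k \<odot>\<^bsub>V\<^esub> t (mul x h))"
      using smult_t_lin[OF k linear_on_comp[OF mul_lin[OF hM] t_lin]] by simp
    show "linear_on K M V (\<lambda>x. char_act K \<psi> h k \<odot>\<^bsub>V\<^esub> t x)"
      by (rule smult_t_lin[OF char_closed[OF h k] t_lin])
    fix g assume g: "g \<in> carrier G"
    have "k \<odot>\<^bsub>V\<^esub> t (mul (basis_elt K g) h) = a g (k \<odot>\<^bsub>V\<^esub> t h)"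
      using linear_onD(3)[OF a_lin[OF g] k t(1)[OF hM]] by (simp add: mul_basis t_tr g hM)
    also have "\<dots> = char_act K \<psi> h k \<odot>\<^bsub>V\<^esub> a g v0"
      using linear_onD(3)[OF a_lin[OF g] char_closed[OF h k] v0] by (simp add: t_KH[OF h k])
    finally show "k \<odot>\<^bsub>V\<^esub> t (mul (basis_elt K g) h) = char_act K \<psi> h k \<odot>\<^bsub>V\<^esub> t (basis_elt K g)"
      by (simp add: t_basis g)
  qed
  define b where "b = (\<lambda>(x, k). k \<odot>\<^bsub>V\<^esub> t x)"
  have b: "b \<in> B \<rightarrow> carrier V" using t(1) by (auto simp: B_def b_def)
  define S where "S = balanced_relations K (carrier (group_algebra K (G\<lparr>carrier := H\<rparr>)))
    (group_algebra K G) mul (self_module K) (char_act K \<psi>)"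
  have S_eq: "S =
      {basis_elt K (x \<oplus>\<^bsub>M\<^esub> x', y) \<ominus>\<^bsub>F\<^esub> (basis_elt K (x, y) \<oplus>\<^bsub>F\<^esub> basis_elt K (x', y)) | x x' y.
        x \<in> carrier M \<and> x' \<in> carrier M \<and> y \<in> carrier K} \<union>
      {basis_elt K (x, y \<oplus>\<^bsub>K\<^esub> y') \<ominus>\<^bsub>F\<^esub> (basis_elt K (x, y) \<oplus>\<^bsub>F\<^esub> basis_elt K (x, y')) | x y y'.
        x \<in> carrier M \<and> y \<in> carrier K \<and> y' \<in> carrier K} \<union>
      {basis_elt K (k \<odot>\<^bsub>M\<^esub> x, y) \<ominus>\<^bsub>F\<^esub> k \<odot>\<^bsub>F\<^esub> basis_elt K (x, y) | k x y.
        k \<in> carrier K \<and> x \<in> carrier M \<and> y \<in> carrier K} \<union>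
      {basis_elt K (x, k \<otimes>\<^bsub>K\<^esub> y) \<ominus>\<^bsub>F\<^esub> k \<odot>\<^bsub>F\<^esub> basis_elt K (x, y) | k x y.
        k \<in> carrier K \<and> x \<in> carrier M \<and> y \<in> carrier K} \<union>
      {basis_elt K (mul x h, y) \<ominus>\<^bsub>F\<^esub> basis_elt K (x, char_act K \<psi> h y) | x h y.
        x \<in> carrier M \<and> h \<in> carrier KH \<and> y \<in> carrier K}"
    unfolding S_def balanced_relations_def Let_def M_def F_def B_def KH_def by simp
  have ext_lin: "linear_on K F V (lin_ext K V b)" unfolding F_def by (rule V.lin_ext_linear[OF b])
  note ext = linear_onD[OF ext_lin]
  have ext_basis: "lin_ext K V b (basis_elt K (x, k)) = k \<odot>\<^bsub>V\<^esub> t x"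
    if "x \<in> carrier M" "k \<in> carrier K" for x k
    using V.lin_ext_basis_elt[OF _ b, of "(x, k)"] that by (simp add: B_def b_def)
  note rel = V.lin_ext_relation[OF b, folded F_def]
  have pair: "(x, k) \<in> B" if "x \<in> carrier M" "k \<in> carrier K" for x k
    using that by (simp add: B_def)
  have b_pair: "b (x, k) = k \<odot>\<^bsub>V\<^esub> t x" for x k
    by (simp add: b_def)
  have r: "r \<in> carrier F \<and> lin_ext K V b r = \<zero>\<^bsub>V\<^esub>" if "r \<in> S" for r
    using that unfolding S_eq Un_iff
  proof (elim disjE CollectE exE conjE)
    fix x x' y assume [simp]: "x \<in> carrier M" "x' \<in> carrier M" "y \<in> carrier K"
    assume "r = basis_elt K (x \<oplus>\<^bsub>M\<^esub> x', y) \<ominus>\<^bsub>F\<^esub> (basis_elt K (x, y) \<oplus>\<^bsub>F\<^esub> basis_elt K (x', y))"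
    then show ?thesis
      by (simp add: rel pair basis_F ext ext_basis t V.smult_r_distr b_pair)
  next
    fix x y y' assume [simp]: "x \<in> carrier M" "y \<in> carrier K" "y' \<in> carrier K"
    assume "r = basis_elt K (x, y \<oplus>\<^bsub>K\<^esub> y') \<ominus>\<^bsub>F\<^esub> (basis_elt K (x, y) \<oplus>\<^bsub>F\<^esub> basis_elt K (x, y'))"
    then show ?thesis
      by (simp add: rel pair basis_F ext ext_basis t V.smult_l_distr b_pair)
  next
    fix k x y assume [simp]: "k \<in> carrier K" "x \<in> carrier M" "y \<in> carrier K"
    assume "r = basis_elt K (k \<odot>\<^bsub>M\<^esub> x, y) \<ominus>\<^bsub>F\<^esub> k \<odot>\<^bsub>F\<^esub> basis_elt K (x, y)"
    then show ?thesis
      by (simp add: rel pair basis_F ext ext_basis t V.smult_assoc1[symmetric] K.m_comm b_pair)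
  next
    fix k x y assume [simp]: "k \<in> carrier K" "x \<in> carrier M" "y \<in> carrier K"
    assume "r = basis_elt K (x, k \<otimes>\<^bsub>K\<^esub> y) \<ominus>\<^bsub>F\<^esub> k \<odot>\<^bsub>F\<^esub> basis_elt K (x, y)"
    then show ?thesis
      by (simp add: rel pair basis_F ext ext_basis t V.smult_assoc1 b_pair)
  next
    fix x h y assume [simp]: "x \<in> carrier M" "h \<in> carrier KH" "y \<in> carrier K"
    have [simp]: "mul x h \<in> carrier M" using linear_onD(1)[OF mul_lin[OF subsetD[OF KHM]]] by simp
    assume "r = basis_elt K (mul x h, y) \<ominus>\<^bsub>F\<^esub> basis_elt K (x, char_act K \<psi> h y)"
    then show ?thesis
      by (simp add: rel pair basis_F ext ext_basis t char_closed t_mul b_pair)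
  qed
  \<comment> \<open>Transitivity gives a group element moving the base point to x, in effect a
    representative of the coset of \<open>H\<close> that belongs to x.\<close>
  have "\<exists>s. \<forall>x\<in>E. s x \<in> carrier G \<and> \<phi> (s x) x0 = x"
    using trans by (intro bchoice) auto
  then obtain s where s: "\<And>x. x \<in> E \<Longrightarrow> s x \<in> carrier G" "\<And>x. x \<in> E \<Longrightarrow> \<phi> (s x) x0 = x" by blast
  define cs where "cs x = c (s x) x0" for x
  have cs: "cs x \<in> carrier K" "inv\<^bsub>K\<^esub> (cs x) \<in> carrier K" "inv\<^bsub>K\<^esub> (cs x) \<otimes>\<^bsub>K\<^esub> cs x = \<one>\<^bsub>K\<^esub>" if "x \<in> E" for x
  proof -
    have "cs x \<in> Units K"
      using c_closed[OF s(1)[OF that] x0] c_nonzero[OF s(1)[OF that] x0] by (simp add: cs_def K.field_Units)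
    then show "cs x \<in> carrier K" "inv\<^bsub>K\<^esub> (cs x) \<in> carrier K" "inv\<^bsub>K\<^esub> (cs x) \<otimes>\<^bsub>K\<^esub> cs x = \<one>\<^bsub>K\<^esub>"
      by (simp_all add: K.Units_closed)
  qed
  \<comment> \<open>As \<open>s x\<close> sends \<open>v0\<close> to \<open>cs x\<close> times the
    basis vector of x, the inverse scalar makes the value of this pair the basis vector
    itself.\<close>
  define e where "e x = (basis_elt K (s x), inv\<^bsub>K\<^esub> (cs x))" for x
  have e: "e x \<in> B" if "x \<in> E" for x
    using that cs basis_M s by (simp add: e_def B_def)
  have be: "b (e x) = basis_elt K x" if x: "x \<in> E" for x
  proof -
    have "a (s x) v0 = cs x \<odot>\<^bsub>V\<^esub> basis_elt K x"
      using act_mono_rep_basis_elt[OF s(1)[OF x] x0] by (simp add: a_def v0_def V_def s x cs_def)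
    then show ?thesis
      using cs[OF x] K.basis_elt_closed[OF x]
      by (simp add: b_def e_def t_basis s x V.smult_assoc1[symmetric] V_def[symmetric])
  qed
  have gen: "basis_elt K y \<in> N"
    if N: "submodule N K F" and SN: "S \<subseteq> N" and eN: "\<And>x. x \<in> E \<Longrightarrow> basis_elt K (e x) \<in> N" and y: "y \<in> B"
    for N y
  proof -
    note NE = F.submoduleE[OF N]
    note NI = F.submodule_minusD[OF N]
    have gN: "basis_elt K (basis_elt K g, k) \<in> N" if g: "g \<in> carrier G" and k: "k \<in> carrier K" for g k
    proof -
      define x where "x = \<phi> g x0"
      have x: "x \<in> E" using \<phi>_closed[OF g x0] by (simp add: x_def)
      \<comment> \<open>Both g and \<open>s x\<close> send \<open>x0\<close> to x, so h fixes
        \<open>x0\<close>. Hence g = \<open>s x\<close> h, and h can be moved across the tensor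
        sign, where it turns k into \<open>k'\<close>.\<close>
      define h where "h = inv\<^bsub>G\<^esub> (s x) \<otimes>\<^bsub>G\<^esub> g"
      have hG: "h \<in> carrier G" using g s(1)[OF x] by (simp add: h_def)
      have "\<phi> h x0 = \<phi> (inv\<^bsub>G\<^esub> (s x)) (\<phi> (s x) x0)"
        using g s[OF x] x0 by (simp add: h_def \<phi>_mult x_def)
      also have "\<dots> = x0" using s(1)[OF x] x0 by simp
      finally have hH: "h \<in> H" using hG H by simp
      have hKH: "basis_elt K h \<in> carrier KH" using K.basis_elt_closed[OF hH] by (simp add: KH_def)
      define k' where "k' = char_act K \<psi> (basis_elt K h) k"
      have k': "k' \<in> carrier K" unfolding k'_def by (rule char_closed[OF hKH k])
      have kcs: "k' \<otimes>\<^bsub>K\<^esub> cs x \<in> carrier K" using k' cs(1)[OF x] by simp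
      have "s x \<otimes>\<^bsub>G\<^esub> h = g" using g s(1)[OF x] by (simp add: h_def G.m_assoc[symmetric])
      then have mul: "mul (basis_elt K (s x)) (basis_elt K h) = basis_elt K g"
        using s(1)[OF x] hG by (simp add: mul_basis basis_M K.free_rep_act_basis_elt)
      \<comment> \<open>Shows that the pair of \<open>s x\<close> and \<open>k'\<close> is, modulo
        the relations, a multiple of the chosen generator \<open>e x\<close>.\<close>
      have "k' = (k' \<otimes>\<^bsub>K\<^esub> cs x) \<otimes>\<^bsub>K\<^esub> inv\<^bsub>K\<^esub> (cs x)"
        using k' cs[OF x] by (simp add: K.m_assoc K.m_comm[of "cs x"])
      then have "basis_elt K (basis_elt K (s x), k') \<ominus>\<^bsub>F\<^esub> (k' \<otimes>\<^bsub>K\<^esub> cs x) \<odot>\<^bsub>F\<^esub> basis_elt K (e x) \<in> S"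
        unfolding S_eq e_def using k' cs[OF x] basis_M[OF s(1)[OF x]] K.m_closed[OF k' cs(1)[OF x]]
        by (intro UnI1 UnI2 CollectI exI[of _ "k' \<otimes>\<^bsub>K\<^esub> cs x"] exI[of _ "basis_elt K (s x)"]
            exI[of _ "inv\<^bsub>K\<^esub> (cs x)"]) simp
      from NI[OF subsetD[OF SN this] basis_F[OF pair[OF basis_M[OF s(1)[OF x]] k']]
          F.smult_closed[OF kcs basis_F[OF e[OF x]]] NE(4)[OF kcs eN[OF x]]]
      have *: "basis_elt K (basis_elt K (s x), k') \<in> N" .
      have "basis_elt K (mul (basis_elt K (s x)) (basis_elt K h), k) \<ominus>\<^bsub>F\<^esub> basis_elt K (basis_elt K (s x), k') \<in> S"
        unfolding S_eq k'_def using k hKH basis_M[OF s(1)[OF x]] by blast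
      from NI[OF subsetD[OF SN this[unfolded mul]] basis_F[OF pair[OF basis_M[OF g] k]]
          basis_F[OF pair[OF basis_M[OF s(1)[OF x]] k']] *]
      show ?thesis .
    qed
    obtain u k where y_eq: "y = (u, k)" and u: "u \<in> carrier M" and k: "k \<in> carrier K"
      using y by (auto simp: B_def)
    note M_induct = K.free_module_induct[where B = "carrier G", folded M_def,
      consumes 1, case_names zero basis smult add]
    \<comment> \<open>With k fixed, linearity in the first entry leads from group elements to the
      whole group algebra.\<close>
    have "basis_elt K (u, k) \<in> N"
      using u
    proof (induction rule: M_induct)
      case zero
      \<comment> \<open>The generator of the pair (0, k) is a basis vector of the free module and
        not zero; it is the relation for the scalar zero that puts it into \<open>N\<close>.\<close>
      have "basis_elt K (\<zero>\<^bsub>K\<^esub> \<odot>\<^bsub>M\<^esub> \<zero>\<^bsub>M\<^esub>, k) \<ominus>\<^bsub>F\<^esub> \<zero>\<^bsub>K\<^esub> \<odot>\<^bsub>F\<^esub> basis_elt K (\<zero>\<^bsub>M\<^esub>, k) \<in> S"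
        unfolding S_eq using k K.zero_closed M.M.zero_closed by blast
      then have *: "basis_elt K (\<zero>\<^bsub>M\<^esub>, k) \<ominus>\<^bsub>F\<^esub> \<zero>\<^bsub>F\<^esub> \<in> N"
        using SN k by (auto simp: basis_F pair)
      show ?case
        by (rule NI[OF * basis_F[OF pair[OF M.M.zero_closed k]] F.M.zero_closed submodule_zero_closed[OF N]])
    next
      case (basis g)
      then show ?case using gN k by blast
    next
      case (smult c u)
      have *: "basis_elt K (c \<odot>\<^bsub>M\<^esub> u, k) \<ominus>\<^bsub>F\<^esub> c \<odot>\<^bsub>F\<^esub> basis_elt K (u, k) \<in> S"
        unfolding S_eq using k smult(1,2) by blast
      show ?case
        by (rule NI[OF subsetD[OF SN *] basis_F[OF pair[OF M.smult_closed[OF smult(1,2)] k]]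
            F.smult_closed[OF smult(1) basis_F[OF pair[OF smult(2) k]]] NE(4)[OF smult(1,3)]])
    next
      case (add u v)
      have *: "basis_elt K (u \<oplus>\<^bsub>M\<^esub> v, k) \<ominus>\<^bsub>F\<^esub> (basis_elt K (u, k) \<oplus>\<^bsub>F\<^esub> basis_elt K (v, k)) \<in> S"
        unfolding S_eq using k add(1,2) by blast
      show ?case
        by (rule NI[OF subsetD[OF SN *] basis_F[OF pair[OF M.M.a_closed[OF add(1,2)] k]]
            F.M.a_closed[OF basis_F[OF pair[OF add(1) k]] basis_F[OF pair[OF add(2) k]]] NE(5)[OF add(3,4)]])
    qed
    then show ?thesis by (simp add: y_eq)
  qed
  define \<phi>' where "\<phi>' = (\<lambda>g (x, k :: 'a). (mul (basis_elt K g) x, k))"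
  have "rep_isomorphic G K (module.extend (free_module K E) (rep.fields a))
    (quot_rep (free_rep K B \<phi>') (submodule_span K (free_rep K B \<phi>') S))"
  proof (rule quot_free_rep_isomorphic[where b = b and e = e])
    show "linear_representation G K (module.extend (free_module K E) (rep.fields a))"
      using MV unfolding V_mono unfolding V_def .
    show "b \<in> B \<rightarrow> carrier (free_module K E)" using b by (simp add: V_def)
    show "S \<subseteq> carrier (free_module K B)" using r by (auto simp: F_def)
    show "lin_ext K (free_module K E) b w = \<zero>\<^bsub>free_module K E\<^esub>" if "w \<in> S" for w
      using r[OF that] by (simp add: V_def)
    show "e x \<in> B" "b (e x) = basis_elt K x" if "x \<in> E" for x
      using e[OF that] be[OF that] .
    show "basis_elt K y \<in> N" if "submodule N K (free_module K B)" "S \<subseteq> N"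
      "\<And>x. x \<in> E \<Longrightarrow> basis_elt K (e x) \<in> N" "y \<in> B" for N y
      by (rule gen[OF that(1)[folded F_def] that(2,3,4)])
    fix g y assume g: "g \<in> carrier G" and "y \<in> B"
    then obtain x k where y: "y = (x, k)" "x \<in> carrier M" "k \<in> carrier K" by (auto simp: B_def)
    show "\<phi>' g y \<in> B"
      using linear_onD(1)[OF tr_lin[OF g]] y g by (simp add: \<phi>'_def B_def mul_basis)
    show "b (\<phi>' g y) = a g (b y)"
      using linear_onD(3)[OF a_lin[OF g]] y g t(1)
      by (simp add: \<phi>'_def b_def mul_basis t_tr)
  qed
  then show ?thesis
    unfolding V_mono ind_rep_def Let_def S_def B_def M_def V_def \<phi>'_def mul_def
    by simp
qed

end

section \<open>Tensor products of monomial representations\<close>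

lemma (in field) finprod_nonzero:
  assumes "finite A" "\<And>i. i \<in> A \<Longrightarrow> f i \<in> carrier R" "\<And>i. i \<in> A \<Longrightarrow> f i \<noteq> \<zero>"
  shows "finprod R f A \<noteq> \<zero>"
  using assms
proof (induction rule: finite_induct)
  case (insert i A)
  then have "finprod R f (insert i A) = f i \<otimes> finprod R f A" by (intro finprod_insert) auto
  moreover have "finprod R f A \<in> carrier R" using insert.prems by (intro finprod_closed) auto
  ultimately show ?case using insert by (simp add: integral_iff)
qed simp

text \<open>The cocycle identity holds in each coordinate and is multiplied up, K being commutative.
  The action and the scalars are prescribed on the product only, which lets
  \<open>product_action\<close> and \<open>beta\<close> be inserted.\<close>

lemma monomial_action_PiE:
  assumes G: "group G" and K: "field K" and J: "finite J"
    and mono: "\<And>j. j \<in> J \<Longrightarrow> monomial_action G K (E j) (\<phi> j) (c j)"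
    and \<phi>': "\<And>g x. \<lbrakk>g \<in> carrier G; x \<in> (\<Pi>\<^sub>E j\<in>J. E j)\<rbrakk> \<Longrightarrow> \<phi>' g x = (\<lambda>j\<in>J. \<phi> j g (x j))"
    and c': "\<And>g x. \<lbrakk>g \<in> carrier G; x \<in> (\<Pi>\<^sub>E j\<in>J. E j)\<rbrakk> \<Longrightarrow> c' g x = (\<Otimes>\<^bsub>K\<^esub>j\<in>J. c j g (x j))"
  shows "monomial_action G K (\<Pi>\<^sub>E j\<in>J. E j) \<phi>' c'"
proof -
  interpret G: group G by (rule G)
  interpret K: field K by (rule K)
  note ax = monomial_action.\<phi>_closed[OF mono] monomial_action.\<phi>_one[OF mono]
    monomial_action.\<phi>_mult[OF mono] monomial_action.c_closed[OF mono]
    monomial_action.c_nonzero[OF mono] monomial_action.c_mult[OF mono]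
  have el: "x j \<in> E j" if "x \<in> (\<Pi>\<^sub>E j\<in>J. E j)" "j \<in> J" for x j
    using that by auto
  have cl: "\<phi>' g x \<in> (\<Pi>\<^sub>E j\<in>J. E j)" if "g \<in> carrier G" "x \<in> (\<Pi>\<^sub>E j\<in>J. E j)" for g x
    unfolding \<phi>'[OF that] restrict_PiE_iff using that by (auto intro!: ax)
  show ?thesis
  proof (intro monomial_action.intro monomial_action_axioms.intro)
    show "finite (\<Pi>\<^sub>E j\<in>J. E j)"
      using J monomial_action.finite_E[OF mono] by (rule finite_PiE)
  next
    fix x assume x: "x \<in> (\<Pi>\<^sub>E j\<in>J. E j)"
    show "\<phi>' \<one>\<^bsub>G\<^esub> x = x"
    proof (rule PiE_ext[OF cl[OF G.one_closed x] x])
      show "\<phi>' \<one>\<^bsub>G\<^esub> x j = x j" if "j \<in> J" for j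
        using that by (simp add: \<phi>' x ax el[OF x])
    qed
    fix g assume g: "g \<in> carrier G"
    show "\<phi>' g x \<in> (\<Pi>\<^sub>E j\<in>J. E j)" using g x by (rule cl)
    show "c' g x \<in> carrier K"
      unfolding c'[OF g x] using g el[OF x] by (intro K.finprod_closed) (auto intro!: ax)
    show "c' g x \<noteq> \<zero>\<^bsub>K\<^esub>"
      unfolding c'[OF g x] using g el[OF x] J by (intro K.finprod_nonzero) (auto simp: ax)
    fix h assume h: "h \<in> carrier G"
    show "\<phi>' (g \<otimes>\<^bsub>G\<^esub> h) x = \<phi>' g (\<phi>' h x)"
    proof (rule PiE_ext[OF cl[OF G.m_closed[OF g h] x] cl[OF g cl[OF h x]]])
      show "\<phi>' (g \<otimes>\<^bsub>G\<^esub> h) x j = \<phi>' g (\<phi>' h x) j" if "j \<in> J" for j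
        using that unfolding \<phi>'[OF G.m_closed[OF g h] x] \<phi>'[OF g cl[OF h x]]
        by (simp add: \<phi>'[OF h x] g h ax el[OF x])
    qed
    have "c' (g \<otimes>\<^bsub>G\<^esub> h) x = (\<Otimes>\<^bsub>K\<^esub>j\<in>J. c j g (\<phi> j h (x j)) \<otimes>\<^bsub>K\<^esub> c j h (x j))"
      unfolding c'[OF G.m_closed[OF g h] x]
      using g h el[OF x] by (intro K.finprod_cong') (auto simp: ax)
    also have "\<dots> = (\<Otimes>\<^bsub>K\<^esub>j\<in>J. c j g (\<phi> j h (x j))) \<otimes>\<^bsub>K\<^esub> (\<Otimes>\<^bsub>K\<^esub>j\<in>J. c j h (x j))"
      using g h el[OF x] by (intro K.finprod_multf) (auto simp: ax)
    also have "(\<Otimes>\<^bsub>K\<^esub>j\<in>J. c j g (\<phi> j h (x j))) = c' g (\<phi>' h x)"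
      unfolding c'[OF g cl[OF h x]]
      using g h el[OF x] by (intro K.finprod_cong') (auto simp: ax \<phi>'[OF h x])
    finally show "c' (g \<otimes>\<^bsub>G\<^esub> h) x = c' g (\<phi>' h x) \<otimes>\<^bsub>K\<^esub> c' h x"
      by (simp add: c'[OF h x])
  qed (rule G K)+
qed

text \<open>A coordinate of a pure tensor is a product of coordinates, one from each factor. The
  factors are merely isomorphic to monomial representations, and these isomorphisms
  \<open>f j\<close> serve as coordinate systems on them.\<close>

lemma tensor_rep_isomorphic:
  assumes G: "group G" and K: "field K" and J: "finite J"
    and mono: "\<And>j. j \<in> J \<Longrightarrow> monomial_action G K (E j) (\<phi> j) (c j)"
    and iso: "\<And>j. j \<in> J \<Longrightarrow> rep_isomorphic G K (V j) (mono_rep G K (E j) (\<phi> j) (c j))"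
    and \<phi>': "\<And>g x. \<lbrakk>g \<in> carrier G; x \<in> (\<Pi>\<^sub>E j\<in>J. E j)\<rbrakk> \<Longrightarrow> \<phi>' g x = (\<lambda>j\<in>J. \<phi> j g (x j))"
    and c': "\<And>g x. \<lbrakk>g \<in> carrier G; x \<in> (\<Pi>\<^sub>E j\<in>J. E j)\<rbrakk> \<Longrightarrow> c' g x = (\<Otimes>\<^bsub>K\<^esub>j\<in>J. c j g (x j))"
  shows "rep_isomorphic G K (mono_rep G K (\<Pi>\<^sub>E j\<in>J. E j) \<phi>' c') (tensor_rep K J V)"
proof -
  interpret G: group G by (rule G)
  interpret K: field K by (rule K)
  define P where "P = (\<Pi>\<^sub>E j\<in>J. E j)"
  interpret P: monomial_action G K P \<phi>' c'
    unfolding P_def by (rule monomial_action_PiE[OF G K J mono \<phi>' c'])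
  have "\<exists>f. \<forall>j\<in>J. linear_representation G K (V j) \<and>
      bij_betw (f j) (carrier (V j)) (carrier (free_module K (E j))) \<and>
      linear_on K (V j) (free_module K (E j)) (f j) \<and>
      (\<forall>g\<in>carrier G. \<forall>v\<in>carrier (V j). f j (act (V j) g v) =
        act (mono_rep G K (E j) (\<phi> j) (c j)) g (f j v))"
  proof (intro bchoice ballI)
    fix j assume "j \<in> J"
    show "\<exists>f. linear_representation G K (V j) \<and>
      bij_betw f (carrier (V j)) (carrier (free_module K (E j))) \<and>
      linear_on K (V j) (free_module K (E j)) f \<and>
      (\<forall>g\<in>carrier G. \<forall>v\<in>carrier (V j). f (act (V j) g v) =
        act (mono_rep G K (E j) (\<phi> j) (c j)) g (f v))"
      using iso[OF \<open>j \<in> J\<close>] by (rule rep_isomorphicE) auto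
  qed
  then obtain f where Vj: "\<And>j. j \<in> J \<Longrightarrow> linear_representation G K (V j)"
    and bij: "\<And>j. j \<in> J \<Longrightarrow> bij_betw (f j) (carrier (V j)) (carrier (free_module K (E j)))"
    and lin: "\<And>j. j \<in> J \<Longrightarrow> linear_on K (V j) (free_module K (E j)) (f j)"
    and equiv: "\<And>j g v. \<lbrakk>j \<in> J; g \<in> carrier G; v \<in> carrier (V j)\<rbrakk> \<Longrightarrow>
      f j (act (V j) g v) = act (mono_rep G K (E j) (\<phi> j) (c j)) g (f j v)"
    by blast
  define h where "h j = inv_into (carrier (V j)) (f j)" for j
  have modV: "module K (V j)" if "j \<in> J" for j
    using Vj[OF that] by (rule linear_representation.axioms(3))
  have h_lin: "linear_on K (free_module K (E j)) (V j) (h j)" if "j \<in> J" for j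
    unfolding h_def by (rule linear_on_inv_into[OF modV[OF that] bij[OF that] lin[OF that]])
  have fh: "f j (h j u) = u" if "j \<in> J" "u \<in> carrier (free_module K (E j))" for j u
    using bij_betw_inv_into_right[OF bij[OF that(1)] that(2)] by (simp add: h_def)
  have hf: "h j (f j v) = v" if "j \<in> J" "v \<in> carrier (V j)" for j v
    using bij_betw_inv_into_left[OF bij[OF that(1)] that(2)] by (simp add: h_def)
  have f_cl: "f j v x \<in> carrier K" if "j \<in> J" "v \<in> carrier (V j)" for j v x
    using linear_onD(1)[OF lin[OF that(1)] that(2)] by (simp add: free_module_simps)
  define B where "B = (\<Pi>\<^sub>E j\<in>J. carrier (V j))"
  define F where "F = free_module K B"
  \<comment> \<open>The coordinate of the pure tensor of v at the tuple x.\<close>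
  define b where "b v = (\<lambda>x. if x \<in> P then \<Otimes>\<^bsub>K\<^esub>j\<in>J. f j (v j) (x j) else \<zero>\<^bsub>K\<^esub>)" for v
  interpret F: module K F unfolding F_def by (rule K.module_free_module)
  interpret W: module K "free_module K P" by (rule K.module_free_module)
  have Bel: "v j \<in> carrier (V j)" if "v \<in> B" "j \<in> J" for v j
    using that by (auto simp: B_def)
  have Pel: "x j \<in> E j" if "x \<in> P" "j \<in> J" for x j
    using that by (auto simp: P_def)
  have upd: "v(j := w) \<in> B" if "v \<in> B" "j \<in> J" "w \<in> carrier (V j)" for v j w
    using that by (auto simp: B_def PiE_iff extensional_def)
  have b: "b \<in> B \<rightarrow> carrier (free_module K P)"
  proof
    fix v assume v: "v \<in> B"
    show "b v \<in> carrier (free_module K P)"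
      unfolding P.carrier_free_module_iff b_def using Bel[OF v]
      by (auto intro!: K.finprod_closed f_cl)
  qed
  \<comment> \<open>Isolates the only factor that depends on position j. Multilinearity of
    \<open>b\<close> then follows from linearity of \<open>f j\<close>.\<close>
  have b_upd: "b (v(j := w)) x = f j w (x j) \<otimes>\<^bsub>K\<^esub> (\<Otimes>\<^bsub>K\<^esub>i\<in>J - {j}. f i (v i) (x i))"
    and rest_cl: "(\<Otimes>\<^bsub>K\<^esub>i\<in>J - {j}. f i (v i) (x i)) \<in> carrier K"
    if v: "v \<in> B" and j: "j \<in> J" and w: "w \<in> carrier (V j)" and x: "x \<in> P" for v j w x
  proof -
    have "b (v(j := w)) x = (\<Otimes>\<^bsub>K\<^esub>i\<in>insert j (J - {j}). f i ((v(j := w)) i) (x i))"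
      using x j by (simp add: b_def insert_absorb)
    also have "\<dots> = f j w (x j) \<otimes>\<^bsub>K\<^esub> (\<Otimes>\<^bsub>K\<^esub>i\<in>J - {j}. f i ((v(j := w)) i) (x i))"
      using J j Bel[OF upd[OF v j w]] f_cl[OF j w]
      by (subst K.finprod_insert) (auto intro!: f_cl simp del: fun_upd_apply, simp)
    also have "(\<Otimes>\<^bsub>K\<^esub>i\<in>J - {j}. f i ((v(j := w)) i) (x i)) = (\<Otimes>\<^bsub>K\<^esub>i\<in>J - {j}. f i (v i) (x i))"
      using Bel[OF v] by (intro K.finprod_cong') (auto intro!: f_cl)
    finally show "b (v(j := w)) x = f j w (x j) \<otimes>\<^bsub>K\<^esub> (\<Otimes>\<^bsub>K\<^esub>i\<in>J - {j}. f i (v i) (x i))" .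
    show "(\<Otimes>\<^bsub>K\<^esub>i\<in>J - {j}. f i (v i) (x i)) \<in> carrier K"
      using Bel[OF v] by (intro K.finprod_closed) (auto intro!: f_cl)
  qed
  have b_out: "b v x = \<zero>\<^bsub>K\<^esub>" if "x \<notin> P" for v x
    using that by (simp add: b_def)
  have b_add: "b (v(j := w \<oplus>\<^bsub>V j\<^esub> w')) = b (v(j := w)) \<oplus>\<^bsub>free_module K P\<^esub> b (v(j := w'))"
    if v: "v \<in> B" and j: "j \<in> J" and w: "w \<in> carrier (V j)" "w' \<in> carrier (V j)" for v j w w'
  proof
    fix x
    interpret Vj: module K "V j" by (rule modV[OF j])
    show "b (v(j := w \<oplus>\<^bsub>V j\<^esub> w')) x = (b (v(j := w)) \<oplus>\<^bsub>free_module K P\<^esub> b (v(j := w'))) x"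
      using rest_cl[OF v j w(1)] f_cl[OF j] w linear_onD(2)[OF lin[OF j] w]
      by (cases "x \<in> P") (simp_all add: b_upd[OF v j] b_out free_module_simps(3) K.l_distr)
  qed
  have b_smult: "b (v(j := k \<odot>\<^bsub>V j\<^esub> w)) = k \<odot>\<^bsub>free_module K P\<^esub> b (v(j := w))"
    if v: "v \<in> B" and j: "j \<in> J" and k: "k \<in> carrier K" and w: "w \<in> carrier (V j)" for v j k w
  proof
    fix x
    interpret Vj: module K "V j" by (rule modV[OF j])
    show "b (v(j := k \<odot>\<^bsub>V j\<^esub> w)) x = (k \<odot>\<^bsub>free_module K P\<^esub> b (v(j := w))) x"
      using rest_cl[OF v j w] f_cl[OF j] k w linear_onD(3)[OF lin[OF j] k w]
      by (cases "x \<in> P") (simp_all add: b_upd[OF v j] b_out free_module_simps(4) K.m_assoc)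
  qed
  define S where "S = multilinear_relations K J V"
  have S_eq: "S =
      {basis_elt K (v(j := w \<oplus>\<^bsub>V j\<^esub> w')) \<ominus>\<^bsub>F\<^esub> (basis_elt K (v(j := w)) \<oplus>\<^bsub>F\<^esub> basis_elt K (v(j := w'))) | v j w w'.
        v \<in> B \<and> j \<in> J \<and> w \<in> carrier (V j) \<and> w' \<in> carrier (V j)} \<union>
      {basis_elt K (v(j := k \<odot>\<^bsub>V j\<^esub> w)) \<ominus>\<^bsub>F\<^esub> k \<odot>\<^bsub>F\<^esub> basis_elt K (v(j := w)) | v j k w.
        v \<in> B \<and> j \<in> J \<and> k \<in> carrier K \<and> w \<in> carrier (V j)}"
    unfolding S_def multilinear_relations_def Let_def F_def B_def by simp
  have basis_F: "basis_elt K v \<in> carrier F" if "v \<in> B" for v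
    using K.basis_elt_closed[OF that] by (simp add: F_def)
  have ext_lin: "linear_on K F (free_module K P) (lin_ext K (free_module K P) b)"
    unfolding F_def by (rule W.lin_ext_linear[OF b])
  note ext = linear_onD[OF ext_lin]
  have ext_basis: "lin_ext K (free_module K P) b (basis_elt K v) = b v" if "v \<in> B" for v
    by (rule W.lin_ext_basis_elt[OF that b])
  note rel = W.lin_ext_relation[OF b, folded F_def]
  have r: "r \<in> carrier F \<and> lin_ext K (free_module K P) b r = \<zero>\<^bsub>free_module K P\<^esub>" if "r \<in> S" for r
    using that unfolding S_eq Un_iff
  proof (elim disjE CollectE exE conjE)
    fix v j w w' assume v: "v \<in> B" and j: "j \<in> J" and w: "w \<in> carrier (V j)" "w' \<in> carrier (V j)"
    interpret Vj: module K "V j" by (rule modV[OF j])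
    assume "r = basis_elt K (v(j := w \<oplus>\<^bsub>V j\<^esub> w')) \<ominus>\<^bsub>F\<^esub>
      (basis_elt K (v(j := w)) \<oplus>\<^bsub>F\<^esub> basis_elt K (v(j := w')))"
    then show ?thesis
      by (simp add: rel upd[OF v j] w basis_F ext ext_basis b_add[OF v j])
  next
    fix v j k w assume v: "v \<in> B" and j: "j \<in> J" and k: "k \<in> carrier K" and w: "w \<in> carrier (V j)"
    interpret Vj: module K "V j" by (rule modV[OF j])
    assume "r = basis_elt K (v(j := k \<odot>\<^bsub>V j\<^esub> w)) \<ominus>\<^bsub>F\<^esub> k \<odot>\<^bsub>F\<^esub> basis_elt K (v(j := w))"
    then show ?thesis
      by (simp add: rel upd[OF v j] k w basis_F ext ext_basis b_smult[OF v j])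
  qed
  \<comment> \<open>The basis vector of z carried back to the factor, that is, the vector of
    \<open>V j\<close> whose only non-zero coordinate is 1, at z.\<close>
  define d where "d j z = h j (basis_elt K z)" for j z
  have d: "d j z \<in> carrier (V j)" "f j (d j z) = basis_elt K z" if "j \<in> J" "z \<in> E j" for j z
    using linear_onD(1)[OF h_lin[OF that(1)]] fh[OF that(1)] K.basis_elt_closed[OF that(2)]
    by (simp_all add: d_def)
  define e where "e x = (\<lambda>j\<in>J. d j (x j))" for x
  have e: "e x \<in> B" if "x \<in> P" for x
    using d(1) Pel[OF that] by (simp add: e_def B_def)
  have be: "b (e x) = basis_elt K x" if x: "x \<in> P" for x
  proof
    fix y
    consider (1) "y = x" | (2) "y \<in> P" "y \<noteq> x" | (3) "y \<notin> P" "y \<noteq> x" using x by blast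
    then show "b (e x) y = basis_elt K x y"
    proof cases
      case 1
      have "(\<Otimes>\<^bsub>K\<^esub>j\<in>J. f j (e x j) (x j)) = \<one>\<^bsub>K\<^esub>"
        using d(2) Pel[OF x] by (intro K.finprod_one_eqI) (simp add: e_def basis_elt_def)
      then show ?thesis using 1 x by (simp add: b_def basis_elt_def)
    next
      case 2
      then obtain j where j: "j \<in> J" "y j \<noteq> x j"
        using x PiE_ext[of y J E x] by (auto simp: P_def)
      have "f j (e x j) (y j) = \<zero>\<^bsub>K\<^esub>"
        using j d(2)[OF j(1) Pel[OF x j(1)]] by (simp add: e_def basis_elt_def)
      \<comment> \<open>The trivial update brings \<open>b_upd\<close> into play, which pulls the
        vanishing factor out of the product.\<close>
      then have "b ((e x)(j := e x j)) y = \<zero>\<^bsub>K\<^esub>"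
        using b_upd[OF e[OF x] j(1) Bel[OF e[OF x] j(1)] 2(1)]
          rest_cl[OF e[OF x] j(1) Bel[OF e[OF x] j(1)] 2(1)] by simp
      then show ?thesis using 2 by (simp add: basis_elt_def)
    next
      case 3
      then show ?thesis by (simp add: b_out basis_elt_def)
    qed
  qed
  have gen: "basis_elt K v \<in> N"
    if N: "submodule N K F" and SN: "S \<subseteq> N" and eN: "\<And>x. x \<in> P \<Longrightarrow> basis_elt K (e x) \<in> N" and vB: "v \<in> B"
    for N v
  proof -
    note NE = F.submoduleE[OF N]
    note NI = F.submodule_minusD[OF N]
    \<comment> \<open>Multilinear expansion, by induction on a set \<open>A\<close> of positions
      outside which all entries are already basis vectors \<open>d j z\<close>. When
      \<open>A\<close> is empty, v is one of the chosen tuples \<open>e x\<close>.\<close>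
    have "basis_elt K v \<in> N"
      if "finite A" "A \<subseteq> J" "v \<in> B" "\<forall>j\<in>J - A. \<exists>z\<in>E j. v j = d j z" for A v
      using that
    proof (induction A arbitrary: v rule: finite_induct)
      case empty
      then obtain z where z: "\<And>j. j \<in> J \<Longrightarrow> z j \<in> E j \<and> v j = d j (z j)" by (metis Diff_empty)
      have "restrict z J \<in> P" using z by (simp add: P_def)
      moreover have "v = e (restrict z J)"
      proof (rule PiE_ext[of _ J "\<lambda>j. carrier (V j)"])
        show "v \<in> (\<Pi>\<^sub>E j\<in>J. carrier (V j))" "e (restrict z J) \<in> (\<Pi>\<^sub>E j\<in>J. carrier (V j))"
          using empty.prems(2) e[OF calculation] by (simp_all add: B_def)
        show "v j = e (restrict z J) j" if "j \<in> J" for j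
          using z[OF that] that by (simp add: e_def)
      qed
      ultimately show ?case using eN by simp
    next
      case (insert j A)
      then have j: "j \<in> J" and v: "v \<in> B" by auto
      interpret Vj: module K "V j" by (rule modV[OF j])
      note hj = linear_onD[OF h_lin[OF j]]
      interpret Ej: module K "free_module K (E j)" by (rule K.module_free_module)
      have h0: "h j \<zero>\<^bsub>free_module K (E j)\<^esub> = \<zero>\<^bsub>V j\<^esub>"
        by (rule linear_on_zero[OF Ej.module_axioms Vj.module_axioms h_lin[OF j]])
      \<comment> \<open>The entry at j is written through its coordinate vector u. The relations at
        position j reduce u to basis vectors, where the induction hypothesis applies, and u =
        \<open>f j (v j)\<close> returns v itself.\<close>
      have "basis_elt K (v(j := h j u)) \<in> N" if "u \<in> carrier (free_module K (E j))" for u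
        using that
      proof (induction rule: K.free_module_induct)
        case zero
        have "basis_elt K (v(j := \<zero>\<^bsub>K\<^esub> \<odot>\<^bsub>V j\<^esub> \<zero>\<^bsub>V j\<^esub>)) \<ominus>\<^bsub>F\<^esub>
            \<zero>\<^bsub>K\<^esub> \<odot>\<^bsub>F\<^esub> basis_elt K (v(j := \<zero>\<^bsub>V j\<^esub>)) \<in> S"
          unfolding S_eq using v j K.zero_closed Vj.M.zero_closed by blast
        then have *: "basis_elt K (v(j := \<zero>\<^bsub>V j\<^esub>)) \<ominus>\<^bsub>F\<^esub> \<zero>\<^bsub>F\<^esub> \<in> N"
          using SN by (auto simp: basis_F upd[OF v j])
        show ?case
          unfolding h0
          by (rule NI[OF * basis_F[OF upd[OF v j Vj.M.zero_closed]] F.M.zero_closed submodule_zero_closed[OF N]])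
      next
        case (basis z)
        have "\<forall>i\<in>J - A. \<exists>z'\<in>E i. (v(j := h j (basis_elt K z))) i = d i z'"
          using insert.prems(3) basis by (auto simp: d_def)
        then show ?case
          using insert.prems(1) d(1)[OF j basis] by (intro insert.IH upd[OF v j]) (auto simp: d_def)
      next
        case (smult k u)
        have *: "basis_elt K (v(j := k \<odot>\<^bsub>V j\<^esub> h j u)) \<ominus>\<^bsub>F\<^esub> k \<odot>\<^bsub>F\<^esub> basis_elt K (v(j := h j u)) \<in> S"
          unfolding S_eq using v j smult(1) hj(1)[OF smult(2)] by blast
        show ?case
          unfolding hj(3)[OF smult(1,2)]
          by (rule NI[OF subsetD[OF SN *] basis_F[OF upd[OF v j Vj.smult_closed[OF smult(1) hj(1)[OF smult(2)]]]]
              F.smult_closed[OF smult(1) basis_F[OF upd[OF v j hj(1)[OF smult(2)]]]] NE(4)[OF smult(1,3)]])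
      next
        case (add u u')
        have *: "basis_elt K (v(j := h j u \<oplus>\<^bsub>V j\<^esub> h j u')) \<ominus>\<^bsub>F\<^esub>
            (basis_elt K (v(j := h j u)) \<oplus>\<^bsub>F\<^esub> basis_elt K (v(j := h j u'))) \<in> S"
          unfolding S_eq using v j hj(1)[OF add(1)] hj(1)[OF add(2)] by blast
        show ?case
          unfolding hj(2)[OF add(1,2)]
          by (rule NI[OF subsetD[OF SN *] basis_F[OF upd[OF v j Vj.M.a_closed[OF hj(1)[OF add(1)] hj(1)[OF add(2)]]]]
              F.M.a_closed[OF basis_F[OF upd[OF v j hj(1)[OF add(1)]]] basis_F[OF upd[OF v j hj(1)[OF add(2)]]]]
              NE(5)[OF add(3,4)]])
      qed
      from this[OF linear_onD(1)[OF lin[OF j] Bel[OF v j]]] show ?case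
        by (simp add: hf[OF j Bel[OF v j]])
    qed
    from this[OF J subset_refl vB] show ?thesis by simp
  qed
  have "rep_isomorphic G K (module.extend (free_module K P) (rep.fields (act (mono_rep G K P \<phi>' c'))))
    (quot_rep (free_rep K B (\<lambda>g v. \<lambda>j\<in>J. act (V j) g (v j)))
      (submodule_span K (free_rep K B (\<lambda>g v. \<lambda>j\<in>J. act (V j) g (v j))) S))"
  proof (rule quot_free_rep_isomorphic[where b = b and e = e])
    show "linear_representation G K
        (module.extend (free_module K P) (rep.fields (act (mono_rep G K P \<phi>' c'))))"
      using P.linear_representation_mono_rep by (simp add: mono_rep_def)
    show "b \<in> B \<rightarrow> carrier (free_module K P)" by (rule b)
    show "S \<subseteq> carrier (free_module K B)" using r by (auto simp: F_def)
    show "lin_ext K (free_module K P) b w = \<zero>\<^bsub>free_module K P\<^esub>" if "w \<in> S" for w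
      using r[OF that] by simp
    show "e x \<in> B" "b (e x) = basis_elt K x" if "x \<in> P" for x
      using e[OF that] be[OF that] .
    show "basis_elt K y \<in> N" if "submodule N K (free_module K B)" "S \<subseteq> N"
      "\<And>x. x \<in> P \<Longrightarrow> basis_elt K (e x) \<in> N" "y \<in> B" for N y
      by (rule gen[OF that(1)[folded F_def] that(2,3,4)])
    fix g v assume g: "g \<in> carrier G" and v: "v \<in> B"
    show gv: "(\<lambda>j\<in>J. act (V j) g (v j)) \<in> B"
      using linear_representation.act_closed[OF Vj g Bel[OF v]] by (simp add: B_def)
    show "b (\<lambda>j\<in>J. act (V j) g (v j)) = act (mono_rep G K P \<phi>' c') g (b v)"
    proof
      fix x
      show "b (\<lambda>j\<in>J. act (V j) g (v j)) x = act (mono_rep G K P \<phi>' c') g (b v) x"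
      proof (cases "x \<in> P")
        case False
        then show ?thesis by (simp add: b_out act_mono_rep)
      next
        case x: True
        \<comment> \<open>The action on functions evaluates at the point g^-1 x, and since
          \<open_placeholder> is avoided here the same point is read coordinatewise in every
          factor.\<close>
        define y where "y = \<phi>' (inv\<^bsub>G\<^esub> g) x"
        have y: "y \<in> P" unfolding y_def using g x by (intro P.\<phi>_closed) auto
        have yj: "y j = \<phi> j (inv\<^bsub>G\<^esub> g) (x j)" if "j \<in> J" for j
          using \<phi>'[of "inv\<^bsub>G\<^esub> g" x] g x that by (simp add: y_def P_def)
        have cy: "c j g (y j) \<in> carrier K" if "j \<in> J" for j
          using monomial_action.c_closed[OF mono[OF that] g Pel[OF y that]] .
        have "b (\<lambda>j\<in>J. act (V j) g (v j)) x = (\<Otimes>\<^bsub>K\<^esub>j\<in>J. f j (act (V j) g (v j)) (x j))"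
          using x Bel[OF gv] by (auto simp: b_def intro!: K.finprod_cong' f_cl)
        also have "\<dots> = (\<Otimes>\<^bsub>K\<^esub>j\<in>J. c j g (y j) \<otimes>\<^bsub>K\<^esub> f j (v j) (y j))"
          using Bel[OF v] cy f_cl Pel[OF x]
          by (intro K.finprod_cong') (auto simp: equiv[OF _ g] act_mono_rep yj)
        also have "\<dots> = (\<Otimes>\<^bsub>K\<^esub>j\<in>J. c j g (y j)) \<otimes>\<^bsub>K\<^esub> (\<Otimes>\<^bsub>K\<^esub>j\<in>J. f j (v j) (y j))"
          using Bel[OF v] cy f_cl by (intro K.finprod_multf) auto
        also have "\<dots> = c' g y \<otimes>\<^bsub>K\<^esub> b v y"
          using c'[OF g y[unfolded P_def]] y by (simp add: b_def)
        finally show ?thesis using x by (simp add: act_mono_rep y_def)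
      qed
    qed
  qed
  then show ?thesis
    by (simp add: mono_rep_def tensor_rep_def Let_def P_def B_def S_def)
qed

section \<open>Orbit decomposition of monomial representations\<close>

lemma direct_sum_rep_simps [simp]:
  "\<zero>\<^bsub>direct_sum_rep T V\<^esub> = (\<lambda>t\<in>T. \<zero>\<^bsub>V t\<^esub>)"
  "f \<oplus>\<^bsub>direct_sum_rep T V\<^esub> f' = (\<lambda>t\<in>T. f t \<oplus>\<^bsub>V t\<^esub> f' t)"
  "k \<odot>\<^bsub>direct_sum_rep T V\<^esub> f = (\<lambda>t\<in>T. k \<odot>\<^bsub>V t\<^esub> f t)"
  "act (direct_sum_rep T V) g f = (\<lambda>t\<in>T. act (V t) g (f t))"
  by (simp_all add: direct_sum_rep_def)

text \<open>Needed because two descriptions of a subgroup are known to agree only for indices in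
  \<open>T\<close>.\<close>

lemma direct_sum_rep_cong:
  assumes "\<And>t. t \<in> T \<Longrightarrow> V t = V' t"
  shows "direct_sum_rep T V = direct_sum_rep T V'"
proof -
  have "(\<Pi>\<^sub>E t\<in>T. carrier (V t)) = (\<Pi>\<^sub>E t\<in>T. carrier (V' t))"
    using assms by (intro PiE_cong) simp
  moreover have "{t \<in> T. f t \<noteq> \<zero>\<^bsub>V t\<^esub>} = {t \<in> T. f t \<noteq> \<zero>\<^bsub>V' t\<^esub>}" for f
    using assms by auto
  ultimately show ?thesis
    using assms by (simp add: direct_sum_rep_def fun_eq_iff cong: restrict_cong)
qed

lemma carrier_direct_sum_rep_finite:
  "finite T \<Longrightarrow> carrier (direct_sum_rep T V) = (\<Pi>\<^sub>E t\<in>T. carrier (V t))"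
  by (simp add: direct_sum_rep_def)

lemma (in monomial_action) monomial_action_subset:
  assumes "D \<subseteq> E" "\<And>g x. \<lbrakk>g \<in> carrier G; x \<in> D\<rbrakk> \<Longrightarrow> \<phi> g x \<in> D"
  shows "monomial_action G K D \<phi> c"
  using assms(2) subsetD[OF assms(1)] finite_subset[OF assms(1) finite_E]
  by (intro monomial_action.intro monomial_action_axioms.intro G.is_group K.field_axioms)
    (simp_all add: \<phi>_one \<phi>_mult c_closed c_nonzero c_mult)

text \<open>A function on \<open>E\<close> amounts to the family of its restrictions to the disjoint
  invariant blocks \<open>D t\<close>. The isomorphisms with the \<open>V t\<close> are composed
  with this splitting at once, so that the axioms of the direct sum are obtained by
  transport.\<close>

lemma (in monomial_action) mono_rep_direct_sum:
  assumes T: "finite T" and E: "E = (\<Union>t\<in>T. D t)"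
    and disj: "\<And>t t' x. \<lbrakk>t \<in> T; t' \<in> T; x \<in> D t; x \<in> D t'\<rbrakk> \<Longrightarrow> t = t'"
    and closed: "\<And>g t x. \<lbrakk>g \<in> carrier G; t \<in> T; x \<in> D t\<rbrakk> \<Longrightarrow> \<phi> g x \<in> D t"
    and iso: "\<And>t. t \<in> T \<Longrightarrow> rep_isomorphic G K (mono_rep G K (D t) \<phi> c) (V t)"
  shows "rep_isomorphic G K (mono_rep G K E \<phi> c) (direct_sum_rep T V)"
proof -
  have D: "monomial_action G K (D t) \<phi> c" if "t \<in> T" for t
    using that closed E by (intro monomial_action_subset) auto
  have "\<exists>f. \<forall>t\<in>T. linear_representation G K (V t) \<and>
      bij_betw (f t) (carrier (free_module K (D t))) (carrier (V t)) \<and>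
      linear_on K (free_module K (D t)) (V t) (f t) \<and>
      (\<forall>g\<in>carrier G. \<forall>u\<in>carrier (free_module K (D t)).
        f t (act (mono_rep G K (D t) \<phi> c) g u) = act (V t) g (f t u))"
  proof (intro bchoice ballI)
    fix t assume "t \<in> T"
    show "\<exists>f. linear_representation G K (V t) \<and>
      bij_betw f (carrier (free_module K (D t))) (carrier (V t)) \<and>
      linear_on K (free_module K (D t)) (V t) f \<and>
      (\<forall>g\<in>carrier G. \<forall>u\<in>carrier (free_module K (D t)).
        f (act (mono_rep G K (D t) \<phi> c) g u) = act (V t) g (f u))"
      using iso[OF \<open>t \<in> T\<close>] by (rule rep_isomorphicE) auto
  qed
  then obtain f where V: "\<And>t. t \<in> T \<Longrightarrow> linear_representation G K (V t)"
    and bij: "\<And>t. t \<in> T \<Longrightarrow> bij_betw (f t) (carrier (free_module K (D t))) (carrier (V t))"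
    and lin: "\<And>t. t \<in> T \<Longrightarrow> linear_on K (free_module K (D t)) (V t) (f t)"
    and equiv: "\<And>t g u. \<lbrakk>t \<in> T; g \<in> carrier G; u \<in> carrier (free_module K (D t))\<rbrakk>
      \<Longrightarrow> f t (act (mono_rep G K (D t) \<phi> c) g u) = act (V t) g (f t u)"
    by blast
  define r where "r t u = (\<lambda>x. if x \<in> D t then u x else \<zero>\<^bsub>K\<^esub>)" for t and u :: "'x \<Rightarrow> 'a"
  have r: "r t u \<in> carrier (free_module K (D t))"
    if "t \<in> T" "u \<in> carrier (free_module K E)" for t u
    using that by (simp add: monomial_action.carrier_free_module_iff[OF D] carrier_free_module_iff r_def)
  define p where "p u = (\<lambda>t\<in>T. f t (r t u))" for u
  show ?thesis
  proof (rule rep_isomorphic_transport[OF linear_representation_mono_rep, where f = p])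
    show "bij_betw p (carrier (mono_rep G K E \<phi> c)) (carrier (direct_sum_rep T V))"
      unfolding mono_rep_simps carrier_direct_sum_rep_finite[OF T]
    proof (rule bij_betw_imageI)
      show "inj_on p (carrier (free_module K E))"
      proof (rule inj_onI, rule ext)
        fix u v x assume u: "u \<in> carrier (free_module K E)" and v: "v \<in> carrier (free_module K E)"
          and eq: "p u = p v"
        show "u x = v x"
        proof (cases "x \<in> E")
          case True
          then obtain t where t: "t \<in> T" "x \<in> D t" using E by blast
          have "f t (r t u) = f t (r t v)" using fun_cong[OF eq, of t] t(1) by (simp add: p_def)
          then have "r t u = r t v"
            using bij[OF t(1)] r[OF t(1) u] r[OF t(1) v] by (auto simp: bij_betw_def dest: inj_onD)
          from fun_cong[OF this, of x] show ?thesis using t(2) by (simp add: r_def)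
        next
          case False
          then show ?thesis using u v by (simp add: carrier_free_module_iff)
        qed
      qed
      show "p ` carrier (free_module K E) = (\<Pi>\<^sub>E t\<in>T. carrier (V t))"
      proof
        show "p ` carrier (free_module K E) \<subseteq> (\<Pi>\<^sub>E t\<in>T. carrier (V t))"
          using r linear_onD(1)[OF lin] by (auto simp: p_def)
        show "(\<Pi>\<^sub>E t\<in>T. carrier (V t)) \<subseteq> p ` carrier (free_module K E)"
        proof
          fix w assume w: "w \<in> (\<Pi>\<^sub>E t\<in>T. carrier (V t))"
          have "\<exists>s. \<forall>t\<in>T. s t \<in> carrier (free_module K (D t)) \<and> f t (s t) = w t"
          proof (intro bchoice ballI)
            fix t assume "t \<in> T"
            then show "\<exists>u. u \<in> carrier (free_module K (D t)) \<and> f t u = w t"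
              using w bij[OF \<open>t \<in> T\<close>] PiE_mem[OF w \<open>t \<in> T\<close>] unfolding bij_betw_def by (metis image_iff)
          qed
          then obtain s where s: "\<And>t. t \<in> T \<Longrightarrow> s t \<in> carrier (free_module K (D t))"
              "\<And>t. t \<in> T \<Longrightarrow> f t (s t) = w t" by blast
          \<comment> \<open>The index of the block containing x. It is unique by disjointness, so
            the family s glues to one function on \<open>E\<close>.\<close>
          have "\<exists>q. \<forall>x\<in>E. q x \<in> T \<and> x \<in> D (q x)" using E by (intro bchoice) auto
          then obtain q where q: "\<And>x. x \<in> E \<Longrightarrow> q x \<in> T" "\<And>x. x \<in> E \<Longrightarrow> x \<in> D (q x)" by blast
          define u where "u x = (if x \<in> E then s (q x) x else \<zero>\<^bsub>K\<^esub>)" for x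
          have "s (q x) y \<in> carrier K" if "x \<in> E" for x y
            using s(1)[OF q(1)[OF that]] by (simp add: free_module_simps(1))
          then have u: "u \<in> carrier (free_module K E)"
            by (simp add: carrier_free_module_iff u_def)
          have "r t u = s t" if t: "t \<in> T" for t
          proof
            fix x
            show "r t u x = s t x"
            proof (cases "x \<in> D t")
              case True
              then have x: "x \<in> E" using t E by blast
              then have "q x = t" using disj[OF q(1)[OF x] t q(2)[OF x] True] by simp
              then show ?thesis using True x by (simp add: r_def u_def)
            next
              case False
              then show ?thesis
                using s(1)[OF t] by (simp add: r_def monomial_action.carrier_free_module_iff[OF D[OF t]])
            qed
          qed
          then have "p u = w"
            using w s(2) by (intro ext) (auto simp: p_def PiE_iff extensional_def)
          then show "w \<in> p ` carrier (free_module K E)" using u by blast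
        qed
      qed
    qed
    have "r t \<zero>\<^bsub>free_module K E\<^esub> = \<zero>\<^bsub>free_module K (D t)\<^esub>" for t
      by (simp add: r_def free_module_simps(2))
    moreover have "f t \<zero>\<^bsub>free_module K (D t)\<^esub> = \<zero>\<^bsub>V t\<^esub>" if "t \<in> T" for t
      using linear_on_zero[OF K.module_free_module linear_representation.axioms(3)[OF V[OF that]] lin[OF that]] .
    ultimately show "p \<zero>\<^bsub>mono_rep G K E \<phi> c\<^esub> = \<zero>\<^bsub>direct_sum_rep T V\<^esub>"
      by (auto simp: p_def)
  next
    fix u assume "u \<in> carrier (mono_rep G K E \<phi> c)"
    then have u: "u \<in> carrier (free_module K E)" by simp
    show "p (u \<oplus>\<^bsub>mono_rep G K E \<phi> c\<^esub> v) = p u \<oplus>\<^bsub>direct_sum_rep T V\<^esub> p v"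
      if "v \<in> carrier (mono_rep G K E \<phi> c)" for v
    proof -
      have v: "v \<in> carrier (free_module K E)" using that by simp
      have "r t (u \<oplus>\<^bsub>free_module K E\<^esub> v) = r t u \<oplus>\<^bsub>free_module K (D t)\<^esub> r t v" for t
        by (auto simp: r_def free_module_simps(3))
      then show ?thesis
        using linear_onD(2)[OF lin r[OF _ u] r[OF _ v]] by (auto simp: p_def)
    qed
    show "p (k \<odot>\<^bsub>mono_rep G K E \<phi> c\<^esub> u) = k \<odot>\<^bsub>direct_sum_rep T V\<^esub> p u" if k: "k \<in> carrier K" for k
    proof -
      have "r t (k \<odot>\<^bsub>free_module K E\<^esub> u) = k \<odot>\<^bsub>free_module K (D t)\<^esub> r t u" for t
        using k by (auto simp: r_def free_module_simps(4))
      then show ?thesis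
        using linear_onD(3)[OF lin k r[OF _ u]] by (auto simp: p_def)
    qed
    show "p (act (mono_rep G K E \<phi> c) g u) = act (direct_sum_rep T V) g (p u)" if g: "g \<in> carrier G" for g
    proof -
      \<comment> \<open>The action on functions is written with g^-1, so invariance of the block
        under g^-1 is what makes restriction equivariant.\<close>
      have "r t (act (mono_rep G K E \<phi> c) g u) = act (mono_rep G K (D t) \<phi> c) g (r t u)" if t: "t \<in> T" for t
        using closed[OF _ t, of "inv\<^bsub>G\<^esub> g"] g E t by (auto simp: r_def act_mono_rep fun_eq_iff)
      then show ?thesis
        using equiv[OF _ g r[OF _ u]] by (auto simp: p_def)
    qed
  qed
qed

section \<open>The action on a transversal\<close>

context group
begin

lemma mult_inv_cancel:
  assumes "x \<in> carrier G" "y \<in> carrier G"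
  shows "x \<otimes> (inv x \<otimes> y) = y" and "inv x \<otimes> (x \<otimes> y) = y"
  using assms by (simp_all add: m_assoc[symmetric])

context
  fixes W I
  assumes W: "subgroup W G" and I: "left_transversal G W I"
begin

lemma transversal_closed: "i \<in> I \<Longrightarrow> i \<in> carrier G"
  using I by (auto simp: left_transversal_def)

text \<open>Here j lies in the coset xW exactly when j^-1 x lies in W, the two elements of W
  involved being inverse to each other. This turns the coset definition of a transversal into the
  condition that defines \<open>transversal_action\<close>.\<close>

lemma transversal_ex1:
  assumes x: "x \<in> carrier G"
  shows "\<exists>!j. j \<in> I \<and> inv j \<otimes> x \<in> W"
proof -
  have "x <# W \<in> lcosets W" using x by (auto simp: LCOSETS_def)
  then have "\<exists>!j. j \<in> I \<and> j \<in> x <# W"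
    using I by (simp add: left_transversal_def)
  moreover have "j \<in> x <# W \<longleftrightarrow> inv j \<otimes> x \<in> W" if "j \<in> I" for j
  proof
    have j: "j \<in> carrier G" by (rule transversal_closed[OF that])
    show "inv j \<otimes> x \<in> W" if "j \<in> x <# W"
    proof -
      from that obtain w where w: "w \<in> W" "j = x \<otimes> w" by (auto simp: l_coset_def)
      then have "inv j \<otimes> x = inv w"
        using x subgroup.mem_carrier[OF W] by (simp add: inv_mult_group m_assoc)
      then show ?thesis using w(1) subgroup.m_inv_closed[OF W] by simp
    qed
    show "j \<in> x <# W" if "inv j \<otimes> x \<in> W"
    proof -
      have "inv (inv j \<otimes> x) \<in> W" using that by (rule subgroup.m_inv_closed[OF W])
      moreover have "j = x \<otimes> inv (inv j \<otimes> x)"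
        using x j by (simp add: inv_mult_group m_assoc[symmetric])
      ultimately show ?thesis by (auto simp: l_coset_def)
    qed
  qed
  ultimately show ?thesis by blast
qed

lemma transversal_action_unique:
  assumes "g \<in> carrier G" "i \<in> I" "j \<in> I" "inv j \<otimes> g \<otimes> i \<in> W"
  shows "transversal_action G W I g i = j"
proof -
  have "\<exists>!j. j \<in> I \<and> inv j \<otimes> g \<otimes> i \<in> W"
    using transversal_ex1[of "g \<otimes> i"] assms(1,2) transversal_closed
    by (simp add: m_assoc cong: conj_cong)
  then show ?thesis
    using assms by (auto simp: transversal_action_def intro: the1_equality)
qed

lemma transversal_action:
  assumes "g \<in> carrier G" "i \<in> I"
  shows "transversal_action G W I g i \<in> I"
    and "inv (transversal_action G W I g i) \<otimes> g \<otimes> i \<in> W"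
proof -
  from transversal_ex1[of "g \<otimes> i"] obtain j where j: "j \<in> I" "inv j \<otimes> (g \<otimes> i) \<in> W"
    using assms transversal_closed by blast
  then have "inv j \<otimes> g \<otimes> i \<in> W"
    using assms transversal_closed by (simp add: m_assoc)
  moreover from this have "transversal_action G W I g i = j"
    using transversal_action_unique assms j(1) by blast
  ultimately show "transversal_action G W I g i \<in> I"
      "inv (transversal_action G W I g i) \<otimes> g \<otimes> i \<in> W"
    using j(1) by simp_all
qed

lemma transversal_action_eq_self_iff:
  assumes "g \<in> carrier G" "i \<in> I"
  shows "transversal_action G W I g i = i \<longleftrightarrow> inv i \<otimes> g \<otimes> i \<in> W"
  using transversal_action[OF assms] transversal_action_unique[OF assms assms(2)] by auto

text \<open>The action law and the cocycle identity both come from one factorization: the element of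
  \<open>W\<close> attached to gh at i is the one attached to g at h i times the one attached to h
  at i.\<close>

lemma monomial_action_transversal:
  assumes K: "field K" and fin: "finite I" and \<chi>: "\<chi> \<in> hom (G\<lparr>carrier := W\<rparr>) (units_of K)"
  shows "monomial_action G K I (transversal_action G W I)
    (\<lambda>g i. \<chi> (inv (transversal_action G W I g i) \<otimes> g \<otimes> i))"
proof -
  interpret K: field K by (rule K)
  let ?s = "transversal_action G W I"
  have \<chi>_Units: "\<chi> w \<in> Units K" if "w \<in> W" for w
    using \<chi> that by (auto simp: hom_def units_of_def)
  have \<chi>_mult: "\<chi> (v \<otimes> w) = \<chi> v \<otimes>\<^bsub>K\<^esub> \<chi> w" if "v \<in> W" "w \<in> W" for v w
    using \<chi> that by (auto simp: hom_def units_of_def)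
  \<comment> \<open>To be used with j = h i and l = g (h i) in the action on the transversal; both
    brackets then lie in \<open>W\<close>.\<close>
  have chain: "inv l \<otimes> (g \<otimes> h) \<otimes> i = (inv l \<otimes> g \<otimes> j) \<otimes> (inv j \<otimes> h \<otimes> i)"
    if "g \<in> carrier G" "h \<in> carrier G" "i \<in> I" "j \<in> I" "l \<in> I" for g h i j l
    using that by (simp add: m_assoc mult_inv_cancel transversal_closed)
  have s_mult: "?s (g \<otimes> h) i = ?s g (?s h i)"
    if g: "g \<in> carrier G" and h: "h \<in> carrier G" and i: "i \<in> I" for g h i
  proof (rule transversal_action_unique)
    note hi = transversal_action[OF h i]
    note ghi = transversal_action[OF g hi(1)]
    show "?s g (?s h i) \<in> I" by (rule ghi(1))
    show "inv (?s g (?s h i)) \<otimes> (g \<otimes> h) \<otimes> i \<in> W"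
      unfolding chain[OF g h i hi(1) ghi(1)] by (rule subgroup.m_closed[OF W ghi(2) hi(2)])
  qed (use g h i in auto)
  show ?thesis
  proof (intro monomial_action.intro monomial_action_axioms.intro)
    fix i assume i: "i \<in> I"
    show "?s \<one> i = i"
      using i transversal_closed[OF i] subgroup.one_closed[OF W] by (simp add: transversal_action_eq_self_iff)
    fix g assume g: "g \<in> carrier G"
    note gi = transversal_action[OF g i]
    show "?s g i \<in> I" by (rule gi(1))
    show "\<chi> (inv (?s g i) \<otimes> g \<otimes> i) \<in> carrier K" "\<chi> (inv (?s g i) \<otimes> g \<otimes> i) \<noteq> \<zero>\<^bsub>K\<^esub>"
      using \<chi>_Units[OF gi(2)] by (auto simp: K.field_Units)
  next
    fix g h i assume g: "g \<in> carrier G" and h: "h \<in> carrier G" and i: "i \<in> I"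
    note hi = transversal_action[OF h i]
    note ghi = transversal_action[OF g hi(1)]
    show "?s (g \<otimes> h) i = ?s g (?s h i)" by (rule s_mult[OF g h i])
    show "\<chi> (inv (?s (g \<otimes> h) i) \<otimes> (g \<otimes> h) \<otimes> i) =
        \<chi> (inv (?s g (?s h i)) \<otimes> g \<otimes> ?s h i) \<otimes>\<^bsub>K\<^esub> \<chi> (inv (?s h i) \<otimes> h \<otimes> i)"
      unfolding s_mult[OF g h i] chain[OF g h i hi(1) ghi(1)] by (rule \<chi>_mult[OF ghi(2) hi(2)])
  qed (fact is_group K fin)+
qed

text \<open>The base point is the representative x of the coset \<open>W\<close>, which may differ
  from the identity. Its stabilizer, the conjugate of \<open>W\<close> by x, is \<open>W\<close>
  again because x lies in \<open>W\<close>. For the same reason conjugation by x does not change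
  \<chi>.\<close>

lemma ind_rep_transversal_isomorphic:
  assumes K: "field K" and fin: "finite I" and \<chi>: "\<chi> \<in> hom (G\<lparr>carrier := W\<rparr>) (units_of K)"
  shows "rep_isomorphic G K (ind_rep G K W \<chi>) (mono_rep G K I (transversal_action G W I)
    (\<lambda>g i. \<chi> (inv (transversal_action G W I g i) \<otimes> g \<otimes> i)))"
proof -
  interpret K: field K by (rule K)
  interpret A: monomial_action G K I "transversal_action G W I"
      "\<lambda>g i. \<chi> (inv (transversal_action G W I g i) \<otimes> g \<otimes> i)"
    by (rule monomial_action_transversal[OF K fin \<chi>])
  have \<chi>_closed: "\<chi> w \<in> carrier K" and \<chi>_Units: "\<chi> w \<in> Units K" if "w \<in> W" for w
    using \<chi> that by (auto simp: hom_def units_of_def)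
  have \<chi>_mult: "\<chi> (v \<otimes> w) = \<chi> v \<otimes>\<^bsub>K\<^esub> \<chi> w" if "v \<in> W" "w \<in> W" for v w
    using \<chi> that by (auto simp: hom_def units_of_def)
  have \<chi>_one: "\<chi> \<one> = \<one>\<^bsub>K\<^esub>"
  proof -
    have one: "\<one> \<in> W" by (rule subgroup.one_closed[OF W])
    have nz: "\<chi> \<one> \<noteq> \<zero>\<^bsub>K\<^esub>" using \<chi>_Units[OF one] by (auto simp: K.field_Units)
    have "\<chi> \<one> \<otimes>\<^bsub>K\<^esub> \<chi> \<one> = \<chi> \<one> \<otimes>\<^bsub>K\<^esub> \<one>\<^bsub>K\<^esub>"
      using \<chi>_mult[OF one one] \<chi>_closed[OF one] by simp
    then show ?thesis
      using K.m_lcancel[OF nz \<chi>_closed[OF one] \<chi>_closed[OF one] K.one_closed] by blast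
  qed
  obtain x where x: "x \<in> I" "inv x \<in> W"
    using transversal_ex1[of \<one>] transversal_closed by auto
  then have xG: "x \<in> carrier G" and xW: "x \<in> W"
    using transversal_closed subgroup.m_inv_closed[OF W, of "inv x"] by auto
  have "rep_isomorphic G K (mono_rep G K I (transversal_action G W I)
    (\<lambda>g i. \<chi> (inv (transversal_action G W I g i) \<otimes> g \<otimes> i))) (ind_rep G K W \<chi>)"
  proof (rule A.ind_rep_isomorphic[OF x(1)])
    fix i assume i: "i \<in> I"
    then have iG: "i \<in> carrier G" by (rule transversal_closed)
    \<comment> \<open>Since i^-1 (i x^-1) x is the identity, an element of \<open>W\<close>.\<close>
    have "transversal_action G W I (i \<otimes> inv x) x = i"
      using i iG x xG subgroup.one_closed[OF W]
      by (intro transversal_action_unique) (simp_all add: m_assoc)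
    then show "\<exists>g\<in>carrier G. transversal_action G W I g x = i"
      using iG xG by (intro bexI[of _ "i \<otimes> inv x"]) auto
  next
    have "inv x \<otimes> g \<otimes> x \<in> W \<longleftrightarrow> g \<in> W" if g: "g \<in> carrier G" for g
    proof
      assume "inv x \<otimes> g \<otimes> x \<in> W"
      then have "x \<otimes> (inv x \<otimes> g \<otimes> x) \<otimes> inv x \<in> W"
        by (rule subgroup.m_closed[OF W subgroup.m_closed[OF W xW] x(2)])
      moreover have "x \<otimes> (inv x \<otimes> g \<otimes> x) \<otimes> inv x = g"
        using g xG by (simp add: m_assoc mult_inv_cancel)
      ultimately show "g \<in> W" by simp
    next
      assume "g \<in> W"
      then show "inv x \<otimes> g \<otimes> x \<in> W"
        by (rule subgroup.m_closed[OF W subgroup.m_closed[OF W x(2)] xW])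
    qed
    then show "W = {g \<in> carrier G. transversal_action G W I g x = x}"
      using subgroup.mem_carrier[OF W] x(1) by (auto simp: transversal_action_eq_self_iff)
  next
    fix h assume h: "h \<in> W"
    have "transversal_action G W I h x = x"
      using subgroup.mem_carrier[OF W h] x(1) subgroup.m_closed[OF W subgroup.m_closed[OF W x(2) h] xW]
      by (simp add: transversal_action_eq_self_iff)
    \<comment> \<open>All three factors lie in \<open>W\<close>, so \<chi> splits, and commutativity
      of K brings the values at x^-1 and x together.\<close>
    then have "\<chi> (inv (transversal_action G W I h x) \<otimes> h \<otimes> x) = \<chi> (inv x) \<otimes>\<^bsub>K\<^esub> \<chi> h \<otimes>\<^bsub>K\<^esub> \<chi> x"
      using h x(2) xW by (simp add: \<chi>_mult subgroup.m_closed[OF W])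
    also have "\<dots> = \<chi> h \<otimes>\<^bsub>K\<^esub> \<chi> (inv x \<otimes> x)"
      using h x(2) xW by (simp add: \<chi>_mult \<chi>_closed K.m_ac)
    also have "\<dots> = \<chi> h" using h xG by (simp add: \<chi>_one \<chi>_closed)
    finally show "\<chi> h = \<chi> (inv (transversal_action G W I h x) \<otimes> h \<otimes> x)" by simp
  qed
  then show ?thesis by (rule rep_isomorphic_sym)
qed

end

end

lemma (in group) mem_conj_iff:
  assumes W: "subgroup W G" and x: "x \<in> carrier G"
  shows "g \<in> x <# W #> inv x \<longleftrightarrow> g \<in> carrier G \<and> inv x \<otimes> g \<otimes> x \<in> W"
proof
  assume "g \<in> x <# W #> inv x"
  then obtain w where w: "w \<in> W" "g = x \<otimes> w \<otimes> inv x" by (auto simp: l_coset_def r_coset_def)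
  then have "w \<in> carrier G" using subgroup.mem_carrier[OF W] by blast
  with w x have "inv x \<otimes> g \<otimes> x = w" by (simp add: m_assoc mult_inv_cancel)
  then show "g \<in> carrier G \<and> inv x \<otimes> g \<otimes> x \<in> W"
    using w x \<open>w \<in> carrier G\<close> by simp
next
  assume g: "g \<in> carrier G \<and> inv x \<otimes> g \<otimes> x \<in> W"
  then have "g = x \<otimes> (inv x \<otimes> g \<otimes> x) \<otimes> inv x"
    using x by (simp add: m_assoc mult_inv_cancel)
  then show "g \<in> x <# W #> inv x" using g by (auto simp: l_coset_def r_coset_def)
qed

section \<open>Stabilizers and orbits of a monomial action\<close>

context monomial_action
begin

lemma subgroup_stabilizer: "x \<in> E \<Longrightarrow> subgroup {g \<in> carrier G. \<phi> g x = x} G"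
  by (rule G.subgroupI) (auto simp: \<phi>_mult intro!: exI[of _ "\<one>\<^bsub>G\<^esub>"] \<phi>_one dest: \<phi>_inv(1))

text \<open>Where h fixes x, the cocycle identity reads
  \<open>c (g h) x = c g x c h x\<close>.\<close>

lemma hom_stabilizer:
  assumes x: "x \<in> E"
  shows "restrict (\<lambda>g. c g x) {g \<in> carrier G. \<phi> g x = x}
    \<in> hom (G\<lparr>carrier := {g \<in> carrier G. \<phi> g x = x}\<rparr>) (units_of K)"
  using x c_closed[OF _ x] c_nonzero[OF _ x]
  by (auto simp: hom_def units_of_def K.field_Units c_mult \<phi>_mult)

lemma \<phi>_orbit_closed:
  assumes x: "x \<in> E" and y: "y \<in> orbit G \<phi> x" and g: "g \<in> carrier G"
  shows "\<phi> g y \<in> orbit G \<phi> x"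
proof -
  obtain h where h: "h \<in> carrier G" "y = \<phi> h x" using y by (auto simp: orbit_def)
  then have "\<phi> g y = \<phi> (g \<otimes>\<^bsub>G\<^esub> h) x" using x g by (simp add: \<phi>_mult)
  then show ?thesis using g h(1) by (auto simp: orbit_def)
qed

lemma orbit_subset: "x \<in> E \<Longrightarrow> orbit G \<phi> x \<subseteq> E"
  by (auto simp: orbit_def \<phi>_closed)

lemma mem_orbit_self: "x \<in> E \<Longrightarrow> x \<in> orbit G \<phi> x"
  unfolding orbit_def using \<phi>_one[of x] G.one_closed by (metis (mono_tags, lifting) mem_Collect_eq)

lemma orbit_eqI:
  assumes x: "x \<in> E" and y: "y \<in> orbit G \<phi> x"
  shows "orbit G \<phi> y = orbit G \<phi> x"
proof -
  obtain g where g: "g \<in> carrier G" "y = \<phi> g x" using y by (auto simp: orbit_def)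
  have yE: "y \<in> E" using orbit_subset[OF x] y by blast
  have "x = \<phi> (inv\<^bsub>G\<^esub> g) y" using g x by simp
  then have "x \<in> orbit G \<phi> y" using g(1) by (auto simp: orbit_def)
  have "orbit G \<phi> u \<subseteq> orbit G \<phi> v" if "v \<in> E" "u \<in> orbit G \<phi> v" for u v
  proof
    fix z assume "z \<in> orbit G \<phi> u"
    then obtain h where "h \<in> carrier G" "z = \<phi> h u" by (auto simp: orbit_def)
    then show "z \<in> orbit G \<phi> v" using \<phi>_orbit_closed[OF that] by simp
  qed
  from this[OF x y] this[OF yE \<open>x \<in> orbit G \<phi> y\<close>] show ?thesis by blast
qed

text \<open>The orbits are the invariant blocks; each is transitive, with its representative as base
  point. Values of \<open>\<psi> t\<close> are prescribed on the stabilizer alone, so a restricted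
  function such as \<open>psi\<close> is admissible.\<close>

lemma mono_rep_orbit_decomposition:
  assumes T: "orbit_representatives G E \<phi> T"
    and \<psi>: "\<And>t h. \<lbrakk>t \<in> T; h \<in> carrier G; \<phi> h t = t\<rbrakk> \<Longrightarrow> \<psi> t h = c h t"
  shows "rep_isomorphic G K (mono_rep G K E \<phi> c)
    (direct_sum_rep T (\<lambda>t. ind_rep G K {g \<in> carrier G. \<phi> g t = t} (\<psi> t)))"
proof -
  have TE: "T \<subseteq> E" and ex1: "\<And>x. x \<in> E \<Longrightarrow> \<exists>!t. t \<in> T \<and> t \<in> orbit G \<phi> x"
    using T by (auto simp: orbit_representatives_def orbits_def)
  show ?thesis
  proof (rule mono_rep_direct_sum[where D = "orbit G \<phi>"])
    show "finite T" using TE finite_E by (rule finite_subset)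
    show "E = (\<Union>t\<in>T. orbit G \<phi> t)"
    proof
      show "(\<Union>t\<in>T. orbit G \<phi> t) \<subseteq> E" using TE orbit_subset by blast
      show "E \<subseteq> (\<Union>t\<in>T. orbit G \<phi> t)"
      proof
        fix x assume x: "x \<in> E"
        from ex1[OF x] obtain t where "t \<in> T" "t \<in> orbit G \<phi> x" by blast
        then show "x \<in> (\<Union>t\<in>T. orbit G \<phi> t)"
          using orbit_eqI[OF x] mem_orbit_self[OF x] by blast
      qed
    qed
    show "t = t'" if t: "t \<in> T" "t' \<in> T" and x: "x \<in> orbit G \<phi> t" "x \<in> orbit G \<phi> t'" for t t' x
    proof -
      have tE: "t \<in> E" "t' \<in> E" using t TE by auto
      have "orbit G \<phi> t = orbit G \<phi> t'" using orbit_eqI[OF tE(1) x(1)] orbit_eqI[OF tE(2) x(2)] by simp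
      then show ?thesis
        using ex1[OF tE(1)] t mem_orbit_self[OF tE(1)] mem_orbit_self[OF tE(2)] by blast
    qed
    show "\<phi> g x \<in> orbit G \<phi> t" if "g \<in> carrier G" "t \<in> T" "x \<in> orbit G \<phi> t" for g t x
      using \<phi>_orbit_closed that TE by blast
    fix t assume t: "t \<in> T"
    then have tE: "t \<in> E" using TE by blast
    interpret O: monomial_action G K "orbit G \<phi> t" \<phi> c
      using tE \<phi>_orbit_closed orbit_subset by (intro monomial_action_subset) auto
    show "rep_isomorphic G K (mono_rep G K (orbit G \<phi> t) \<phi> c)
        (ind_rep G K {g \<in> carrier G. \<phi> g t = t} (\<psi> t))"
    proof (rule O.ind_rep_isomorphic[OF mem_orbit_self[OF tE] _ refl])
      show "\<exists>g\<in>carrier G. \<phi> g t = x" if "x \<in> orbit G \<phi> t" for x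
        using that by (auto simp: orbit_def)
      show "\<psi> t h = c h t" if "h \<in> {g \<in> carrier G. \<phi> g t = t}" for h
        using that \<psi>[OF t] by simp
    qed
  qed
qed

end

section \<open>The tensor product decomposed over the orbits on the product of the
  transversals\<close>

theorem theorem2p1p1:
  fixes K :: "('a, 'n) ring_scheme" and d k :: nat
    and W I :: "nat \<Rightarrow> (nat \<Rightarrow> nat) set"
    and \<chi> :: "nat \<Rightarrow> (nat \<Rightarrow> nat) \<Rightarrow> 'a"
    and T :: "(nat \<Rightarrow> nat \<Rightarrow> nat) set"
  assumes "algebraically_closed K"
    and "\<And>n::nat. n > 0 \<Longrightarrow> [n] \<cdot>\<^bsub>K\<^esub> \<one>\<^bsub>K\<^esub> \<noteq> \<zero>\<^bsub>K\<^esub>"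
    and "d \<ge> 1" and "k \<ge> 1"
    and "\<And>m. m \<in> {1..k} \<Longrightarrow> subgroup (W m) (sym_group d)"
    and "\<And>m. m \<in> {1..k} \<Longrightarrow> \<chi> m \<in> hom (sym_group d\<lparr>carrier := W m\<rparr>) (units_of K)"
    and "\<And>m. m \<in> {1..k} \<Longrightarrow> left_transversal (sym_group d) (W m) (I m)"
    and "orbit_representatives (sym_group d) (\<Pi>\<^sub>E m\<in>{1..k}. I m)
           (product_action (sym_group d) {1..k} W I) T"
  shows "(\<forall>\<omega>\<in>T. subgroup (conj_intersection (sym_group d) {1..k} W \<omega>) (sym_group d) \<and>
            psi (sym_group d) K {1..k} W I \<chi> \<omega>
              \<in> hom (sym_group d\<lparr>carrier := conj_intersection (sym_group d) {1..k} W \<omega>\<rparr>) (units_of K)) \<and>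
         rep_isomorphic (sym_group d) K
           (tensor_rep K {1..k} (\<lambda>m. ind_rep (sym_group d) K (W m) (\<chi> m)))
           (direct_sum_rep T (\<lambda>\<omega>. ind_rep (sym_group d) K
              (conj_intersection (sym_group d) {1..k} W \<omega>) (psi (sym_group d) K {1..k} W I \<chi> \<omega>)))"
proof -
  define G where "G = sym_group d"
  define J where "J = {1..k}"
  have K: "field K" using assms(1) by (rule algebraically_closed.axioms(1))
  have G: "group G" unfolding G_def by (rule sym_group_is_group)
  interpret G: group G by (rule G)
  interpret K: field K by (rule K)
  have J: "finite J" "J \<noteq> {}" using assms(4) by (auto simp: J_def)
  note hyps = assms(5-8)[folded G_def J_def]
  have finG: "finite (carrier G)"
    by (simp add: G_def sym_group_def finite_permutations)
  have fin: "finite (I m)" if "m \<in> J" for m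
    using hyps(3)[OF that] finG by (auto simp: left_transversal_def intro: finite_subset)
  define E where "E = (\<Pi>\<^sub>E m\<in>J. I m)"
  define \<phi> where "\<phi> = product_action G J W I"
  define c where "c = (\<lambda>g \<omega>. beta G K J W I \<chi> \<omega> g)"
  note mono = G.monomial_action_transversal[OF hyps(1) hyps(3) K fin hyps(2)]
  note ind = G.ind_rep_transversal_isomorphic[OF hyps(1) hyps(3) K fin hyps(2)]
  have \<phi>: "\<phi> g \<omega> = (\<lambda>m\<in>J. transversal_action G (W m) (I m) g (\<omega> m))" if "\<omega> \<in> (\<Pi>\<^sub>E m\<in>J. I m)" for g \<omega>
    using that by (simp add: \<phi>_def product_action_def)
  \<comment> \<open>Identifies \<open>beta\<close> as the product of the cocycles of the single
    transversals.\<close>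
  have c: "c g \<omega> = (\<Otimes>\<^bsub>K\<^esub>m\<in>J. \<chi> m (inv\<^bsub>G\<^esub> transversal_action G (W m) (I m) g (\<omega> m) \<otimes>\<^bsub>G\<^esub> g \<otimes>\<^bsub>G\<^esub> \<omega> m))" for g \<omega>
    by (simp add: c_def beta_def)
  interpret E: monomial_action G K E \<phi> c
    unfolding E_def by (rule monomial_action_PiE[OF G K J(1) mono \<phi> c])
  have T: "orbit_representatives G E \<phi> T" using hyps(4) by (simp add: E_def \<phi>_def)
  then have TE: "T \<subseteq> E" by (simp add: orbit_representatives_def)
  \<comment> \<open>A tuple is fixed exactly when all its entries are, and the entry at m is fixed
    exactly when g lies in the conjugate of \<open>W m\<close> by it.\<close>
  have stab: "conj_intersection G J W \<omega> = {g \<in> carrier G. \<phi> g \<omega> = \<omega>}" if "\<omega> \<in> E" for \<omega>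
  proof -
    have \<omega>: "\<omega> m \<in> I m" if "m \<in> J" for m using \<open>\<omega> \<in> E\<close> that by (auto simp: E_def)
    have \<omega>G: "\<omega> m \<in> carrier G" if "m \<in> J" for m
      using G.transversal_closed[OF hyps(1)[OF that] hyps(3)[OF that] \<omega>[OF that]] .
    have "\<phi> g \<omega> = \<omega> \<longleftrightarrow> (\<forall>m\<in>J. inv\<^bsub>G\<^esub> \<omega> m \<otimes>\<^bsub>G\<^esub> g \<otimes>\<^bsub>G\<^esub> \<omega> m \<in> W m)" if g: "g \<in> carrier G" for g
    proof -
      have "\<phi> g \<omega> = \<omega> \<longleftrightarrow> (\<forall>m\<in>J. \<phi> g \<omega> m = \<omega> m)"
        using PiE_ext[OF E.\<phi>_closed[OF g \<open>\<omega> \<in> E\<close>, unfolded E_def] \<open>\<omega> \<in> E\<close>[unfolded E_def]] by auto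
      also have "\<dots> \<longleftrightarrow> (\<forall>m\<in>J. transversal_action G (W m) (I m) g (\<omega> m) = \<omega> m)"
        using \<open>\<omega> \<in> E\<close> by (simp add: \<phi> E_def)
      also have "\<dots> \<longleftrightarrow> (\<forall>m\<in>J. inv\<^bsub>G\<^esub> \<omega> m \<otimes>\<^bsub>G\<^esub> g \<otimes>\<^bsub>G\<^esub> \<omega> m \<in> W m)"
        using G.transversal_action_eq_self_iff[OF hyps(1) hyps(3) g \<omega>] by simp
      finally show ?thesis .
    qed
    \<comment> \<open>Here \<open>J\<close> must be non-empty: an intersection over no index would
      be the whole type instead of the group.\<close>
    moreover have "conj_intersection G J W \<omega> =
        {g \<in> carrier G. \<forall>m\<in>J. inv\<^bsub>G\<^esub> \<omega> m \<otimes>\<^bsub>G\<^esub> g \<otimes>\<^bsub>G\<^esub> \<omega> m \<in> W m}"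
      using J(2) by (auto simp: conj_intersection_def G.mem_conj_iff[OF hyps(1) \<omega>G])
    ultimately show ?thesis by auto
  qed
  \<comment> \<open>So \<open>psi\<close> is the cocycle at \<omega> on the stabilizer of \<omega>,
    to which \<open>hom_stabilizer\<close> applies.\<close>
  have psi: "psi G K J W I \<chi> \<omega> = restrict (\<lambda>g. c g \<omega>) {g \<in> carrier G. \<phi> g \<omega> = \<omega>}" if "\<omega> \<in> E" for \<omega>
    by (simp add: psi_def c_def stab[OF that])
  have chars: "\<forall>\<omega>\<in>T. subgroup (conj_intersection G J W \<omega>) G \<and>
      psi G K J W I \<chi> \<omega> \<in> hom (G\<lparr>carrier := conj_intersection G J W \<omega>\<rparr>) (units_of K)"
  proof
    fix \<omega> assume "\<omega> \<in> T"
    then have \<omega>: "\<omega> \<in> E" using TE by blast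
    show "subgroup (conj_intersection G J W \<omega>) G \<and>
        psi G K J W I \<chi> \<omega> \<in> hom (G\<lparr>carrier := conj_intersection G J W \<omega>\<rparr>) (units_of K)"
      unfolding stab[OF \<omega>] psi[OF \<omega>] using E.subgroup_stabilizer[OF \<omega>] E.hom_stabilizer[OF \<omega>] by blast
  qed
  have "rep_isomorphic G K (mono_rep G K (\<Pi>\<^sub>E m\<in>J. I m) \<phi> c)
      (tensor_rep K J (\<lambda>m. ind_rep G K (W m) (\<chi> m)))"
    by (rule tensor_rep_isomorphic[OF G K J(1) mono ind \<phi> c])
  then have tensor: "rep_isomorphic G K (tensor_rep K J (\<lambda>m. ind_rep G K (W m) (\<chi> m))) (mono_rep G K E \<phi> c)"
    unfolding E_def by (rule rep_isomorphic_sym)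
  have "rep_isomorphic G K (mono_rep G K E \<phi> c)
      (direct_sum_rep T (\<lambda>\<omega>. ind_rep G K {g \<in> carrier G. \<phi> g \<omega> = \<omega>} (psi G K J W I \<chi> \<omega>)))"
    using TE by (intro E.mono_rep_orbit_decomposition[OF T]) (auto simp: psi)
  also have "direct_sum_rep T (\<lambda>\<omega>. ind_rep G K {g \<in> carrier G. \<phi> g \<omega> = \<omega>} (psi G K J W I \<chi> \<omega>)) =
      direct_sum_rep T (\<lambda>\<omega>. ind_rep G K (conj_intersection G J W \<omega>) (psi G K J W I \<chi> \<omega>))"
    using stab TE by (intro direct_sum_rep_cong) auto
  finally show ?thesis
    using chars rep_isomorphic_trans[OF tensor] unfolding G_def J_def by blast
qed

end
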